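(* Let $(w_0,\ldots,w_n)$ and $(v_0,\ldots,v_m)$ be positive integer weights, let $\ell\ge1$, and let $p(x_1,\ldots,x_n)$ and $q(y_1,\ldots,y_m)$ be quasi-smooth weighted homogeneous polynomials of degrees $\ell w_0$ and $\ell v_0$ respectively. Put $$V_1=\{x_0^\ell+p=0\}\subset\mathbf{P}_{(w_0,\ldots,w_n)},\quad V_2=\{y_0^\ell+q=0\}\subset\mathbf{P}_{(v_0,\ldots,v_m)},\quad V=V_1\times V_2,$$ $$X=\{p(z_1,\ldots,z_n)-q(t_1,\ldots,t_m)=0\}\subset\mathbf{P}_{(v_0w_1,\ldots,v_0w_n,w_0v_1,\ldots,w_0v_m)},$$ and let the group $\boldsymbol{\mu}_\ell$ of $\ell$-th roots of unity act on $V$ by $\gamma\cdot((x_0:\cdots:x_n),(y_0:\cdots:y_m))=((\gamma x_0:x_1:\cdots:x_n),(\gamma y_0:y_1:\cdots:y_m))$. Let $\tilde V$ be a resolution of singularities of $V$ to which the action of $\boldsymbol{\mu}_\ell$ lifts, and let $\tilde X$ be a resolution of singularities of $X$; the twist map $\Phi:V\dashrightarrow X$ then lifts to a map $\tilde\Phi:\tilde V\to\tilde X$ that forms a commutative diagram with $\Phi$ and the resolutions $\tilde V\to V$, $\tilde X\to X$. Under these assumptions, $\tilde X$ is a resolution of the quotients $(V_1\times V_2)/\boldsymbol{\mu}_\ell$ and $\tilde V/\boldsymbol{\mu}_\ell$.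
   Context: All varieties are over $\mathbf{C}$. $\mathbf{P}_{(w_0,\ldots,w_n)}$ is the weighted projective space, the quotient of $\mathbf{C}^{n+1}\setminus\{0\}$ by $\mathbf{C}^*$ acting by $t\cdot(z_0,\ldots,z_n)=(t^{w_0}z_0,\ldots,t^{w_n}z_n)$. The weights $(w_0,\ldots,w_n)$ and $(v_0,\ldots,v_m)$ are assumed normalized: no $n$ of the $n+1$ weights $w_i$ (respectively no $m$ of the $m+1$ weights $v_j$) have a common divisor $>1$. A weighted homogeneous polynomial is quasi-smooth if its affine zero set is smooth outside the origin. The twist map is $$\Phi:((x_0,\ldots,x_n),(y_0,\ldots,y_m))\mapsto\bigl(y_0^{w_1/w_0}x_1,\ldots,y_0^{w_n/w_0}x_n,\,x_0^{v_1/v_0}y_1,\ldots,x_0^{v_m/v_0}y_m\bigr),$$ where the fractional powers are powers of a $w_0$-th root of $y_0$ and of a $v_0$-th root of $x_0$.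
   Formalization: In the conclusion, "resolution of the quotients" means that X~ is smooth, complete and has a birational map (not necessarily a morphism, for which the claim fails) to each quotient, compatible with Φ~; the lift Φ~ of a single-valued Φ is assumed, possibly only as a rational map. *)

theory Defs
  imports "HOL-Analysis.Analysis" "HOL-Library.Poly_Mapping"
begin

section \<open>Polynomials in the variables $x_0, x_1, \ldots$ over the complex numbers\<close>

type_synonym cpoly = "(nat \<Rightarrow>\<^sub>0 nat) \<Rightarrow>\<^sub>0 complex"

definition poly_eval :: "cpoly \<Rightarrow> (nat \<Rightarrow> complex) \<Rightarrow> complex" where
  "poly_eval P x =
     (\<Sum>m\<in>Poly_Mapping.keys P. Poly_Mapping.lookup P m *
        (\<Prod>i\<in>Poly_Mapping.keys m. x i ^ Poly_Mapping.lookup m i))"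

definition poly_vars :: "cpoly \<Rightarrow> nat set" where
  "poly_vars P = (\<Union>m\<in>Poly_Mapping.keys P. Poly_Mapping.keys m)"

definition partial_deriv :: "nat \<Rightarrow> cpoly \<Rightarrow> (nat \<Rightarrow> complex) \<Rightarrow> complex" where
  "partial_deriv i P x = deriv (\<lambda>t. poly_eval P (x(i := t))) (x i)"

definition weighted_homogeneous :: "(nat \<Rightarrow> nat) \<Rightarrow> nat \<Rightarrow> cpoly \<Rightarrow> bool" where
  "weighted_homogeneous w d P \<longleftrightarrow>
     (\<forall>m\<in>Poly_Mapping.keys P. (\<Sum>i\<in>Poly_Mapping.keys m. w i * Poly_Mapping.lookup m i) = d)"

text \<open>Smoothness of the zero set is that of the scheme $P = 0$ in the affine space with
  coordinates indexed by \<open>I\<close>: a repeated factor of \<open>P\<close>, or \<open>P = 0\<close>, is excluded.\<close>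

definition quasi_smooth :: "nat set \<Rightarrow> cpoly \<Rightarrow> bool" where
  "quasi_smooth I P \<longleftrightarrow>
     (\<forall>x. (\<forall>i. i \<notin> I \<longrightarrow> x i = 0) \<and> x \<noteq> (\<lambda>_. 0) \<and> poly_eval P x = 0
        \<longrightarrow> (\<exists>i\<in>I. partial_deriv i P x \<noteq> 0))"

section \<open>Spaces with functions\<close>

text \<open>Varieties are understood in the sense of Serre: topological spaces with a sheaf of
  complex-valued functions that are locally isomorphic to closed subsets of affine space. They are
  not required to be irreducible (the hypersurfaces below are finite sets of points when \<open>n = 1\<close>).
  Functions are total in HOL, and only the values of an element of \<open>reg S U\<close> on \<open>U\<close> matter;
  \<open>reg S U\<close> is meaningful for open \<open>U\<close> only.\<close>

record 'a fspace =
  topo :: "'a topology"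
  reg :: "'a set \<Rightarrow> ('a \<Rightarrow> complex) set"

abbreviation pts :: "'a fspace \<Rightarrow> 'a set" where
  "pts S \<equiv> topspace (topo S)"

definition space_with_functions :: "'a fspace \<Rightarrow> bool" where
  "space_with_functions S \<longleftrightarrow>
     (\<forall>U. openin (topo S) U \<longrightarrow>
        (\<forall>c. (\<lambda>_. c) \<in> reg S U) \<and>
        (\<forall>f\<in>reg S U. \<forall>g\<in>reg S U. (\<lambda>a. f a + g a) \<in> reg S U \<and> (\<lambda>a. f a * g a) \<in> reg S U) \<and>
        (\<forall>f\<in>reg S U. openin (topo S) {a\<in>U. f a \<noteq> 0} \<and>
           (\<lambda>a. inverse (f a)) \<in> reg S {a\<in>U. f a \<noteq> 0}) \<and>
        (\<forall>f\<in>reg S U. \<forall>W. openin (topo S) W \<and> W \<subseteq> U \<longrightarrow> f \<in> reg S W) \<and>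
        (\<forall>f. (\<forall>a\<in>U. \<exists>W. openin (topo S) W \<and> a \<in> W \<and> W \<subseteq> U \<and>
                (\<exists>g\<in>reg S W. \<forall>b\<in>W. f b = g b)) \<longrightarrow> f \<in> reg S U))"

definition morphism :: "'a fspace \<Rightarrow> 'b fspace \<Rightarrow> ('a \<Rightarrow> 'b) \<Rightarrow> bool" where
  "morphism S T f \<longleftrightarrow>
     continuous_map (topo S) (topo T) f \<and>
     (\<forall>U g. openin (topo T) U \<and> g \<in> reg T U \<longrightarrow> g \<circ> f \<in> reg S {a\<in>pts S. f a \<in> U})"

definition isomorphism :: "'a fspace \<Rightarrow> 'b fspace \<Rightarrow> ('a \<Rightarrow> 'b) \<Rightarrow> bool" where
  "isomorphism S T f \<longleftrightarrow>
     morphism S T f \<and>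
     (\<exists>g. morphism T S g \<and> (\<forall>a\<in>pts S. g (f a) = a) \<and> (\<forall>b\<in>pts T. f (g b) = b))"

definition subspace_fun :: "'a fspace \<Rightarrow> 'a set \<Rightarrow> 'a fspace" where
  "subspace_fun S Z =
     \<lparr>topo = subtopology (topo S) Z,
      reg = (\<lambda>U. {f. \<forall>a\<in>U. \<exists>W g. openin (topo S) W \<and> a \<in> W \<and> g \<in> reg S W \<and>
                        (\<forall>b\<in>W \<inter> U. f b = g b)})\<rparr>"

definition affine_points :: "nat \<Rightarrow> (nat \<Rightarrow> complex) set" where
  "affine_points N = {x. \<forall>i\<ge>N. x i = 0}"

definition affine_space :: "nat \<Rightarrow> (nat \<Rightarrow> complex) fspace" where
  "affine_space N =
     \<lparr>topo = topology_generated_by (range (\<lambda>P. {x\<in>affine_points N. poly_eval P x \<noteq> 0})),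
      reg = (\<lambda>U. {f. \<forall>a\<in>U. \<exists>P Q. poly_eval Q a \<noteq> 0 \<and>
                        (\<forall>b\<in>U. poly_eval Q b \<noteq> 0 \<longrightarrow> f b = poly_eval P b / poly_eval Q b)})\<rparr>"

text \<open>The product is the categorical product of spaces with functions: its regular functions are
  locally the quotients of sums of products $f(a)\,g(b)$ of regular functions, and the sets where
  such sums do not vanish form a base of its topology (which is not the product topology).\<close>

definition tensor_reg :: "'a fspace \<Rightarrow> 'b fspace \<Rightarrow> 'a set \<Rightarrow> 'b set \<Rightarrow> ('a \<times> 'b \<Rightarrow> complex) set" where
  "tensor_reg S T U W =
     {h. \<exists>(k::nat) f g. (\<forall>i<k. f i \<in> reg S U \<and> g i \<in> reg T W) \<and>
                        h = (\<lambda>(a, b). \<Sum>i<k. f i a * g i b)}"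

definition prod_fspace :: "'a fspace \<Rightarrow> 'b fspace \<Rightarrow> ('a \<times> 'b) fspace" where
  "prod_fspace S T =
     \<lparr>topo = topology_generated_by
        {B. \<exists>U W h. openin (topo S) U \<and> openin (topo T) W \<and> h \<in> tensor_reg S T U W \<and>
                    B = {c \<in> U \<times> W. h c \<noteq> 0}},
      reg = (\<lambda>A. {F. \<forall>c\<in>A. \<exists>U W h k. openin (topo S) U \<and> openin (topo T) W \<and> c \<in> U \<times> W \<and>
                       h \<in> tensor_reg S T U W \<and> k \<in> tensor_reg S T U W \<and> k c \<noteq> 0 \<and>
                       (\<forall>e\<in>A \<inter> U \<times> W. k e \<noteq> 0 \<longrightarrow> F e = h e / k e)})\<rparr>"

definition orbit :: "'g set \<Rightarrow> ('g \<Rightarrow> 'a \<Rightarrow> 'a) \<Rightarrow> 'a \<Rightarrow> 'a set" where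
  "orbit G act a = (\<lambda>g. act g a) ` G"

text \<open>The quotient has the orbits as points, the quotient topology, and the invariant regular
  functions as regular functions.\<close>

definition orbit_space :: "'a fspace \<Rightarrow> 'g set \<Rightarrow> ('g \<Rightarrow> 'a \<Rightarrow> 'a) \<Rightarrow> 'a set fspace" where
  "orbit_space S G act =
     \<lparr>topo = topology (\<lambda>U. U \<subseteq> orbit G act ` pts S \<and>
                           openin (topo S) {a\<in>pts S. orbit G act a \<in> U}),
      reg = (\<lambda>U. {f. f \<circ> orbit G act \<in> reg S {a\<in>pts S. orbit G act a \<in> U}})\<rparr>"

lemma openin_orbit_space:
  "openin (topo (orbit_space S G act)) U \<longleftrightarrow>
     U \<subseteq> orbit G act ` pts S \<and> openin (topo S) {a\<in>pts S. orbit G act a \<in> U}"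
proof -
  have "istopology (\<lambda>U. U \<subseteq> orbit G act ` pts S \<and> openin (topo S) {a\<in>pts S. orbit G act a \<in> U})"
    (is "istopology ?L")
    unfolding istopology_def
  proof (intro conjI allI impI)
    fix A B assume "?L A" "?L B"
    then show "A \<inter> B \<subseteq> orbit G act ` pts S" by blast
    have "{a\<in>pts S. orbit G act a \<in> A \<inter> B} =
        {a\<in>pts S. orbit G act a \<in> A} \<inter> {a\<in>pts S. orbit G act a \<in> B}" by blast
    then show "openin (topo S) {a\<in>pts S. orbit G act a \<in> A \<inter> B}"
      using \<open>?L A\<close> \<open>?L B\<close> by (simp add: openin_Int)
  next
    fix K assume K: "\<forall>A\<in>K. ?L A"
    then show "\<Union>K \<subseteq> orbit G act ` pts S" by blast
    have "{a\<in>pts S. orbit G act a \<in> \<Union>K} = (\<Union>A\<in>K. {a\<in>pts S. orbit G act a \<in> A})" by blast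
    then show "openin (topo S) {a\<in>pts S. orbit G act a \<in> \<Union>K}"
      using K by (metis (no_types, lifting) imageE openin_Union)
  qed
  then show ?thesis
    by (simp add: orbit_space_def topology_inverse')
qed

section \<open>Varieties, smoothness, completeness, resolutions\<close>

definition affine_variety :: "'a fspace \<Rightarrow> bool" where
  "affine_variety S \<longleftrightarrow>
     (\<exists>N Z \<phi>. closedin (topo (affine_space N)) Z \<and>
              isomorphism S (subspace_fun (affine_space N) Z) \<phi>)"

definition variety :: "'a fspace \<Rightarrow> bool" where
  "variety S \<longleftrightarrow>
     space_with_functions S \<and>
     (\<exists>\<U>. finite \<U> \<and> \<Union>\<U> = pts S \<and>
          (\<forall>U\<in>\<U>. openin (topo S) U \<and> affine_variety (subspace_fun S U))) \<and>
     closedin (topo (prod_fspace S S)) {(a, a) |a. a \<in> pts S}"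

text \<open>Smoothness: every point has a neighbourhood isomorphic to the locus of $r$ equations in an
  open subset of affine $N$-space, with linearly independent differentials at that point.\<close>

definition smooth :: "'a fspace \<Rightarrow> bool" where
  "smooth S \<longleftrightarrow>
     (\<forall>a\<in>pts S. \<exists>U N W r F \<phi>.
        openin (topo S) U \<and> a \<in> U \<and> openin (topo (affine_space N)) W \<and>
        isomorphism (subspace_fun S U)
          (subspace_fun (affine_space N) {x\<in>W. \<forall>i<(r::nat). poly_eval (F i) x = 0}) \<phi> \<and>
        (\<forall>c. (\<forall>j<N. (\<Sum>i<r. c i * partial_deriv j (F i) (\<phi> a)) = 0) \<longrightarrow> (\<forall>i<r. c i = 0)))"

text \<open>Every variety has at most the cardinality of the continuum, so up to isomorphism the test
  varieties \<open>T\<close> below are all varieties.\<close>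

definition complete_variety :: "'a fspace \<Rightarrow> bool" where
  "complete_variety S \<longleftrightarrow>
     variety S \<and>
     (\<forall>T :: (nat \<Rightarrow> complex) fspace. variety T \<longrightarrow>
        closed_map (topo (prod_fspace S T)) (topo T) snd)"

definition dense_open :: "'a fspace \<Rightarrow> 'a set \<Rightarrow> bool" where
  "dense_open S U \<longleftrightarrow> openin (topo S) U \<and> (topo S) closure_of U = pts S"

definition rational_map :: "'a fspace \<Rightarrow> 'a set \<Rightarrow> 'b fspace \<Rightarrow> ('a \<Rightarrow> 'b) \<Rightarrow> bool" where
  "rational_map S U T f \<longleftrightarrow> dense_open S U \<and> morphism (subspace_fun S U) T f"

definition birational_map :: "'a fspace \<Rightarrow> 'a set \<Rightarrow> 'b fspace \<Rightarrow> ('a \<Rightarrow> 'b) \<Rightarrow> bool" where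
  "birational_map S U T f \<longleftrightarrow>
     dense_open S U \<and>
     (\<exists>W. dense_open T W \<and> isomorphism (subspace_fun S U) (subspace_fun T W) f)"

text \<open>\<open>resolution Y S \<pi>\<close> is a resolution of a complete variety \<open>S\<close> in the usual sense: for such \<open>S\<close>
  the morphism \<open>\<pi>\<close> is proper iff \<open>Y\<close> is complete.

  \<open>birational_resolution Y S U \<psi>\<close> only asks for a birational map, defined on \<open>U\<close>, from \<open>Y\<close> to \<open>S\<close>. This
  is the sense in which a resolution of \<open>X\<close> resolves the quotients below: if \<open>X\<close> is the smooth
  quadric $z_1^2 + z_2^2 = t_1^2 + t_2^2$ in $\mathbf{P}^3$ (all weights 1, exponent 2), then
  \<open>X\<close> has Picard number 2, and there is no birational morphism from \<open>X\<close> to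
  $(V_1 \times V_2)/\mu_2$, a surface with four nodes.\<close>

definition birational_resolution :: "'a fspace \<Rightarrow> 'b fspace \<Rightarrow> 'a set \<Rightarrow> ('a \<Rightarrow> 'b) \<Rightarrow> bool" where
  "birational_resolution Y S U \<psi> \<longleftrightarrow>
     complete_variety Y \<and> smooth Y \<and> birational_map Y U S \<psi>"

definition resolution :: "'a fspace \<Rightarrow> 'b fspace \<Rightarrow> ('a \<Rightarrow> 'b) \<Rightarrow> bool" where
  "resolution Y S \<pi> \<longleftrightarrow>
     morphism Y S \<pi> \<and> (\<exists>U. birational_resolution Y S U \<pi>)"

text \<open>\<open>Y\<close> resolves \<open>Q\<close> through the rational map \<open>f\<close> from \<open>S\<close> to \<open>Y\<close>, defined on \<open>U\<close>: the birational map
  from \<open>Y\<close> to \<open>Q\<close>, composed with \<open>f\<close>, is the given map \<open>\<kappa>\<close> from \<open>S\<close> to \<open>Q\<close>.\<close>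

definition resolves_via ::
  "'a fspace \<Rightarrow> 'a set \<Rightarrow> ('a \<Rightarrow> 'b) \<Rightarrow> 'b fspace \<Rightarrow> 'c fspace \<Rightarrow> ('a \<Rightarrow> 'c) \<Rightarrow> bool" where
  "resolves_via S U f Y Q \<kappa> \<longleftrightarrow>
     (\<exists>D \<psi> W. birational_resolution Y Q D \<psi> \<and>
        dense_open S W \<and> W \<subseteq> U \<and> (\<forall>a\<in>W. f a \<in> D \<and> \<psi> (f a) = \<kappa> a))"

section \<open>Weighted projective spaces\<close>

definition weighted_scale :: "(nat \<Rightarrow> nat) \<Rightarrow> complex \<Rightarrow> (nat \<Rightarrow> complex) \<Rightarrow> nat \<Rightarrow> complex" where
  "weighted_scale w t x = (\<lambda>i. t ^ w i * x i)"

abbreviation weighted_point :: "(nat \<Rightarrow> nat) \<Rightarrow> (nat \<Rightarrow> complex) \<Rightarrow> (nat \<Rightarrow> complex) set" where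
  "weighted_point w \<equiv> orbit (- {0}) (weighted_scale w)"

definition punctured :: "nat \<Rightarrow> (nat \<Rightarrow> complex) set" where
  "punctured N = affine_points N - {\<lambda>_. 0}"

text \<open>\<open>weighted_proj N w\<close> has the \<open>N\<close> homogeneous coordinates $x_0, \ldots, x_{N-1}$.\<close>

definition weighted_proj :: "nat \<Rightarrow> (nat \<Rightarrow> nat) \<Rightarrow> (nat \<Rightarrow> complex) set fspace" where
  "weighted_proj N w =
     orbit_space (subspace_fun (affine_space N) (punctured N)) (- {0}) (weighted_scale w)"

definition normalized_weights :: "nat \<Rightarrow> (nat \<Rightarrow> nat) \<Rightarrow> bool" where
  "normalized_weights n w \<longleftrightarrow> (\<forall>i\<le>n. Gcd (w ` ({..n} - {i})) = 1)"

section \<open>The varieties of the twist map\<close>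

definition cyclic_hypersurface ::
  "nat \<Rightarrow> (nat \<Rightarrow> nat) \<Rightarrow> nat \<Rightarrow> cpoly \<Rightarrow> (nat \<Rightarrow> complex) set fspace" where
  "cyclic_hypersurface n w l p =
     subspace_fun (weighted_proj (n + 1) w)
       (weighted_point w ` {x \<in> punctured (n + 1). x 0 ^ l + poly_eval p x = 0})"

text \<open>The homogeneous coordinates of the target space of the twist map are numbered
  $z_1, \ldots, z_n, t_1, \ldots, t_m$, starting from \<open>0\<close>.\<close>

definition twist_weights :: "nat \<Rightarrow> (nat \<Rightarrow> nat) \<Rightarrow> (nat \<Rightarrow> nat) \<Rightarrow> nat \<Rightarrow> nat" where
  "twist_weights n w v = (\<lambda>k. if k < n then v 0 * w (k + 1) else w 0 * v (k - n + 1))"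

definition twist_hypersurface ::
  "nat \<Rightarrow> nat \<Rightarrow> (nat \<Rightarrow> nat) \<Rightarrow> (nat \<Rightarrow> nat) \<Rightarrow> cpoly \<Rightarrow> cpoly \<Rightarrow> (nat \<Rightarrow> complex) set fspace" where
  "twist_hypersurface n m w v p q =
     subspace_fun (weighted_proj (n + m) (twist_weights n w v))
       (weighted_point (twist_weights n w v) `
          {c \<in> punctured (n + m).
             poly_eval p (\<lambda>i. c (i - 1)) - poly_eval q (\<lambda>j. c (n + j - 1)) = 0})"

text \<open>Here \<open>r\<close> and \<open>s\<close> are the roots $y_0^{1/w_0}$ and $x_0^{1/v_0}$.\<close>

definition twist_coords ::
  "nat \<Rightarrow> nat \<Rightarrow> (nat \<Rightarrow> nat) \<Rightarrow> (nat \<Rightarrow> nat) \<Rightarrow> complex \<Rightarrow> complex \<Rightarrow>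
     (nat \<Rightarrow> complex) \<Rightarrow> (nat \<Rightarrow> complex) \<Rightarrow> nat \<Rightarrow> complex" where
  "twist_coords n m w v r s x y =
     (\<lambda>k. if k < n then r ^ w (k + 1) * x (k + 1)
          else if k < n + m then s ^ v (k - n + 1) * y (k - n + 1)
          else 0)"

text \<open>The graph of the formula for $\Phi$, with all choices of the two roots.\<close>

definition twist_graph ::
  "nat \<Rightarrow> nat \<Rightarrow> (nat \<Rightarrow> nat) \<Rightarrow> (nat \<Rightarrow> nat) \<Rightarrow>
     (((nat \<Rightarrow> complex) set \<times> (nat \<Rightarrow> complex) set) \<times> (nat \<Rightarrow> complex) set) set" where
  "twist_graph n m w v =
     {((weighted_point w x, weighted_point v y),
       weighted_point (twist_weights n w v) (twist_coords n m w v r s x y)) | x y r s.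
        x \<in> punctured (n + 1) \<and> y \<in> punctured (m + 1) \<and> r ^ w 0 = y 0 \<and> s ^ v 0 = x 0 \<and>
        twist_coords n m w v r s x y \<noteq> (\<lambda>_. 0)}"

definition roots_of_unity :: "nat \<Rightarrow> complex set" where
  "roots_of_unity l = {\<gamma>. \<gamma> ^ l = 1}"

text \<open>A point of a weighted projective space is the set of its coordinate vectors.\<close>

definition twist_action ::
  "complex \<Rightarrow> (nat \<Rightarrow> complex) set \<times> (nat \<Rightarrow> complex) set \<Rightarrow>
     (nat \<Rightarrow> complex) set \<times> (nat \<Rightarrow> complex) set" where
  "twist_action \<gamma> = (\<lambda>(A, B). ((\<lambda>x. x(0 := \<gamma> * x 0)) ` A, (\<lambda>y. y(0 := \<gamma> * y 0)) ` B))"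

text \<open>\<open>\<sigma>\<close> is an action of the $\ell$-th roots of unity on \<open>Y\<close> that lifts the action \<open>act\<close> along \<open>\<pi>\<close>.\<close>

definition lifted_action ::
  "nat \<Rightarrow> 'a fspace \<Rightarrow> (complex \<Rightarrow> 'a \<Rightarrow> 'a) \<Rightarrow> ('a \<Rightarrow> 'b) \<Rightarrow> (complex \<Rightarrow> 'b \<Rightarrow> 'b) \<Rightarrow> bool" where
  "lifted_action l Y \<sigma> \<pi> act \<longleftrightarrow>
     (\<forall>\<gamma>\<in>roots_of_unity l. morphism Y Y (\<sigma> \<gamma>)) \<and>
     (\<forall>a\<in>pts Y. \<sigma> 1 a = a \<and>
        (\<forall>\<gamma>\<in>roots_of_unity l. \<pi> (\<sigma> \<gamma> a) = act \<gamma> (\<pi> a) \<and>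
           (\<forall>\<delta>\<in>roots_of_unity l. \<sigma> (\<gamma> * \<delta>) a = \<sigma> \<gamma> (\<sigma> \<delta> a))))"

text \<open>The rational map \<open>f\<close>, defined on \<open>U\<close>, makes the diagram with $\Phi$ commute, where $\Phi$ is
  single-valued as a map: the value does not depend on the choice of the roots.\<close>

definition lifts_twist ::
  "nat \<Rightarrow> nat \<Rightarrow> (nat \<Rightarrow> nat) \<Rightarrow> (nat \<Rightarrow> nat) \<Rightarrow> 'a set \<Rightarrow> ('a \<Rightarrow> 'b) \<Rightarrow>
     ('a \<Rightarrow> (nat \<Rightarrow> complex) set \<times> (nat \<Rightarrow> complex) set) \<Rightarrow> ('b \<Rightarrow> (nat \<Rightarrow> complex) set) \<Rightarrow> bool" where
  "lifts_twist n m w v U f \<pi>V \<pi>X \<longleftrightarrow>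
     (\<forall>a\<in>U. \<forall>b. (\<pi>V a, b) \<in> twist_graph n m w v \<longrightarrow> \<pi>X (f a) = b)"

end

theory Submission
  imports Defs "HOL-Complex_Analysis.Conformal_Mappings"
begin

text \<open>Both \<open>X\<close> and $(V_1 \times V_2)/\mu_\ell$ contain a dense open set that is a quotient of one and
  the same affine variety, the slice $\{p = -1\} \times \{q = -1\}$ in affine \<open>(n + m)\<close>-space.
  A point $(z, t)$ of the slice gives the point $(z : t)$ of \<open>X\<close>, on which \<open>p\<close> does not vanish, and
  the point $((1 : z), (1 : t))$ of $V_1 \times V_2$, on which $x_0$ and $y_0$ do not vanish. With
  $x_0 = y_0 = 1$ the roots in the formula for $\Phi$ may be taken to be 1, so $\Phi$ maps the second
  point to the first. Every point of \<open>X\<close> with $p \neq 0$, and every point of $V_1 \times V_2$ with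
  $x_0 y_0 \neq 0$, arises in this way after rescaling the coordinates.

  The maps from the slice to \<open>X\<close> and to $V_1 \times V_2$ (hence to $(V_1 \times V_2)/\mu_\ell$) are open
  quotients: a subset of the image is open, and a function on it is regular, as soon as the pullback to
  the slice is (\<open>open_quotient_X\<close>, \<open>open_quotient_V\<close>, \<open>open_quotient_orbit_space\<close>). The reason is
  that the fibres are orbits of finite groups of diagonal matrices. A fraction of polynomials whose values
  are constant on the orbits can be averaged so that only invariant monomials remain
  (\<open>invariant_fraction\<close>). The degrees of an invariant monomial are divisible by the orders of the cyclic
  groups involved, and so it can be made homogeneous of degree 0 by a power of \<open>- p\<close>, or by powers of $x_0$ and $y_0$,
  all of which are 1 on the slice. Two open quotients of the same space that have the same fibres have
  isomorphic images (\<open>open_quotient_isomorphism\<close>).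

  It remains to compare fibres (\<open>fibre\<close>). If $((1 : z'), (1 : t'))$ is in the $\mu_\ell$-orbit of
  $((1 : z), (1 : t))$, then up to the scaling of $\mathbf{P}$ that defines \<open>X\<close> the two vectors differ by
  a $v_0$-th root of unity acting on \<open>t\<close>, and such vectors give the same point of $V_1 \times V_2$. That
  they give the same point of \<open>X\<close> is the assumption that $\Phi$ is single-valued, available wherever the
  lift $\tilde\Phi$ is defined. Therefore the slice is cut down to a dense open subset \<open>Z\<close>, stable under
  all scalings in question, that lies below the domain of $\tilde\Phi$.

  The open sets in question are dense (\<open>to_V_dense\<close>, \<open>to_X_dense\<close>): near a point where $x_0$, or \<open>p\<close>,
  vanishes, the open mapping theorem for polynomials in one variable gives points where it does not. A
  birational morphism from a separated space is injective over the open set over which it has an inverse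
  (\<open>isomorphism_domain_eq_preimage\<close>). This allows all conclusions to be transported to \<open>Vt\<close> and
  \<open>Xt\<close>; in particular the part of \<open>Vt\<close> over \<open>Z\<close> is stable under the lifted action, and \<open>Z\<close> is
  also an open quotient chart of \<open>Vt\<close>.\<close>

section \<open>Polynomial functions\<close>

text \<open>Polynomials are used through the functions that they define; this makes substitution and products
  immediate, and the results below are statements about functions.\<close>

definition polyfun :: "((nat \<Rightarrow> complex) \<Rightarrow> complex) \<Rightarrow> bool" where
  "polyfun f \<longleftrightarrow> f \<in> range poly_eval"

definition monom_eval :: "(nat \<Rightarrow>\<^sub>0 nat) \<Rightarrow> (nat \<Rightarrow> complex) \<Rightarrow> complex" where
  "monom_eval m x = (\<Prod>i\<in>Poly_Mapping.keys m. x i ^ Poly_Mapping.lookup m i)"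

lemma poly_eval_superset:
  assumes "finite K" "Poly_Mapping.keys P \<subseteq> K"
  shows "poly_eval P x = (\<Sum>m\<in>K. Poly_Mapping.lookup P m * monom_eval m x)"
  unfolding poly_eval_def monom_eval_def
  by (rule sum.mono_neutral_left) (use assms in \<open>auto simp: in_keys_iff\<close>)

lemma monom_eval_superset:
  assumes "finite K" "Poly_Mapping.keys m \<subseteq> K"
  shows "monom_eval m x = (\<Prod>i\<in>K. x i ^ Poly_Mapping.lookup m i)"
  unfolding monom_eval_def
  by (rule prod.mono_neutral_left) (use assms in \<open>auto simp: in_keys_iff\<close>)

lemma poly_eval_add: "poly_eval (P + Q) x = poly_eval P x + poly_eval Q x"
proof -
  let ?K = "Poly_Mapping.keys P \<union> Poly_Mapping.keys Q"
  have "Poly_Mapping.keys (P + Q) \<subseteq> ?K" by (rule keys_add)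
  then show ?thesis
    by (simp add: poly_eval_superset[of ?K] lookup_add distrib_right sum.distrib)
qed

lemma poly_eval_single: "poly_eval (Poly_Mapping.single m c) x = c * monom_eval m x"
  by (simp add: poly_eval_superset[of "{m}"])

lemma monom_eval_add: "monom_eval (m + m') x = monom_eval m x * monom_eval m' x"
proof -
  let ?K = "Poly_Mapping.keys m \<union> Poly_Mapping.keys m'"
  have "Poly_Mapping.keys (m + m') \<subseteq> ?K" by (rule keys_add)
  then show ?thesis
    by (simp add: monom_eval_superset[of ?K] lookup_add power_add prod.distrib)
qed

lemma polyfun_poly_eval [intro, simp]: "polyfun (poly_eval P)"
  by (simp add: polyfun_def)

lemma polyfun_term [intro]: "polyfun (\<lambda>x. c * monom_eval m x)"
proof -
  have "(\<lambda>x. c * monom_eval m x) = poly_eval (Poly_Mapping.single m c)"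
    by (simp add: fun_eq_iff poly_eval_single)
  then show ?thesis by simp
qed

lemma polyfun_const [intro, simp]: "polyfun (\<lambda>x. c)"
  using polyfun_term[of c 0] by (simp add: monom_eval_def)

lemma polyfun_coord [intro, simp]: "polyfun (\<lambda>x. x i)"
  using polyfun_term[of 1 "Poly_Mapping.single i 1"] by (simp add: monom_eval_def)

lemma polyfun_add [intro]: "polyfun f \<Longrightarrow> polyfun g \<Longrightarrow> polyfun (\<lambda>x. f x + g x)"
  unfolding polyfun_def by (auto simp: image_iff fun_eq_iff) (metis poly_eval_add)

lemma polyfun_sum [intro]: "(\<And>i. i \<in> I \<Longrightarrow> polyfun (f i)) \<Longrightarrow> polyfun (\<lambda>x. \<Sum>i\<in>I. f i x)"
  by (induction I rule: infinite_finite_induct) auto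

lemma polyfun_mult [intro]:
  assumes "polyfun f" "polyfun g" shows "polyfun (\<lambda>x. f x * g x)"
proof -
  obtain P Q where f: "f = poly_eval P" and g: "g = poly_eval Q"
    using assms by (auto simp: polyfun_def)
  have eq: "(\<lambda>x. f x * g x) = (\<lambda>x. \<Sum>m\<in>Poly_Mapping.keys P. \<Sum>m'\<in>Poly_Mapping.keys Q.
      (Poly_Mapping.lookup P m * Poly_Mapping.lookup Q m') * monom_eval (m + m') x)"
    unfolding f g poly_eval_def monom_eval_add
    by (simp add: fun_eq_iff sum_product monom_eval_def mult_ac)
  show ?thesis unfolding eq by (intro polyfun_sum polyfun_term)
qed

lemma polyfun_uminus [intro]: "polyfun f \<Longrightarrow> polyfun (\<lambda>x. - f x)"
  using polyfun_mult[OF polyfun_const[of "-1"]] by simp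

lemma polyfun_diff [intro]: "polyfun f \<Longrightarrow> polyfun g \<Longrightarrow> polyfun (\<lambda>x. f x - g x)"
  using polyfun_add[OF _ polyfun_uminus] by simp

lemma polyfun_power [intro]: "polyfun f \<Longrightarrow> polyfun (\<lambda>x. f x ^ k)"
  by (induction k) auto

lemma polyfun_prod [intro]: "(\<And>i. i \<in> I \<Longrightarrow> polyfun (f i)) \<Longrightarrow> polyfun (\<lambda>x. \<Prod>i\<in>I. f i x)"
  by (induction I rule: infinite_finite_induct) auto

lemma polyfun_compose:
  assumes "polyfun f" "\<And>i. polyfun (\<lambda>x. \<theta> x i)"
  shows "polyfun (\<lambda>x. f (\<theta> x))"
proof -
  obtain P where f: "f = poly_eval P" using assms by (auto simp: polyfun_def)
  show ?thesis unfolding f poly_eval_def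
    using assms(2) by (intro polyfun_sum polyfun_mult polyfun_const polyfun_prod polyfun_power)
qed

lemma continuous_on_poly_eval:
  fixes \<theta> :: "'a::topological_space \<Rightarrow> nat \<Rightarrow> complex"
  assumes "\<And>i. continuous_on S (\<lambda>u. \<theta> u i)"
  shows "continuous_on S (\<lambda>u. poly_eval P (\<theta> u))"
  unfolding poly_eval_def using assms by (intro continuous_intros)

lemma polyfun_on_line:
  fixes a b :: "nat \<Rightarrow> complex"
  assumes "polyfun f"
  obtains G :: "complex poly" where "\<And>t. f (\<lambda>i. a i + t * b i) = poly G t"
proof -
  obtain P where f: "f = poly_eval P" using assms by (auto simp: polyfun_def)
  show ?thesis
    by (rule that[of "\<Sum>m\<in>Poly_Mapping.keys P. Polynomial.smult (Poly_Mapping.lookup P m)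
          (\<Prod>i\<in>Poly_Mapping.keys m. [:a i, b i:] ^ Poly_Mapping.lookup m i)"])
       (simp add: f poly_eval_def poly_sum poly_prod)
qed

abbreviation monomial_at :: "nat \<Rightarrow> (nat \<Rightarrow>\<^sub>0 nat) \<Rightarrow> (nat \<Rightarrow> complex) \<Rightarrow> complex" where
  "monomial_at N m x \<equiv> (\<Prod>k<N. x k ^ Poly_Mapping.lookup m k)"

lemma affine_pointsD: "x \<in> affine_points N \<Longrightarrow> N \<le> i \<Longrightarrow> x i = 0"
  by (simp add: affine_points_def)

text \<open>On affine \<open>N\<close>-space the variables from number \<open>N\<close> on vanish, so only monomials in the first \<open>N\<close> variables
  survive.\<close>

lemma polyfun_expand:
  assumes "polyfun f"
  obtains c where "finite {m. c m \<noteq> (0::complex)}"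
    "\<And>x. x \<in> affine_points N \<Longrightarrow>
       f x = (\<Sum>m | c m \<noteq> 0. c m * monomial_at N m x)"
proof -
  obtain P where f: "f = poly_eval P" using assms by (auto simp: polyfun_def)
  define c where "c m = (if Poly_Mapping.keys m \<subseteq> {..<N} then Poly_Mapping.lookup P m else 0)" for m
  have sub: "{m. c m \<noteq> 0} \<subseteq> Poly_Mapping.keys P"
    by (auto simp: c_def in_keys_iff split: if_splits)
  have "f x = (\<Sum>m | c m \<noteq> 0. c m * monomial_at N m x)"
    if x: "x \<in> affine_points N" for x
  proof -
    have t: "Poly_Mapping.lookup P m * monom_eval m x
        = c m * monomial_at N m x" for m
    proof (cases "Poly_Mapping.keys m \<subseteq> {..<N}")
      case True
      then show ?thesis by (simp add: c_def monom_eval_superset[of "{..<N}"])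
    next
      case False
      then obtain i where "i \<in> Poly_Mapping.keys m" "N \<le> i" by (auto simp: subset_eq not_less)
      then have "monom_eval m x = 0" using affine_pointsD[OF x]
        by (auto simp: monom_eval_def in_keys_iff intro!: prod_zero bexI[of _ i])
      with False show ?thesis by (simp add: c_def)
    qed
    have "f x = (\<Sum>m\<in>Poly_Mapping.keys P. c m * monomial_at N m x)"
      unfolding f by (subst poly_eval_superset[of "Poly_Mapping.keys P"]) (simp_all add: t)
    also have "\<dots> = (\<Sum>m | c m \<noteq> 0. c m * monomial_at N m x)"
      by (rule sum.mono_neutral_right) (use sub in auto)
    finally show ?thesis .
  qed
  with sub that show ?thesis using finite_subset finite_keys by blast
qed

section \<open>Averaging over a finite diagonal group\<close>

abbreviation diag_scale :: "(nat \<Rightarrow> complex) \<Rightarrow> (nat \<Rightarrow> complex) \<Rightarrow> nat \<Rightarrow> complex" where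
  "diag_scale g x \<equiv> (\<lambda>i. g i * x i)"

definition diagonal_group :: "(nat \<Rightarrow> complex) set \<Rightarrow> bool" where
  "diagonal_group G \<longleftrightarrow> finite G \<and> (\<lambda>_. 1) \<in> G \<and> (\<forall>g\<in>G. \<forall>i. g i \<noteq> 0) \<and>
     (\<forall>g\<in>G. \<forall>h\<in>G. diag_scale g h \<in> G)"

text \<open>Orthogonality: translating by \<open>g0\<close> permutes the group, and multiplies the sum by the value of the
  character at \<open>g0\<close>.\<close>

lemma character_sum_zero:
  assumes G: "diagonal_group G" and g0: "g0 \<in> G" and ne: "(\<Prod>k<N. g0 k ^ (e k :: nat)) \<noteq> 1"
  shows "(\<Sum>g\<in>G. \<Prod>k<N. g k ^ e k) = 0"
proof -
  have inj: "inj_on (diag_scale g0) G"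
    using G g0 by (auto simp: inj_on_def diagonal_group_def fun_eq_iff)
  have "diag_scale g0 ` G = G"
    using G g0 by (intro endo_inj_surj[OF _ _ inj]) (auto simp: diagonal_group_def)
  then have "(\<Sum>g\<in>G. \<Prod>k<N. g k ^ e k) = (\<Sum>g\<in>G. \<Prod>k<N. diag_scale g0 g k ^ e k)"
    using sum.reindex[OF inj, of "\<lambda>g. \<Prod>k<N. g k ^ e k"] by (simp add: o_def)
  also have "\<dots> = (\<Prod>k<N. g0 k ^ e k) * (\<Sum>g\<in>G. \<Prod>k<N. g k ^ e k)"
    by (simp add: power_mult_distrib prod.distrib sum_distrib_left)
  finally show ?thesis using ne by simp
qed

lemma separating_polyfun:
  assumes "finite F" "c \<notin> F"
  obtains M where "polyfun M" "M c \<noteq> 0" "\<And>x. x \<in> F \<Longrightarrow> M x = 0"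
proof -
  have "\<exists>i. x i \<noteq> c i" if "x \<in> F" for x using that assms by (metis ext)
  then obtain j where j: "\<And>x. x \<in> F \<Longrightarrow> x (j x) \<noteq> c (j x)" by metis
  show ?thesis
  proof (rule that[of "\<lambda>z. \<Prod>x\<in>F. (z (j x) - x (j x))"])
    show "polyfun (\<lambda>z. \<Prod>x\<in>F. (z (j x) - x (j x)))" by (intro polyfun_prod polyfun_diff) auto
    show "(\<Prod>x\<in>F. (c (j x) - x (j x))) \<noteq> 0" using assms j by (force simp: prod_zero_iff)
  qed (use assms in \<open>auto intro!: prod_zero\<close>)
qed

text \<open>The average of a monomial over the group is the monomial times a character sum, so the average of a
  polynomial retains exactly the monomials with trivial character.\<close>

lemma reynolds_expand:
  assumes "polyfun f" "diagonal_group G"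
  obtains c where "finite {m. c m \<noteq> (0::complex)}"
    "\<And>m g. c m \<noteq> 0 \<Longrightarrow> g \<in> G \<Longrightarrow> monomial_at N m g = 1"
    "\<And>x. x \<in> affine_points N \<Longrightarrow> (\<Sum>g\<in>G. f (diag_scale g x))
        = (\<Sum>m | c m \<noteq> 0. c m * monomial_at N m x)"
proof -
  obtain c where fin: "finite {m. c m \<noteq> 0}" and c: "\<And>x. x \<in> affine_points N \<Longrightarrow>
       f x = (\<Sum>m | c m \<noteq> 0. c m * monomial_at N m x)"
    by (rule polyfun_expand[OF assms(1), of N]) (rule that; assumption)
  define d where "d m = c m * (\<Sum>g\<in>G. monomial_at N m g)" for m
  have sub: "{m. d m \<noteq> 0} \<subseteq> {m. c m \<noteq> 0}" by (auto simp: d_def)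
  show ?thesis
  proof (rule that[of d])
    show "finite {m. d m \<noteq> 0}" using sub fin by (rule finite_subset)
    show "monomial_at N m g = 1" if "d m \<noteq> 0" "g \<in> G" for m g
      using that character_sum_zero[OF assms(2)] by (auto simp: d_def)
    fix x assume x: "x \<in> affine_points N"
    then have gx: "diag_scale g x \<in> affine_points N" for g by (simp add: affine_points_def)
    have "(\<Sum>g\<in>G. f (diag_scale g x)) =
        (\<Sum>g\<in>G. \<Sum>m | c m \<noteq> 0. c m * monomial_at N m (diag_scale g x))"
      by (simp add: c[OF gx])
    also have "\<dots> = (\<Sum>m | c m \<noteq> 0. d m * monomial_at N m x)"
      by (subst sum.swap)
         (simp add: d_def power_mult_distrib prod.distrib sum_distrib_left sum_distrib_right mult_ac)
    also have "\<dots> = (\<Sum>m | d m \<noteq> 0. d m * monomial_at N m x)"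
      by (rule sum.mono_neutral_right) (use fin sub in auto)
    finally show "(\<Sum>g\<in>G. f (diag_scale g x))
        = (\<Sum>m | d m \<noteq> 0. d m * monomial_at N m x)" .
  qed
qed

text \<open>An invariant function that is locally a fraction of polynomials is locally a fraction of invariant
  polynomials. The equation \<open>f x * Q x = P x\<close> may be averaged because it has no denominators; averaging \<open>Q\<close>
  itself could give 0 at \<open>c\<close>, which is avoided by first multiplying with a polynomial that vanishes at the
  points of the orbit of \<open>c\<close> other than \<open>c\<close>.

  With \<open>P = Q\<close> and the indicator function of a set as \<open>f\<close>, the lemma yields invariant equations for
  invariant open sets.\<close>

lemma invariant_fraction:
  assumes G: "diagonal_group G" and A: "A \<subseteq> affine_points N"
    and inv: "\<And>g x. g \<in> G \<Longrightarrow> x \<in> A \<Longrightarrow> diag_scale g x \<in> A \<and> f (diag_scale g x) = f x"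
    and PQ: "polyfun P" "polyfun Q" "\<And>x. x \<in> A \<Longrightarrow> f x * Q x = P x"
    and c: "c \<in> A" "Q c \<noteq> 0"
  obtains K a b P' Q' where "finite K"
    "\<And>m g. m \<in> K \<Longrightarrow> g \<in> G \<Longrightarrow> monomial_at N m g = 1"
    "\<And>x. x \<in> A \<Longrightarrow> P' x = (\<Sum>m\<in>K. a m * monomial_at N m x)"
    "\<And>x. x \<in> A \<Longrightarrow> Q' x = (\<Sum>m\<in>K. b m * monomial_at N m x)"
    "\<And>x. x \<in> A \<Longrightarrow> f x * Q' x = P' x" "Q' c \<noteq> (0::complex)"
proof -
  have finG: "finite G" and oneG: "(\<lambda>_. 1) \<in> G" using G by (auto simp: diagonal_group_def)
  define F where "F = (\<lambda>g. diag_scale g c) ` G - {c}"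
  obtain M where M: "polyfun M" "M c \<noteq> 0" "\<And>x. x \<in> F \<Longrightarrow> M x = 0"
    using separating_polyfun[of F c] finG by (auto simp: F_def)
  define P' where "P' x = (\<Sum>g\<in>G. P (diag_scale g x) * M (diag_scale g x))" for x
  define Q' where "Q' x = (\<Sum>g\<in>G. Q (diag_scale g x) * M (diag_scale g x))" for x
  have eq: "f x * Q' x = P' x" if "x \<in> A" for x
    unfolding P'_def Q'_def sum_distrib_left
  proof (rule sum.cong[OF refl])
    fix g assume "g \<in> G"
    then have "diag_scale g x \<in> A" "f (diag_scale g x) = f x" using inv that by blast+
    then show "f x * (Q (diag_scale g x) * M (diag_scale g x)) = P (diag_scale g x) * M (diag_scale g x)"
      using PQ(3)[of "diag_scale g x"] by (metis mult.assoc)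
  qed
  have "Q' c = (\<Sum>g\<in>G. if diag_scale g c = c then Q c * M c else 0)"
    unfolding Q'_def by (rule sum.cong) (use M(3) in \<open>auto simp: F_def\<close>)
  also have "\<dots> = of_nat (card {g\<in>G. diag_scale g c = c}) * (Q c * M c)"
    using finG by (simp add: sum.If_cases Collect_conj_eq)
  also have "\<dots> \<noteq> 0" using c M(2) oneG finG by (auto simp: card_eq_0_iff)
  finally have Q'c: "Q' c \<noteq> 0" .
  have pP: "polyfun (\<lambda>x. P x * M x)" and pQ: "polyfun (\<lambda>x. Q x * M x)" using PQ M by auto
  obtain a where a: "finite {m. a m \<noteq> 0}"
    "\<And>m g. a m \<noteq> 0 \<Longrightarrow> g \<in> G \<Longrightarrow> monomial_at N m g = 1"
    "\<And>x. x \<in> affine_points N \<Longrightarrow> P' x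
        = (\<Sum>m | a m \<noteq> 0. a m * monomial_at N m x)"
    by (rule reynolds_expand[OF pP G, of N, folded P'_def]) (rule that; assumption)
  obtain b where b: "finite {m. b m \<noteq> 0}"
    "\<And>m g. b m \<noteq> 0 \<Longrightarrow> g \<in> G \<Longrightarrow> monomial_at N m g = 1"
    "\<And>x. x \<in> affine_points N \<Longrightarrow> Q' x
        = (\<Sum>m | b m \<noteq> 0. b m * monomial_at N m x)"
    by (rule reynolds_expand[OF pQ G, of N, folded Q'_def]) (rule that; assumption)
  let ?K = "{m. a m \<noteq> 0} \<union> {m. b m \<noteq> 0}"
  show ?thesis
  proof (rule that[of ?K P' a Q' b])
    show "P' x = (\<Sum>m\<in>?K. a m * monomial_at N m x)" if "x \<in> A" for x
      using a b A that by (subst a(3)) (auto intro!: sum.mono_neutral_left)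
    show "Q' x = (\<Sum>m\<in>?K. b m * monomial_at N m x)" if "x \<in> A" for x
      using a b A that by (subst b(3)) (auto intro!: sum.mono_neutral_left)
  qed (use a b eq Q'c in auto)
qed

section \<open>Spaces with functions\<close>

lemma
  assumes "space_with_functions S" "openin (topo S) U"
  shows swf_const: "(\<lambda>_. c) \<in> reg S U"
    and swf_add: "f \<in> reg S U \<Longrightarrow> g \<in> reg S U \<Longrightarrow> (\<lambda>a. f a + g a) \<in> reg S U"
    and swf_mult: "f \<in> reg S U \<Longrightarrow> g \<in> reg S U \<Longrightarrow> (\<lambda>a. f a * g a) \<in> reg S U"
    and swf_nonzero: "f \<in> reg S U \<Longrightarrow> openin (topo S) {a\<in>U. f a \<noteq> 0}"
    and swf_inverse: "f \<in> reg S U \<Longrightarrow> (\<lambda>a. inverse (f a)) \<in> reg S {a\<in>U. f a \<noteq> 0}"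
    and swf_restrict: "f \<in> reg S U \<Longrightarrow> openin (topo S) W \<Longrightarrow> W \<subseteq> U \<Longrightarrow> f \<in> reg S W"
    and swf_glue: "(\<And>a. a \<in> U \<Longrightarrow> \<exists>W g. openin (topo S) W \<and> a \<in> W \<and> W \<subseteq> U \<and>
                g \<in> reg S W \<and> (\<forall>b\<in>W. f b = g b)) \<Longrightarrow> f \<in> reg S U"
proof -
  note * = assms(1)[unfolded space_with_functions_def, THEN spec, THEN mp, OF assms(2)]
  note const = *[THEN conjunct1] and arith = *[THEN conjunct2, THEN conjunct1]
    and inv = *[THEN conjunct2, THEN conjunct2, THEN conjunct1]
    and res = *[THEN conjunct2, THEN conjunct2, THEN conjunct2, THEN conjunct1]
    and glue = *[THEN conjunct2, THEN conjunct2, THEN conjunct2, THEN conjunct2]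
  show "(\<lambda>_. c) \<in> reg S U" using const ..
  show "(\<lambda>a. f a + g a) \<in> reg S U" if "f \<in> reg S U" "g \<in> reg S U" using arith that by blast
  show "(\<lambda>a. f a * g a) \<in> reg S U" if "f \<in> reg S U" "g \<in> reg S U" using arith that by blast
  show "openin (topo S) {a\<in>U. f a \<noteq> 0}" if "f \<in> reg S U" using inv that by blast
  show "(\<lambda>a. inverse (f a)) \<in> reg S {a\<in>U. f a \<noteq> 0}" if "f \<in> reg S U" using inv that by blast
  show "f \<in> reg S W" if "f \<in> reg S U" "openin (topo S) W" "W \<subseteq> U" using res that by blast
  show "f \<in> reg S U" if "\<And>a. a \<in> U \<Longrightarrow> \<exists>W g. openin (topo S) W \<and> a \<in> W \<and> W \<subseteq> U \<and>
                g \<in> reg S W \<and> (\<forall>b\<in>W. f b = g b)"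
    by (rule glue[THEN spec, THEN mp], rule ballI, drule that, blast)
qed

lemma swf_cong:
  assumes "space_with_functions S" "openin (topo S) U" "f \<in> reg S U" "\<And>a. a \<in> U \<Longrightarrow> g a = f a"
  shows "g \<in> reg S U"
  by (rule swf_glue[OF assms(1,2)]) (use assms in blast)

lemma swf_sum:
  assumes "space_with_functions S" "openin (topo S) U" "\<And>i. i < (k::nat) \<Longrightarrow> f i \<in> reg S U"
  shows "(\<lambda>a. \<Sum>i<k. f i a) \<in> reg S U"
  using assms(3) by (induction k) (auto intro: swf_const[OF assms(1,2)] swf_add[OF assms(1,2)])

lemma topo_subspace [simp]: "topo (subspace_fun S Z) = subtopology (topo S) Z"
  by (simp add: subspace_fun_def)

lemma reg_subspace:
  "f \<in> reg (subspace_fun S Z) U \<longleftrightarrow>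
     (\<forall>a\<in>U. \<exists>W g. openin (topo S) W \<and> a \<in> W \<and> g \<in> reg S W \<and> (\<forall>b\<in>W \<inter> U. f b = g b))"
  by (simp add: subspace_fun_def)

lemma reg_subspace_subset:
  assumes "f \<in> reg (subspace_fun S Z) U" "U' \<subseteq> U"
  shows "f \<in> reg (subspace_fun S Z') U'"
  unfolding reg_subspace
proof
  fix a assume "a \<in> U'"
  then have "\<exists>W g. openin (topo S) W \<and> a \<in> W \<and> g \<in> reg S W \<and> (\<forall>b\<in>W \<inter> U. f b = g b)"
    using assms unfolding reg_subspace by blast
  then show "\<exists>W g. openin (topo S) W \<and> a \<in> W \<and> g \<in> reg S W \<and> (\<forall>b\<in>W \<inter> U'. f b = g b)"
    using assms(2) by blast
qed

lemma reg_subspaceI: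
  "f \<in> reg S W \<Longrightarrow> openin (topo S) W \<Longrightarrow> U \<subseteq> W \<Longrightarrow> f \<in> reg (subspace_fun S Z) U"
  unfolding reg_subspace by blast

text \<open>On an open set of the ambient space the gluing axiom removes the local extensions that define regular
  functions on a subspace.\<close>

lemma reg_subspace_open:
  assumes S: "space_with_functions S" and U: "openin (topo S) U" and f: "f \<in> reg (subspace_fun S Z) U"
  shows "f \<in> reg S U"
proof (rule swf_glue[OF S U])
  fix a assume a: "a \<in> U"
  then obtain W g where W: "openin (topo S) W" "a \<in> W" "g \<in> reg S W" "\<forall>b\<in>W \<inter> U. f b = g b"
    using f unfolding reg_subspace by meson
  have "openin (topo S) (W \<inter> U)" using W U by blast
  moreover have "g \<in> reg S (W \<inter> U)" using swf_restrict[OF S W(1) W(3)] calculation by blast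
  ultimately show "\<exists>W g. openin (topo S) W \<and> a \<in> W \<and> W \<subseteq> U \<and> g \<in> reg S W \<and> (\<forall>b\<in>W. f b = g b)"
    using W a by blast
qed

lemma space_with_functions_subspace:
  assumes S: "space_with_functions S"
  shows "space_with_functions (subspace_fun S Z)"
  unfolding space_with_functions_def
proof (intro allI impI conjI ballI)
  let ?T = "subspace_fun S Z"
  fix U assume U: "openin (topo ?T) U"
  then obtain U' where U': "openin (topo S) U'" "U = U' \<inter> Z" by (auto simp: openin_subtopology)
  show "(\<lambda>_. c) \<in> reg ?T U" for c
    by (rule reg_subspaceI[OF swf_const[OF S U'(1)] U'(1)]) (use U' in blast)
  have binop: "(\<lambda>a. h (f a) (g a)) \<in> reg ?T U"
    if fg: "f \<in> reg ?T U" "g \<in> reg ?T U"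
      and h: "\<And>W f g. openin (topo S) W \<Longrightarrow> f \<in> reg S W \<Longrightarrow> g \<in> reg S W \<Longrightarrow> (\<lambda>a. h (f a) (g a)) \<in> reg S W"
    for f g h
    unfolding reg_subspace
  proof
    fix a assume a: "a \<in> U"
    obtain W1 f' where W1: "openin (topo S) W1" "a \<in> W1" "f' \<in> reg S W1" "\<forall>b\<in>W1 \<inter> U. f b = f' b"
      using fg(1) a unfolding reg_subspace by meson
    obtain W2 g' where W2: "openin (topo S) W2" "a \<in> W2" "g' \<in> reg S W2" "\<forall>b\<in>W2 \<inter> U. g b = g' b"
      using fg(2) a unfolding reg_subspace by meson
    have W: "openin (topo S) (W1 \<inter> W2)" using W1 W2 by blast
    then have "f' \<in> reg S (W1 \<inter> W2)" "g' \<in> reg S (W1 \<inter> W2)"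
      using swf_restrict[OF S W1(1,3)] swf_restrict[OF S W2(1,3)] by blast+
    from h[OF W this] W1 W2 W
    show "\<exists>W k. openin (topo S) W \<and> a \<in> W \<and> k \<in> reg S W \<and> (\<forall>b\<in>W \<inter> U. h (f b) (g b) = k b)"
      by (intro exI[of _ "W1 \<inter> W2"] exI[of _ "\<lambda>a. h (f' a) (g' a)"]) auto
  qed
  show "(\<lambda>a. f a + g a) \<in> reg ?T U" "(\<lambda>a. f a * g a) \<in> reg ?T U"
    if "f \<in> reg ?T U" "g \<in> reg ?T U" for f g
    using binop[OF that] swf_add[OF S] swf_mult[OF S] by blast+
  {
    fix f assume f: "f \<in> reg ?T U"
    have loc: "\<exists>W g. openin (topo S) W \<and> a \<in> W \<and> g \<in> reg S W \<and> (\<forall>b\<in>W \<inter> U. f b = g b)"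
      if "a \<in> U" for a using f that unfolding reg_subspace by blast
    show "openin (topo ?T) {a\<in>U. f a \<noteq> 0}"
    proof (subst openin_subopen, intro ballI)
      fix a assume a: "a \<in> {a\<in>U. f a \<noteq> 0}"
      then obtain W g where W: "openin (topo S) W" "a \<in> W" "g \<in> reg S W" "\<forall>b\<in>W \<inter> U. f b = g b"
        using loc by blast
      have "openin (topo ?T) (U \<inter> (Z \<inter> {b\<in>W. g b \<noteq> 0}))"
        by (rule openin_Int[OF U]) (use swf_nonzero[OF S W(1,3)] in \<open>simp add: openin_subtopology_Int2\<close>)
      moreover have "a \<in> U \<inter> (Z \<inter> {b\<in>W. g b \<noteq> 0})" using a W U' by auto
      moreover have "U \<inter> (Z \<inter> {b\<in>W. g b \<noteq> 0}) \<subseteq> {a\<in>U. f a \<noteq> 0}" using W by auto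
      ultimately show "\<exists>T. openin (topo ?T) T \<and> a \<in> T \<and> T \<subseteq> {a\<in>U. f a \<noteq> 0}" by blast
    qed
    show "(\<lambda>a. inverse (f a)) \<in> reg ?T {a\<in>U. f a \<noteq> 0}"
      unfolding reg_subspace
    proof
      fix a assume a: "a \<in> {a\<in>U. f a \<noteq> 0}"
      then obtain W g where W: "openin (topo S) W" "a \<in> W" "g \<in> reg S W" "\<forall>b\<in>W \<inter> U. f b = g b"
        using loc by blast
      show "\<exists>W g. openin (topo S) W \<and> a \<in> W \<and> g \<in> reg S W \<and>
          (\<forall>b\<in>W \<inter> {a\<in>U. f a \<noteq> 0}. inverse (f b) = g b)"
        by (rule exI[of _ "{b\<in>W. g b \<noteq> 0}"], rule exI[of _ "\<lambda>b. inverse (g b)"])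
           (use swf_nonzero[OF S W(1,3)] swf_inverse[OF S W(1,3)] a W in auto)
    qed
    show "f \<in> reg ?T W" if "openin (topo ?T) W \<and> W \<subseteq> U" for W
      using reg_subspace_subset[OF f] that by blast
  }
  fix f assume f: "\<forall>a\<in>U. \<exists>W. openin (topo ?T) W \<and> a \<in> W \<and> W \<subseteq> U \<and>
                (\<exists>g\<in>reg ?T W. \<forall>b\<in>W. f b = g b)"
  show "f \<in> reg ?T U"
    unfolding reg_subspace
  proof
    fix a assume "a \<in> U"
    then obtain W g where W: "openin (topo ?T) W" "a \<in> W" "g \<in> reg ?T W" "\<forall>b\<in>W. f b = g b"
      using f by blast
    obtain W' where W': "openin (topo S) W'" "W = W' \<inter> Z" using W(1) by (auto simp: openin_subtopology)
    obtain W2 h where W2: "openin (topo S) W2" "a \<in> W2" "h \<in> reg S W2" "\<forall>b\<in>W2 \<inter> W. g b = h b"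
      using W unfolding reg_subspace by meson
    have o: "openin (topo S) (W2 \<inter> W')" using W2 W' by blast
    then have "h \<in> reg S (W2 \<inter> W')" using swf_restrict[OF S W2(1,3)] by blast
    then show "\<exists>W g. openin (topo S) W \<and> a \<in> W \<and> g \<in> reg S W \<and> (\<forall>b\<in>W \<inter> U. f b = g b)"
      using o W W' W2 U' by (intro exI[of _ "W2 \<inter> W'"] exI[of _ h]) auto
  qed
qed

subsection \<open>Morphisms\<close>

lemma morphismD:
  assumes "morphism S T f"
  shows "continuous_map (topo S) (topo T) f"
    and "a \<in> pts S \<Longrightarrow> f a \<in> pts T"
    and "openin (topo T) U \<Longrightarrow> openin (topo S) {a\<in>pts S. f a \<in> U}"
    and "openin (topo T) U \<Longrightarrow> g \<in> reg T U \<Longrightarrow> g \<circ> f \<in> reg S {a\<in>pts S. f a \<in> U}"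
  using assms by (auto simp: morphism_def continuous_map)

lemma morphismI:
  assumes "\<And>a. a \<in> pts S \<Longrightarrow> f a \<in> pts T"
    and "\<And>U. openin (topo T) U \<Longrightarrow> openin (topo S) {a\<in>pts S. f a \<in> U}"
    and "\<And>U g. openin (topo T) U \<Longrightarrow> g \<in> reg T U \<Longrightarrow> g \<circ> f \<in> reg S {a\<in>pts S. f a \<in> U}"
  shows "morphism S T f"
  using assms by (auto simp: morphism_def continuous_map)

lemma morphism_compose:
  assumes f: "morphism S T f" and g: "morphism T R g"
  shows "morphism S R (g \<circ> f)"
proof (rule morphismI)
  show "(g \<circ> f) a \<in> pts R" if "a \<in> pts S" for a
    using that morphismD(2)[OF f] morphismD(2)[OF g] by simp
  fix U assume U: "openin (topo R) U"
  have eq: "{a\<in>pts S. (g \<circ> f) a \<in> U} = {a\<in>pts S. f a \<in> {b\<in>pts T. g b \<in> U}}"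
    using morphismD(2)[OF f] by auto
  show "openin (topo S) {a\<in>pts S. (g \<circ> f) a \<in> U}"
    unfolding eq by (rule morphismD(3)[OF f morphismD(3)[OF g U]])
  show "k \<circ> (g \<circ> f) \<in> reg S {a\<in>pts S. (g \<circ> f) a \<in> U}" if "k \<in> reg R U" for k
    unfolding eq using morphismD(4)[OF f morphismD(3)[OF g U] morphismD(4)[OF g U that]]
    by (simp add: comp_assoc)
qed

lemma morphism_cong:
  assumes S: "space_with_functions S" and f: "morphism S T f" and eq: "\<And>a. a \<in> pts S \<Longrightarrow> g a = f a"
  shows "morphism S T g"
proof (rule morphismI)
  show "g a \<in> pts T" if "a \<in> pts S" for a using morphismD(2)[OF f that] eq[OF that] by simp
  fix U assume U: "openin (topo T) U"
  have set: "{a\<in>pts S. g a \<in> U} = {a\<in>pts S. f a \<in> U}" using eq by auto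
  show "openin (topo S) {a\<in>pts S. g a \<in> U}" unfolding set by (rule morphismD(3)[OF f U])
  show "k \<circ> g \<in> reg S {a\<in>pts S. g a \<in> U}" if k: "k \<in> reg T U" for k
    unfolding set by (rule swf_cong[OF S morphismD(3)[OF f U] morphismD(4)[OF f U k]]) (use eq in auto)
qed

lemma morphism_subspace_dom:
  assumes f: "morphism S T f"
  shows "morphism (subspace_fun S Z) T f"
proof (rule morphismI)
  show "f a \<in> pts T" if "a \<in> pts (subspace_fun S Z)" for a
    using that morphismD(2)[OF f] by simp
  fix U assume U: "openin (topo T) U"
  have eq: "{a\<in>pts (subspace_fun S Z). f a \<in> U} = Z \<inter> {a\<in>pts S. f a \<in> U}" by auto
  show "openin (topo (subspace_fun S Z)) {a\<in>pts (subspace_fun S Z). f a \<in> U}"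
    unfolding eq using morphismD(3)[OF f U] by (simp add: openin_subtopology_Int2)
  show "k \<circ> f \<in> reg (subspace_fun S Z) {a\<in>pts (subspace_fun S Z). f a \<in> U}" if k: "k \<in> reg T U" for k
    by (rule reg_subspaceI[OF morphismD(4)[OF f U k] morphismD(3)[OF f U]]) auto
qed

lemma morphism_subspace_cod:
  assumes S: "space_with_functions S" and f: "morphism S T f" and Z: "\<And>a. a \<in> pts S \<Longrightarrow> f a \<in> Z"
  shows "morphism S (subspace_fun T Z) f"
proof (rule morphismI)
  show "f a \<in> pts (subspace_fun T Z)" if "a \<in> pts S" for a using that morphismD(2)[OF f] Z by simp
  fix U assume "openin (topo (subspace_fun T Z)) U"
  then obtain U' where U': "openin (topo T) U'" "U = U' \<inter> Z" by (auto simp: openin_subtopology)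
  have eq: "{a\<in>pts S. f a \<in> U} = {a\<in>pts S. f a \<in> U'}" using U' Z by auto
  show o: "openin (topo S) {a\<in>pts S. f a \<in> U}" unfolding eq by (rule morphismD(3)[OF f U'(1)])
  fix k assume k: "k \<in> reg (subspace_fun T Z) U"
  show "k \<circ> f \<in> reg S {a\<in>pts S. f a \<in> U}"
  proof (rule reg_subspace_open[OF S o, of _ UNIV], unfold reg_subspace, rule ballI)
    fix a assume a: "a \<in> {a\<in>pts S. f a \<in> U}"
    then obtain W g where W: "openin (topo T) W" "f a \<in> W" "g \<in> reg T W" "\<forall>b\<in>W \<inter> U. k b = g b"
      using k unfolding reg_subspace by auto
    show "\<exists>W g. openin (topo S) W \<and> a \<in> W \<and> g \<in> reg S W \<and>
        (\<forall>b\<in>W \<inter> {a\<in>pts S. f a \<in> U}. (k \<circ> f) b = g b)"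
      by (rule exI[of _ "{a\<in>pts S. f a \<in> W}"], rule exI[of _ "g \<circ> f"])
         (use morphismD(3)[OF f W(1)] morphismD(4)[OF f W(1,3)] a W in auto)
  qed
qed

lemma morphism_from_subspace_cod:
  assumes f: "morphism S (subspace_fun T Z) f"
  shows "morphism S T f"
proof (rule morphismI)
  show "f a \<in> pts T" if "a \<in> pts S" for a using morphismD(2)[OF f that] by simp
  have Z: "f a \<in> Z" if "a \<in> pts S" for a using morphismD(2)[OF f that] by simp
  fix U assume U: "openin (topo T) U"
  have o: "openin (topo (subspace_fun T Z)) (Z \<inter> U)" using U by (simp add: openin_subtopology_Int2)
  have eq: "{a\<in>pts S. f a \<in> U} = {a\<in>pts S. f a \<in> Z \<inter> U}" using Z by auto
  show "openin (topo S) {a\<in>pts S. f a \<in> U}" unfolding eq by (rule morphismD(3)[OF f o])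
  show "k \<circ> f \<in> reg S {a\<in>pts S. f a \<in> U}" if k: "k \<in> reg T U" for k
    unfolding eq by (rule morphismD(4)[OF f o reg_subspaceI[OF k U]]) auto
qed

lemma morphism_id: "space_with_functions S \<Longrightarrow> morphism S S (\<lambda>a. a)"
proof (rule morphismI)
  assume S: "space_with_functions S"
  fix U assume U: "openin (topo S) U"
  then have eq: "{a\<in>pts S. a \<in> U} = U" using openin_subset by auto
  show "openin (topo S) {a\<in>pts S. a \<in> U}" using U eq by simp
  show "k \<circ> (\<lambda>a. a) \<in> reg S {a\<in>pts S. a \<in> U}" if "k \<in> reg S U" for k
    using that eq by (simp add: o_def)
qed

text \<open>This form lets one conclude about subspaces of a quotient or a product directly from its universal data:
  the pullbacks of the open sets and the regular functions of the ambient space suffice, because regular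
  functions on a subspace are local restrictions of those.\<close>

lemma morphism_subspacesI:
  assumes map: "\<And>a. a \<in> pts S \<Longrightarrow> a \<in> Z \<Longrightarrow> f a \<in> pts T \<inter> Z'"
    and op: "\<And>U. openin (topo T) U \<Longrightarrow> openin (topo S) {a\<in>pts S \<inter> Z. f a \<in> U}"
    and rg: "\<And>U g. openin (topo T) U \<Longrightarrow> g \<in> reg T U \<Longrightarrow> g \<circ> f \<in> reg S {a\<in>pts S \<inter> Z. f a \<in> U}"
  shows "morphism (subspace_fun S Z) (subspace_fun T Z') f"
proof (rule morphismI)
  show "f a \<in> pts (subspace_fun T Z')" if "a \<in> pts (subspace_fun S Z)" for a using that map by simp
  fix U assume "openin (topo (subspace_fun T Z')) U"
  then obtain U' where U': "openin (topo T) U'" "U = U' \<inter> Z'" by (auto simp: openin_subtopology)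
  have eq: "{a\<in>pts (subspace_fun S Z). f a \<in> U} = Z \<inter> {a\<in>pts S \<inter> Z. f a \<in> U'}" using U' map by auto
  show "openin (topo (subspace_fun S Z)) {a\<in>pts (subspace_fun S Z). f a \<in> U}"
    unfolding eq using op[OF U'(1)] by (simp add: openin_subtopology_Int2)
  fix k assume k: "k \<in> reg (subspace_fun T Z') U"
  show "k \<circ> f \<in> reg (subspace_fun S Z) {a\<in>pts (subspace_fun S Z). f a \<in> U}"
    unfolding reg_subspace
  proof
    fix a assume a: "a \<in> {a\<in>pts (subspace_fun S Z). f a \<in> U}"
    then obtain W g where W: "openin (topo T) W" "f a \<in> W" "g \<in> reg T W" "\<forall>b\<in>W \<inter> U. k b = g b"
      using k unfolding reg_subspace by auto
    show "\<exists>W g. openin (topo S) W \<and> a \<in> W \<and> g \<in> reg S W \<and>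
        (\<forall>b\<in>W \<inter> {a\<in>pts (subspace_fun S Z). f a \<in> U}. (k \<circ> f) b = g b)"
      by (rule exI[of _ "{a\<in>pts S \<inter> Z. f a \<in> W}"], rule exI[of _ "g \<circ> f"])
         (use op[OF W(1)] rg[OF W(1,3)] a W in auto)
  qed
qed

text \<open>The regular functions of \<open>subspace_fun S U\<close> on a subset of \<open>U\<close> do not mention \<open>U\<close>, so a morphism between
  subspaces restricts without a gluing argument.\<close>

lemma morphism_restrict:
  assumes f: "morphism (subspace_fun S U) (subspace_fun T W) f"
    and "U' \<subseteq> U" "W' \<subseteq> W" "openin (topo T) W'" and map: "\<And>a. a \<in> pts S \<Longrightarrow> a \<in> U' \<Longrightarrow> f a \<in> W'"
  shows "morphism (subspace_fun S U') (subspace_fun T W') f"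
proof (rule morphismI)
  have fW: "f a \<in> pts T" if "a \<in> pts S" "a \<in> U'" for a
    using morphismD(2)[OF f, of a] that assms(2) by auto
  show "f a \<in> pts (subspace_fun T W')" if "a \<in> pts (subspace_fun S U')" for a
    using that map fW by simp
  fix V assume "openin (topo (subspace_fun T W')) V"
  then have V: "openin (topo T) V" "V \<subseteq> W'"
    using assms(4) by (auto simp: openin_open_subtopology)
  then have V': "openin (topo (subspace_fun T W)) V"
    using assms(3) by (auto simp: openin_subtopology)
  have eq: "{a\<in>pts (subspace_fun S U'). f a \<in> V} = U' \<inter> {a\<in>pts (subspace_fun S U). f a \<in> V}"
    using assms(2) by auto
  obtain A where A: "openin (topo S) A" "{a\<in>pts (subspace_fun S U). f a \<in> V} = A \<inter> U"
    using morphismD(3)[OF f V'] by (auto simp: openin_subtopology)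
  show "openin (topo (subspace_fun S U')) {a\<in>pts (subspace_fun S U'). f a \<in> V}"
    unfolding eq A(2) using A(1) assms(2) by (auto simp: openin_subtopology)
  fix k assume "k \<in> reg (subspace_fun T W') V"
  then have k: "k \<in> reg (subspace_fun T W) V" by (rule reg_subspace_subset) simp
  show "k \<circ> f \<in> reg (subspace_fun S U') {a\<in>pts (subspace_fun S U'). f a \<in> V}"
    by (rule reg_subspace_subset[OF morphismD(4)[OF f V' k]]) (use assms(2) in auto)
qed

lemma isomorphism_restrict:
  assumes f: "isomorphism (subspace_fun S U) (subspace_fun T W) f"
    and U: "openin (topo S) U" and W: "openin (topo T) W"
    and W': "openin (topo T) W'" "W' \<subseteq> W"
  shows "isomorphism (subspace_fun S {a\<in>U. f a \<in> W'}) (subspace_fun T W') f"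
proof -
  obtain g where m: "morphism (subspace_fun S U) (subspace_fun T W) f"
    and g: "morphism (subspace_fun T W) (subspace_fun S U) g"
    and gf: "\<And>a. a \<in> pts (subspace_fun S U) \<Longrightarrow> g (f a) = a"
    and fg: "\<And>b. b \<in> pts (subspace_fun T W) \<Longrightarrow> f (g b) = b"
    using f unfolding isomorphism_def by blast
  have "openin (topo (subspace_fun T W)) W'"
    using W' W by (simp add: openin_open_subtopology)
  then have "openin (topo S) {a\<in>pts (subspace_fun S U). f a \<in> W'}"
    using morphismD(3)[OF m, of W'] U by (simp add: openin_open_subtopology)
  moreover have "{a\<in>pts (subspace_fun S U). f a \<in> W'} = {a\<in>U. f a \<in> W'}"
    using openin_subset[OF U] by auto
  ultimately have U': "openin (topo S) {a\<in>U. f a \<in> W'}" by simp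
  have 1: "morphism (subspace_fun S {a\<in>U. f a \<in> W'}) (subspace_fun T W') f"
    by (rule morphism_restrict[OF m _ W'(2,1)]) auto
  have 2: "morphism (subspace_fun T W') (subspace_fun S {a\<in>U. f a \<in> W'}) g"
  proof (rule morphism_restrict[OF g W'(2) _ U'])
    fix b assume b: "b \<in> pts T" "b \<in> W'"
    then have "b \<in> pts (subspace_fun T W)" using W'(2) by auto
    then show "g b \<in> {a\<in>U. f a \<in> W'}" using morphismD(2)[OF g, of b] fg[of b] b by auto
  qed auto
  show ?thesis unfolding isomorphism_def
    using 1 2 gf fg W'(2) by (intro conjI exI[of _ g]) auto
qed

lemma isomorphism_compose:
  assumes "isomorphism S T f" "isomorphism T R g" shows "isomorphism S R (g \<circ> f)"
proof -
  obtain f' where f': "morphism S T f" "morphism T S f'" "\<forall>a\<in>pts S. f' (f a) = a" "\<forall>b\<in>pts T. f (f' b) = b"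
    using assms(1) unfolding isomorphism_def by blast
  obtain g' where g': "morphism T R g" "morphism R T g'" "\<forall>a\<in>pts T. g' (g a) = a" "\<forall>b\<in>pts R. g (g' b) = b"
    using assms(2) unfolding isomorphism_def by blast
  show ?thesis unfolding isomorphism_def
    by (intro conjI exI[of _ "f' \<circ> g'"] morphism_compose[OF f'(1) g'(1)] morphism_compose[OF g'(2) f'(2)])
       (use f' g' morphismD(2)[OF f'(1)] morphismD(2)[OF g'(2)] in auto)
qed

subsection \<open>Products\<close>

text \<open>Along a pair of morphisms a sum of products of regular functions pulls back to a sum of products.\<close>

lemma tensor_reg_pullback:
  assumes T: "space_with_functions T" and \<alpha>: "morphism T S1 \<alpha>" and \<beta>: "morphism T S2 \<beta>"
    and U: "openin (topo S1) U" and W: "openin (topo S2) W" and h: "h \<in> tensor_reg S1 S2 U W"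
  shows "openin (topo T) {x\<in>pts T. \<alpha> x \<in> U \<and> \<beta> x \<in> W}"
    and "(\<lambda>x. h (\<alpha> x, \<beta> x)) \<in> reg T {x\<in>pts T. \<alpha> x \<in> U \<and> \<beta> x \<in> W}"
proof -
  have eq: "{x\<in>pts T. \<alpha> x \<in> U \<and> \<beta> x \<in> W} = {x\<in>pts T. \<alpha> x \<in> U} \<inter> {x\<in>pts T. \<beta> x \<in> W}" by auto
  show o: "openin (topo T) {x\<in>pts T. \<alpha> x \<in> U \<and> \<beta> x \<in> W}"
    unfolding eq using morphismD(3)[OF \<alpha> U] morphismD(3)[OF \<beta> W] by blast
  obtain k :: nat and f g where fg: "\<forall>i<k. f i \<in> reg S1 U \<and> g i \<in> reg S2 W"
    and h: "h = (\<lambda>(a, b). \<Sum>i<k. f i a * g i b)"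
    using h unfolding tensor_reg_def by blast
  have "(\<lambda>x. (f i \<circ> \<alpha>) x * (g i \<circ> \<beta>) x) \<in> reg T {x\<in>pts T. \<alpha> x \<in> U \<and> \<beta> x \<in> W}" if "i < k" for i
  proof (rule swf_mult[OF T o])
    show "f i \<circ> \<alpha> \<in> reg T {x\<in>pts T. \<alpha> x \<in> U \<and> \<beta> x \<in> W}"
      using swf_restrict[OF T morphismD(3)[OF \<alpha> U] morphismD(4)[OF \<alpha> U] o] fg that by blast
    show "g i \<circ> \<beta> \<in> reg T {x\<in>pts T. \<alpha> x \<in> U \<and> \<beta> x \<in> W}"
      using swf_restrict[OF T morphismD(3)[OF \<beta> W] morphismD(4)[OF \<beta> W] o] fg that by blast
  qed
  from swf_sum[OF T o this] show "(\<lambda>x. h (\<alpha> x, \<beta> x)) \<in> reg T {x\<in>pts T. \<alpha> x \<in> U \<and> \<beta> x \<in> W}"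
    by (simp add: h)
qed

lemma tensor_reg_one:
  assumes "space_with_functions S" "space_with_functions T"
    and "openin (topo S) U" "openin (topo T) W"
  shows "(\<lambda>_. 1) \<in> tensor_reg S T U W"
  unfolding tensor_reg_def
  by (rule CollectI, rule exI[of _ 1], rule exI[of _ "\<lambda>_ _. 1"], rule exI[of _ "\<lambda>_ _. 1"])
     (auto simp: swf_const[OF assms(1,3)] swf_const[OF assms(2,4)])

lemma pts_prod:
  assumes "space_with_functions S" "space_with_functions T"
  shows "pts (prod_fspace S T) = pts S \<times> pts T"
proof
  show "pts (prod_fspace S T) \<subseteq> pts S \<times> pts T"
  proof
    fix c assume "c \<in> pts (prod_fspace S T)"
    then obtain U W where "openin (topo S) U" "openin (topo T) W" "c \<in> U \<times> W"
      unfolding prod_fspace_def by auto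
    then show "c \<in> pts S \<times> pts T" using openin_subset[of "topo S" U] openin_subset[of "topo T" W] by auto
  qed
  show "pts S \<times> pts T \<subseteq> pts (prod_fspace S T)"
  proof
    fix c assume c: "c \<in> pts S \<times> pts T"
    have "\<exists>U W h. openin (topo S) U \<and> openin (topo T) W \<and> h \<in> tensor_reg S T U W \<and>
        pts S \<times> pts T = {c \<in> U \<times> W. h c \<noteq> (0::complex)}"
      by (rule exI[of _ "pts S"], rule exI[of _ "pts T"], rule exI[of _ "\<lambda>_. 1"])
         (auto intro!: tensor_reg_one assms)
    then show "c \<in> pts (prod_fspace S T)"
      using c unfolding prod_fspace_def by (simp, intro exI[of _ "pts S \<times> pts T"]) blast
  qed
qed

text \<open>The universal property of the product. Its basic open sets and its fractions are defined by tensors, whose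
  pullbacks are regular functions.\<close>

lemma morphism_pair:
  assumes T: "space_with_functions T" and S1: "space_with_functions S1" and S2: "space_with_functions S2"
    and \<alpha>: "morphism T S1 \<alpha>" and \<beta>: "morphism T S2 \<beta>"
  shows "morphism T (prod_fspace S1 S2) (\<lambda>x. (\<alpha> x, \<beta> x))"
  unfolding morphism_def
proof (intro conjI allI impI)
  let ?P = "prod_fspace S1 S2"
  let ?B = "{B. \<exists>U W h. openin (topo S1) U \<and> openin (topo S2) W \<and> h \<in> tensor_reg S1 S2 U W \<and>
                    B = {c \<in> U \<times> W. h c \<noteq> 0}}"
  have tB: "topo ?P = topology_generated_by ?B" by (simp add: prod_fspace_def)
  have pre: "openin (topo T) {x\<in>pts T. \<alpha> x \<in> U \<and> \<beta> x \<in> W \<and> h (\<alpha> x, \<beta> x) \<noteq> 0}"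
    if "openin (topo S1) U" "openin (topo S2) W" "h \<in> tensor_reg S1 S2 U W" for U W h
    using swf_nonzero[OF T tensor_reg_pullback[OF T \<alpha> \<beta> that]] by (simp add: conj_ac)
  show cont: "continuous_map (topo T) (topo ?P) (\<lambda>x. (\<alpha> x, \<beta> x))"
    unfolding tB continuous_on_generated_topo_iff
  proof (intro conjI allI impI)
    fix B assume "B \<in> ?B"
    then obtain U W h where B: "openin (topo S1) U" "openin (topo S2) W" "h \<in> tensor_reg S1 S2 U W"
      "B = {c \<in> U \<times> W. h c \<noteq> 0}" by blast
    have "(\<lambda>x. (\<alpha> x, \<beta> x)) -` B \<inter> pts T = {x\<in>pts T. \<alpha> x \<in> U \<and> \<beta> x \<in> W \<and> h (\<alpha> x, \<beta> x) \<noteq> 0}"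
      unfolding B(4) by auto
    then show "openin (topo T) ((\<lambda>x. (\<alpha> x, \<beta> x)) -` B \<inter> pts T)" using pre[OF B(1-3)] by simp
  next
    have "\<Union>?B = pts S1 \<times> pts S2" using pts_prod[OF S1 S2] tB by simp
    then show "(\<lambda>x. (\<alpha> x, \<beta> x)) ` pts T \<subseteq> \<Union>?B"
      using morphismD(2)[OF \<alpha>] morphismD(2)[OF \<beta>] by auto
  qed
  fix A F assume "openin (topo ?P) A \<and> F \<in> reg ?P A"
  then have A: "openin (topo ?P) A" and F: "F \<in> reg ?P A" by auto
  let ?A = "{x\<in>pts T. (\<alpha> x, \<beta> x) \<in> A}"
  have oA: "openin (topo T) ?A" using cont A by (simp add: continuous_map)
  show "F \<circ> (\<lambda>x. (\<alpha> x, \<beta> x)) \<in> reg T ?A"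
  proof (rule reg_subspace_open[OF T oA, of _ UNIV], unfold reg_subspace, rule ballI)
    fix x assume x: "x \<in> ?A"
    then obtain U W h k where *: "openin (topo S1) U" "openin (topo S2) W" "(\<alpha> x, \<beta> x) \<in> U \<times> W"
      "h \<in> tensor_reg S1 S2 U W" "k \<in> tensor_reg S1 S2 U W" "k (\<alpha> x, \<beta> x) \<noteq> 0"
      "\<forall>e\<in>A \<inter> U \<times> W. k e \<noteq> 0 \<longrightarrow> F e = h e / k e"
      using F unfolding prod_fspace_def by auto
    let ?D0 = "{x\<in>pts T. \<alpha> x \<in> U \<and> \<beta> x \<in> W}"
    note o = tensor_reg_pullback(1)[OF T \<alpha> \<beta> *(1,2,4)]
    note hr = tensor_reg_pullback(2)[OF T \<alpha> \<beta> *(1,2,4)] and kr = tensor_reg_pullback(2)[OF T \<alpha> \<beta> *(1,2,5)]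
    let ?D = "{x\<in>?D0. k (\<alpha> x, \<beta> x) \<noteq> 0}"
    have oD: "openin (topo T) ?D" by (rule swf_nonzero[OF T o kr])
    have "(\<lambda>x. h (\<alpha> x, \<beta> x) * inverse (k (\<alpha> x, \<beta> x))) \<in> reg T ?D"
      by (rule swf_mult[OF T oD swf_restrict[OF T o hr oD] swf_inverse[OF T o kr]]) auto
    then show "\<exists>W g. openin (topo T) W \<and> x \<in> W \<and> g \<in> reg T W \<and>
        (\<forall>b\<in>W \<inter> ?A. (F \<circ> (\<lambda>x. (\<alpha> x, \<beta> x))) b = g b)"
      using oD x * by (intro exI[of _ ?D] exI conjI) (assumption | auto simp: divide_inverse)+
  qed
qed

subsection \<open>Density and separation\<close>

lemma dense_open_iff:
  "dense_open S U \<longleftrightarrow> openin (topo S) U \<and> (\<forall>A. openin (topo S) A \<and> A \<noteq> {} \<longrightarrow> A \<inter> U \<noteq> {})"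
  unfolding dense_open_def using dense_intersects_open by (metis Int_commute)

lemma dense_openD:
  assumes "dense_open S U"
  shows "openin (topo S) U" "openin (topo S) A \<Longrightarrow> a \<in> A \<Longrightarrow> \<exists>b. b \<in> A \<and> b \<in> U"
  using assms unfolding dense_open_iff by blast+

lemma dense_openI:
  assumes "openin (topo S) U" "\<And>A a. openin (topo S) A \<Longrightarrow> a \<in> A \<Longrightarrow> \<exists>b. b \<in> A \<and> b \<in> U"
  shows "dense_open S U"
  unfolding dense_open_iff using assms by blast

text \<open>Over \<open>W\<close> the identity and \<open>inv \<circ> \<pi>\<close> (where \<open>inv\<close> is the inverse of the isomorphism) are two morphisms to
  the separated space \<open>S\<close> that agree on the dense set \<open>U\<close>. The set where they differ is the preimage of
  the complement of the diagonal; it is open and misses \<open>U\<close>, so it is empty.\<close>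

lemma isomorphism_domain_eq_preimage:
  assumes var: "variety S" and \<pi>: "morphism S T \<pi>" and U: "dense_open S U" and W: "openin (topo T) W"
    and iso: "isomorphism (subspace_fun S U) (subspace_fun T W) \<pi>" and a: "a \<in> pts S" "\<pi> a \<in> W"
  shows "a \<in> U"
proof -
  have S: "space_with_functions S" and diag: "closedin (topo (prod_fspace S S)) {(a, a) |a. a \<in> pts S}"
    using var unfolding variety_def by auto
  define N where "N = {a\<in>pts S. \<pi> a \<in> W}"
  define R where "R = subspace_fun S N"
  have N: "openin (topo S) N" unfolding N_def by (rule morphismD(3)[OF \<pi> W])
  have ptsR: "pts R = N" using openin_subset[OF N] by (auto simp: R_def)
  have R: "space_with_functions R" unfolding R_def by (rule space_with_functions_subspace[OF S])
  obtain g where m: "morphism (subspace_fun S U) (subspace_fun T W) \<pi>"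
    and g: "morphism (subspace_fun T W) (subspace_fun S U) g"
    and gf: "\<And>a. a \<in> pts (subspace_fun S U) \<Longrightarrow> g (\<pi> a) = a"
    using iso unfolding isomorphism_def by blast
  have "morphism R (subspace_fun T W) \<pi>"
    by (rule morphism_subspace_cod[OF R]) (use ptsR N_def \<pi> in \<open>auto simp: R_def intro: morphism_subspace_dom\<close>)
  from morphism_compose[OF this g] have g\<pi>': "morphism R (subspace_fun S U) (g \<circ> \<pi>)" .
  then have g\<pi>: "morphism R S (g \<circ> \<pi>)" by (rule morphism_from_subspace_cod)
  have id: "morphism R S (\<lambda>a. a)" unfolding R_def by (rule morphism_subspace_dom[OF morphism_id[OF S]])
  \<comment> \<open>The graph of \<open>g \<circ> \<pi>\<close> as a morphism: its preimage of the complement of the diagonal is open.\<close>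
  have pair: "morphism R (prod_fspace S S) (\<lambda>x. (x, (g \<circ> \<pi>) x))"
    by (rule morphism_pair[OF R S S id g\<pi>])
  define E where "E = {x\<in>pts R. (x, (g \<circ> \<pi>) x) \<in> pts (prod_fspace S S) - {(a, a) |a. a \<in> pts S}}"
  have "openin (topo R) E" unfolding E_def
    by (rule morphismD(3)[OF pair]) (use diag in \<open>simp add: closedin_def\<close>)
  then have oE: "openin (topo S) E" using N by (auto simp: R_def openin_open_subtopology)
  have Usub: "U \<subseteq> pts S" using dense_openD(1)[OF U] openin_subset by auto
  have aE: "a \<notin> E"
  proof
    assume "a \<in> E"
    then obtain y where y: "y \<in> E" "y \<in> U" using dense_openD(2)[OF U oE] by blast
    then have "g (\<pi> y) = y" using gf Usub by auto
    then show False using y Usub by (auto simp: E_def)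
  qed
  have aR: "a \<in> pts R" using a by (simp add: ptsR N_def)
  have "(a, (g \<circ> \<pi>) a) \<in> pts (prod_fspace S S)" by (rule morphismD(2)[OF pair aR])
  with aE aR have "(a, (g \<circ> \<pi>) a) \<in> {(a, a) |a. a \<in> pts S}" unfolding E_def by simp
  then have "a = (g \<circ> \<pi>) a" by auto
  moreover have "(g \<circ> \<pi>) a \<in> U" using morphismD(2)[OF g\<pi>' aR] by auto
  ultimately show ?thesis by simp
qed

text \<open>The inverse is part of the data, so that it can be used as a function below.\<close>

locale birational_morphism =
  fixes S :: "'s fspace" and T :: "'t fspace" and \<pi> U W and inv :: "'t \<Rightarrow> 's"
  assumes var: "variety S" and mor: "morphism S T \<pi>"
    and U: "dense_open S U" and W: "dense_open T W"
    and to: "morphism (subspace_fun S U) (subspace_fun T W) \<pi>"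
    and from_W: "morphism (subspace_fun T W) (subspace_fun S U) inv"
    and inv_left: "\<And>a. a \<in> U \<Longrightarrow> inv (\<pi> a) = a" and inv_right: "\<And>b. b \<in> W \<Longrightarrow> \<pi> (inv b) = b"
begin

lemma open_U: "openin (topo S) U" and open_W: "openin (topo T) W"
  using U W by (auto dest: dense_openD)

lemma U_pts: "a \<in> U \<Longrightarrow> a \<in> pts S"
  using openin_subset[OF open_U] by auto

lemma to_W: "a \<in> U \<Longrightarrow> \<pi> a \<in> W"
  using morphismD(2)[OF to, of a] U_pts by auto

lemma inv_U: "b \<in> W \<Longrightarrow> inv b \<in> U"
  using morphismD(2)[OF from_W, of b] openin_subset[OF open_W] by auto

lemma iso: "isomorphism (subspace_fun S U) (subspace_fun T W) \<pi>"
  unfolding isomorphism_def using to from_W inv_left inv_right by (intro conjI exI[of _ inv]) auto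

lemma mem_U: "a \<in> pts S \<Longrightarrow> \<pi> a \<in> W \<Longrightarrow> a \<in> U"
  by (rule isomorphism_domain_eq_preimage[OF var mor U open_W iso])

lemma openin_inv:
  assumes "openin (topo S) A" shows "openin (topo T) {b\<in>W. inv b \<in> A}"
proof -
  have "openin (topo (subspace_fun T W)) {b\<in>pts (subspace_fun T W). inv b \<in> A}"
    by (rule morphismD(3)[OF morphism_from_subspace_cod[OF from_W] assms])
  moreover have "{b\<in>pts (subspace_fun T W). inv b \<in> A} = {b\<in>W. inv b \<in> A}"
    using openin_subset[OF open_W] by auto
  ultimately show ?thesis by (simp add: openin_open_subtopology[OF open_W])
qed

end

lemma resolution_birational_morphism:
  assumes "resolution Y S \<pi>"
  obtains U W g where "birational_morphism Y S \<pi> U W g"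
proof -
  obtain U W where *: "morphism Y S \<pi>" "complete_variety Y" "dense_open Y U" "dense_open S W"
    and iso: "isomorphism (subspace_fun Y U) (subspace_fun S W) \<pi>"
    using assms unfolding resolution_def birational_resolution_def birational_map_def by blast
  have "U \<subseteq> pts Y" "W \<subseteq> pts S" using * openin_subset unfolding dense_open_def by blast+
  then obtain g where "morphism (subspace_fun Y U) (subspace_fun S W) \<pi>"
    "morphism (subspace_fun S W) (subspace_fun Y U) g"
    "\<And>a. a \<in> U \<Longrightarrow> g (\<pi> a) = a" "\<And>b. b \<in> W \<Longrightarrow> \<pi> (g b) = b"
    using iso unfolding isomorphism_def by (auto simp: subset_iff)
  with * have "birational_morphism Y S \<pi> U W g"
    by unfold_locales (simp_all add: complete_variety_def)
  then show ?thesis by (rule that)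
qed

subsection \<open>Quotients\<close>

lemma pts_orbit_space: "pts (orbit_space S G act) = orbit G act ` pts S"
proof -
  have "openin (topo (orbit_space S G act)) (orbit G act ` pts S)"
    unfolding openin_orbit_space by (auto intro!: subset_refl simp: Collect_conj_eq[symmetric])
      (metis (mono_tags, lifting) Collect_cong Collect_mem_eq imageI openin_topspace)
  then show ?thesis using openin_orbit_space[of S G act "pts (orbit_space S G act)"]
    by (meson openin_subset openin_topspace subset_antisym)
qed

lemma morphism_orbit: "morphism S (orbit_space S G act) (orbit G act)"
  by (rule morphismI) (auto simp: pts_orbit_space openin_orbit_space, simp add: orbit_space_def)

text \<open>\<open>\<pi>\<close> identifies the open subspace \<open>\<pi> ` pts R\<close> of \<open>S\<close> with the quotient of \<open>R\<close> by the fibres of \<open>\<pi>\<close>.\<close>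

definition open_quotient :: "'r fspace \<Rightarrow> 's fspace \<Rightarrow> ('r \<Rightarrow> 's) \<Rightarrow> bool" where
  "open_quotient R S \<pi> \<longleftrightarrow> morphism R S \<pi> \<and>
     (\<forall>A. A \<subseteq> \<pi> ` pts R \<and> openin (topo R) {z\<in>pts R. \<pi> z \<in> A} \<longrightarrow>
        openin (topo S) A \<and> (\<forall>f. f \<circ> \<pi> \<in> reg R {z\<in>pts R. \<pi> z \<in> A} \<longrightarrow> f \<in> reg S A))"

lemma open_quotientD:
  assumes "open_quotient R S \<pi>"
  shows "morphism R S \<pi>"
    and "A \<subseteq> \<pi> ` pts R \<Longrightarrow> openin (topo R) {z\<in>pts R. \<pi> z \<in> A} \<Longrightarrow> openin (topo S) A"
    and "A \<subseteq> \<pi> ` pts R \<Longrightarrow> openin (topo R) {z\<in>pts R. \<pi> z \<in> A} \<Longrightarrow>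
      f \<circ> \<pi> \<in> reg R {z\<in>pts R. \<pi> z \<in> A} \<Longrightarrow> f \<in> reg S A"
  using assms unfolding open_quotient_def by blast+

lemma open_quotient_image:
  assumes "open_quotient R S \<pi>" shows "openin (topo S) (\<pi> ` pts R)"
proof (rule open_quotientD(2)[OF assms])
  have "{z\<in>pts R. \<pi> z \<in> \<pi> ` pts R} = pts R" by auto
  then show "openin (topo R) {z\<in>pts R. \<pi> z \<in> \<pi> ` pts R}" by simp
qed simp

lemma open_quotient_induced_morphism:
  assumes R: "space_with_functions R" and \<pi>: "open_quotient R S \<pi>" and \<pi>': "morphism R S' \<pi>'"
    and \<Psi>: "\<And>z. z \<in> pts R \<Longrightarrow> \<Psi> (\<pi> z) = \<pi>' z"
  shows "morphism (subspace_fun S (\<pi> ` pts R)) (subspace_fun S' (\<pi>' ` pts R)) \<Psi>"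
proof (rule morphism_subspacesI)
  show "\<Psi> a \<in> pts S' \<inter> \<pi>' ` pts R" if "a \<in> \<pi> ` pts R" for a
    using that \<Psi> morphismD(2)[OF \<pi>'] by auto
  fix U assume U: "openin (topo S') U"
  let ?A = "{a\<in>pts S \<inter> \<pi> ` pts R. \<Psi> a \<in> U}"
  have pre: "{z\<in>pts R. \<pi> z \<in> ?A} = {z\<in>pts R. \<pi>' z \<in> U}"
  proof (intro Collect_cong conj_cong refl)
    fix z assume z: "z \<in> pts R"
    show "\<pi> z \<in> ?A \<longleftrightarrow> \<pi>' z \<in> U"
      by (simp add: \<Psi>[OF z] imageI[OF z] morphismD(2)[OF open_quotientD(1)[OF \<pi>] z])
  qed
  have sub: "?A \<subseteq> \<pi> ` pts R" by auto
  have o: "openin (topo R) {z\<in>pts R. \<pi> z \<in> ?A}" unfolding pre by (rule morphismD(3)[OF \<pi>' U])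
  show "openin (topo S) ?A" by (rule open_quotientD(2)[OF \<pi> sub o])
  fix g assume g: "g \<in> reg S' U"
  show "g \<circ> \<Psi> \<in> reg S ?A"
  proof (rule open_quotientD(3)[OF \<pi> sub o])
    show "g \<circ> \<Psi> \<circ> \<pi> \<in> reg R {z\<in>pts R. \<pi> z \<in> ?A}"
      unfolding pre
      by (rule swf_cong[OF R morphismD(3)[OF \<pi>' U] morphismD(4)[OF \<pi>' U g]]) (use \<Psi> in auto)
  qed
qed

text \<open>Both images are the quotient of \<open>R\<close> by one and the same equivalence relation.\<close>

lemma open_quotient_isomorphism:
  assumes R: "space_with_functions R" and \<pi>: "open_quotient R S \<pi>" and \<pi>': "open_quotient R S' \<pi>'"
    and fib: "\<And>z z'. z \<in> pts R \<Longrightarrow> z' \<in> pts R \<Longrightarrow> \<pi> z = \<pi> z' \<longleftrightarrow> \<pi>' z = \<pi>' z'"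
  obtains \<Psi> where "\<And>z. z \<in> pts R \<Longrightarrow> \<Psi> (\<pi> z) = \<pi>' z"
    "isomorphism (subspace_fun S (\<pi> ` pts R)) (subspace_fun S' (\<pi>' ` pts R)) \<Psi>"
proof -
  define \<Psi> where "\<Psi> b = \<pi>' (SOME z. z \<in> pts R \<and> \<pi> z = b)" for b
  define \<Theta> where "\<Theta> b = \<pi> (SOME z. z \<in> pts R \<and> \<pi>' z = b)" for b
  have \<Psi>: "\<Psi> (\<pi> z) = \<pi>' z" if z: "z \<in> pts R" for z
    unfolding \<Psi>_def by (rule someI2[of _ z]) (use z fib in auto)
  have \<Theta>: "\<Theta> (\<pi>' z) = \<pi> z" if z: "z \<in> pts R" for z
    unfolding \<Theta>_def by (rule someI2[of _ z]) (use z fib in auto)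
  have "isomorphism (subspace_fun S (\<pi> ` pts R)) (subspace_fun S' (\<pi>' ` pts R)) \<Psi>"
    unfolding isomorphism_def
    by (intro conjI exI[of _ \<Theta>] open_quotient_induced_morphism[OF R \<pi> open_quotientD(1)[OF \<pi>'] \<Psi>]
        open_quotient_induced_morphism[OF R \<pi>' open_quotientD(1)[OF \<pi>] \<Theta>]) (auto simp: \<Psi> \<Theta>)
  with \<Psi> that show ?thesis by blast
qed

lemma open_quotient_restrict:
  assumes R: "space_with_functions R" and \<pi>: "open_quotient R S \<pi>" and R0: "openin (topo R) R0"
    and sat: "\<And>z z'. z \<in> pts R \<Longrightarrow> z' \<in> R0 \<Longrightarrow> \<pi> z = \<pi> z' \<Longrightarrow> z \<in> R0"
  shows "open_quotient (subspace_fun R R0) S \<pi>"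
  unfolding open_quotient_def
proof (intro conjI allI impI)
  show "morphism (subspace_fun R R0) S \<pi>" by (rule morphism_subspace_dom[OF open_quotientD(1)[OF \<pi>]])
  have pts: "pts (subspace_fun R R0) = R0" using openin_subset[OF R0] by auto
  fix A assume "A \<subseteq> \<pi> ` pts (subspace_fun R R0) \<and>
      openin (topo (subspace_fun R R0)) {z\<in>pts (subspace_fun R R0). \<pi> z \<in> A}"
  then have A: "A \<subseteq> \<pi> ` R0" "openin (topo R) {z\<in>R0. \<pi> z \<in> A}"
    using R0 unfolding pts by (auto simp: openin_open_subtopology)
  have eq: "{z\<in>pts R. \<pi> z \<in> A} = {z\<in>R0. \<pi> z \<in> A}" using A(1) sat openin_subset[OF R0] by blast
  have sub: "A \<subseteq> \<pi> ` pts R" using A(1) openin_subset[OF R0] by auto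
  have o: "openin (topo R) {z\<in>pts R. \<pi> z \<in> A}" unfolding eq by (rule A(2))
  show "openin (topo S) A" by (rule open_quotientD(2)[OF \<pi> sub o])
  fix f assume f: "f \<circ> \<pi> \<in> reg (subspace_fun R R0) {z\<in>pts (subspace_fun R R0). \<pi> z \<in> A}"
  show "f \<in> reg S A"
    by (rule open_quotientD(3)[OF \<pi> sub o], rule reg_subspace_open[OF R o])
       (use f in \<open>simp only: pts eq\<close>)
qed

text \<open>Openness and regularity on an orbit space are defined by pullback to \<open>S\<close>, and the invariance of the image
  makes the preimage in \<open>S\<close> of a subset of the new image a subset of the old one.\<close>

lemma open_quotient_orbit_space:
  assumes \<pi>: "open_quotient R S \<pi>" and self: "\<And>a. a \<in> pts S \<Longrightarrow> a \<in> orbit G act a"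
    and inv: "\<And>g z. g \<in> G \<Longrightarrow> z \<in> pts R \<Longrightarrow> act g (\<pi> z) \<in> \<pi> ` pts R"
  shows "open_quotient R (orbit_space S G act) (\<lambda>z. orbit G act (\<pi> z))"
  unfolding open_quotient_def
proof (intro conjI allI impI)
  show "morphism R (orbit_space S G act) (\<lambda>z. orbit G act (\<pi> z))"
    using morphism_compose[OF open_quotientD(1)[OF \<pi>] morphism_orbit] by (simp add: o_def)
  fix A assume "A \<subseteq> (\<lambda>z. orbit G act (\<pi> z)) ` pts R \<and>
      openin (topo R) {z\<in>pts R. orbit G act (\<pi> z) \<in> A}"
  then have A: "A \<subseteq> (\<lambda>z. orbit G act (\<pi> z)) ` pts R"
    "openin (topo R) {z\<in>pts R. orbit G act (\<pi> z) \<in> A}" by auto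
  have \<pi>S: "\<pi> z \<in> pts S" if "z \<in> pts R" for z by (rule morphismD(2)[OF open_quotientD(1)[OF \<pi>] that])
  let ?B = "{a\<in>pts S. orbit G act a \<in> A}"
  have sub: "?B \<subseteq> \<pi> ` pts R"
  proof
    fix a assume a: "a \<in> ?B"
    then obtain z where z: "z \<in> pts R" "orbit G act a = orbit G act (\<pi> z)" using A(1) by auto
    then have "a \<in> orbit G act (\<pi> z)" using self a by auto
    then show "a \<in> \<pi> ` pts R" using inv z(1) by (auto simp: orbit_def)
  qed
  have eq: "{z\<in>pts R. \<pi> z \<in> ?B} = {z\<in>pts R. orbit G act (\<pi> z) \<in> A}" using \<pi>S by auto
  have o: "openin (topo R) {z\<in>pts R. \<pi> z \<in> ?B}" unfolding eq by (rule A(2))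
  show "openin (topo (orbit_space S G act)) A"
    unfolding openin_orbit_space using open_quotientD(2)[OF \<pi> sub o] A(1) \<pi>S by auto
  fix f assume f: "f \<circ> (\<lambda>z. orbit G act (\<pi> z)) \<in> reg R {z\<in>pts R. orbit G act (\<pi> z) \<in> A}"
  have "f \<circ> orbit G act \<in> reg S ?B"
    by (rule open_quotientD(3)[OF \<pi> sub o]) (use f in \<open>simp only: eq o_def\<close>)
  then show "f \<in> reg (orbit_space S G act) A" by (simp add: orbit_space_def)
qed

text \<open>A chart of \<open>S\<close> is lifted through a map that is an isomorphism over an open set containing the image.\<close>

lemma open_quotient_transport:
  assumes R: "space_with_functions R" and S': "space_with_functions S'" and \<pi>: "open_quotient R S \<pi>"
    and U: "openin (topo S') U" and W: "openin (topo S) W"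
    and iso: "isomorphism (subspace_fun S' U) (subspace_fun S W) f"
    and \<pi>': "\<And>z. z \<in> pts R \<Longrightarrow> \<pi> z \<in> W \<and> \<pi>' z \<in> U \<and> f (\<pi>' z) = \<pi> z"
  shows "open_quotient R S' \<pi>'"
proof -
  obtain g where m: "morphism (subspace_fun S' U) (subspace_fun S W) f"
    and g: "morphism (subspace_fun S W) (subspace_fun S' U) g"
    and gf: "\<And>a. a \<in> U \<Longrightarrow> g (f a) = a"
    using iso openin_subset[OF U] unfolding isomorphism_def by (auto simp: subset_iff)
  have UW: "f a \<in> W" if "a \<in> U" for a using morphismD(2)[OF m, of a] openin_subset[OF U] that by auto
  have g\<pi>: "g (\<pi> z) = \<pi>' z" if "z \<in> pts R" for z using gf \<pi>'[OF that] by metis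
  have "morphism R (subspace_fun S W) \<pi>"
    by (rule morphism_subspace_cod[OF R open_quotientD(1)[OF \<pi>]]) (use \<pi>' in auto)
  from morphism_from_subspace_cod[OF morphism_compose[OF this g]]
  have mor: "morphism R S' \<pi>'" by (rule morphism_cong[OF R]) (simp add: g\<pi>)
  show ?thesis
    unfolding open_quotient_def
  proof (intro conjI allI impI)
    show "morphism R S' \<pi>'" by (rule mor)
    fix A assume "A \<subseteq> \<pi>' ` pts R \<and> openin (topo R) {z\<in>pts R. \<pi>' z \<in> A}"
    then have A: "A \<subseteq> \<pi>' ` pts R" "openin (topo R) {z\<in>pts R. \<pi>' z \<in> A}" by auto
    have AU: "A \<subseteq> U" using A(1) \<pi>' by auto
    have sub: "f ` A \<subseteq> \<pi> ` pts R" using A(1) \<pi>' by auto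
    have eq: "{z\<in>pts R. \<pi> z \<in> f ` A} = {z\<in>pts R. \<pi>' z \<in> A}"
    proof (intro Collect_cong conj_cong refl iffI)
      fix z assume z: "z \<in> pts R"
      show "\<pi>' z \<in> A" if "\<pi> z \<in> f ` A"
        using that g\<pi>[OF z] gf AU by auto
      show "\<pi> z \<in> f ` A" if "\<pi>' z \<in> A" using that \<pi>'[OF z] by (auto intro: rev_image_eqI)
    qed
    have o: "openin (topo R) {z\<in>pts R. \<pi> z \<in> f ` A}" unfolding eq by (rule A(2))
    have ofA: "openin (topo S) (f ` A)" by (rule open_quotientD(2)[OF \<pi> sub o])
    have ofAW: "openin (topo (subspace_fun S W)) (f ` A)"
      using ofA AU UW by (auto simp: openin_open_subtopology[OF W])
    have eqA: "{a\<in>pts (subspace_fun S' U). f a \<in> f ` A} = A"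
      using AU gf openin_subset[OF U] by auto (metis subset_iff)
    show oA: "openin (topo S') A"
      using morphismD(3)[OF m ofAW] unfolding eqA by (simp add: openin_open_subtopology[OF U])
    fix k assume k: "k \<circ> \<pi>' \<in> reg R {z\<in>pts R. \<pi>' z \<in> A}"
    have "k \<circ> g \<in> reg S (f ` A)"
    proof (rule open_quotientD(3)[OF \<pi> sub o])
      show "k \<circ> g \<circ> \<pi> \<in> reg R {z\<in>pts R. \<pi> z \<in> f ` A}"
        unfolding eq by (rule swf_cong[OF R A(2) k]) (simp add: g\<pi>)
    qed
    then have "k \<circ> g \<in> reg (subspace_fun S W) (f ` A)" by (rule reg_subspaceI[OF _ ofA]) simp
    from morphismD(4)[OF m ofAW this] have "k \<circ> g \<circ> f \<in> reg (subspace_fun S' U) A" unfolding eqA .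
    then have "k \<circ> g \<circ> f \<in> reg S' A" by (rule reg_subspace_open[OF S' oA])
    then show "k \<in> reg S' A" by (rule swf_cong[OF S' oA]) (use gf AU in auto)
  qed
qed

subsection \<open>Affine space\<close>

lemma openin_affine:
  "openin (topo (affine_space N)) W \<longleftrightarrow> W \<subseteq> affine_points N \<and>
     (\<forall>a\<in>W. \<exists>Q. polyfun Q \<and> Q a \<noteq> 0 \<and> {x\<in>affine_points N. Q x \<noteq> 0} \<subseteq> W)"
proof -
  let ?B = "range (\<lambda>P. {x\<in>affine_points N. poly_eval P x \<noteq> 0})"
  let ?R = "\<lambda>W. W \<subseteq> affine_points N \<and>
     (\<forall>a\<in>W. \<exists>Q. polyfun Q \<and> Q a \<noteq> 0 \<and> {x\<in>affine_points N. Q x \<noteq> 0} \<subseteq> W)"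
  have basic: "openin (topo (affine_space N)) {x\<in>affine_points N. Q x \<noteq> 0}" if "polyfun Q" for Q
    using that unfolding polyfun_def affine_space_def by (auto intro: topology_generated_by_Basis)
  have "?R W" if "generate_topology_on ?B W"
    using that
  proof (induction rule: generate_topology_on.induct)
    case (Int A B)
    show ?case
    proof (intro conjI ballI)
      fix a assume "a \<in> A \<inter> B"
      then obtain Q1 Q2 where "polyfun Q1" "Q1 a \<noteq> 0" "{x\<in>affine_points N. Q1 x \<noteq> 0} \<subseteq> A"
        "polyfun Q2" "Q2 a \<noteq> 0" "{x\<in>affine_points N. Q2 x \<noteq> 0} \<subseteq> B"
        using Int.IH by blast
      then show "\<exists>Q. polyfun Q \<and> Q a \<noteq> 0 \<and> {x\<in>affine_points N. Q x \<noteq> 0} \<subseteq> A \<inter> B"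
        by (intro exI[of _ "\<lambda>x. Q1 x * Q2 x"]) auto
    qed (use Int in blast)
  next
    case (UN K)
    show ?case
    proof (intro conjI ballI)
      show "\<Union>K \<subseteq> affine_points N" using UN.IH by (intro Union_least) blast
      fix a assume "a \<in> \<Union>K"
      then obtain A where A: "A \<in> K" "a \<in> A" by blast
      then obtain Q where "polyfun Q" "Q a \<noteq> 0" "{x\<in>affine_points N. Q x \<noteq> 0} \<subseteq> A"
        using UN.IH[OF A(1)] by blast
      then show "\<exists>Q. polyfun Q \<and> Q a \<noteq> 0 \<and> {x\<in>affine_points N. Q x \<noteq> 0} \<subseteq> \<Union>K"
        using A by (intro exI[of _ Q]) blast
    qed
  qed auto
  note gen = this
  have opn: "openin (topo (affine_space N)) W" if "?R W"
  proof (subst openin_subopen, rule ballI)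
    fix a assume a: "a \<in> W"
    then obtain Q where Q: "polyfun Q" "Q a \<noteq> 0" "{x\<in>affine_points N. Q x \<noteq> 0} \<subseteq> W"
      using \<open>?R W\<close> by blast
    have "a \<in> affine_points N" using a \<open>?R W\<close> by blast
    then show "\<exists>T. openin (topo (affine_space N)) T \<and> a \<in> T \<and> T \<subseteq> W"
      using basic[OF Q(1)] Q(2,3) by (intro exI[of _ "{x\<in>affine_points N. Q x \<noteq> 0}"]) simp
  qed
  have "openin (topo (affine_space N)) W = generate_topology_on ?B W"
    unfolding affine_space_def fspace.simps by (rule openin_topology_generated_by_iff)
  with gen opn show ?thesis by blast
qed

lemma pts_affine [simp]: "pts (affine_space N) = affine_points N"
proof -
  have "openin (topo (affine_space N)) (affine_points N)"
    unfolding openin_affine by (auto intro!: exI[of _ "\<lambda>_. 1"])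
  then show ?thesis using openin_affine[of N "pts (affine_space N)"] openin_subset by blast
qed

lemma reg_affine:
  "f \<in> reg (affine_space N) U \<longleftrightarrow> (\<forall>a\<in>U. \<exists>P Q. polyfun P \<and> polyfun Q \<and> Q a \<noteq> 0 \<and>
     (\<forall>b\<in>U. Q b \<noteq> 0 \<longrightarrow> f b = P b / Q b))"
proof -
  have "(\<exists>P Q. poly_eval Q a \<noteq> 0 \<and> (\<forall>b\<in>U. poly_eval Q b \<noteq> 0 \<longrightarrow> f b = poly_eval P b / poly_eval Q b)) \<longleftrightarrow>
     (\<exists>P Q. polyfun P \<and> polyfun Q \<and> Q a \<noteq> 0 \<and> (\<forall>b\<in>U. Q b \<noteq> 0 \<longrightarrow> f b = P b / Q b))" for a
    unfolding polyfun_def by auto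
  then show ?thesis by (simp add: affine_space_def)
qed

lemma reg_affineE:
  assumes "f \<in> reg (affine_space N) U" "a \<in> U"
  obtains P Q where "polyfun P" "polyfun Q" "Q a \<noteq> 0" "\<forall>b\<in>U. Q b \<noteq> 0 \<longrightarrow> f b = P b / Q b"
  using assms unfolding reg_affine by blast

lemma openin_affineE:
  assumes "openin (topo (affine_space N)) W" "a \<in> W"
  obtains Q where "polyfun Q" "Q a \<noteq> 0" "{x\<in>affine_points N. Q x \<noteq> 0} \<subseteq> W"
  using assms unfolding openin_affine by blast

lemma space_with_functions_affine: "space_with_functions (affine_space N)"
  unfolding space_with_functions_def
proof (intro allI impI conjI ballI)
  let ?A = "affine_space N"
  fix U assume U: "openin (topo ?A) U"
  then have sub: "U \<subseteq> affine_points N" by (simp add: openin_affine)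
  show "(\<lambda>_. c) \<in> reg ?A U" for c
    unfolding reg_affine by (intro ballI exI[of _ "\<lambda>_. c"] exI[of _ "\<lambda>_. 1"]) simp
  {
    fix f g assume f: "f \<in> reg ?A U" and g: "g \<in> reg ?A U"
    have "\<exists>P P' Q. polyfun P \<and> polyfun P' \<and> polyfun Q \<and> Q a \<noteq> 0 \<and>
        (\<forall>b\<in>U. Q b \<noteq> 0 \<longrightarrow> f b = P b / Q b \<and> g b = P' b / Q b)" if a: "a \<in> U" for a
    proof -
      obtain P Q where 1: "polyfun P" "polyfun Q" "Q a \<noteq> 0" "\<forall>b\<in>U. Q b \<noteq> 0 \<longrightarrow> f b = P b / Q b"
        by (rule reg_affineE[OF f a])
      obtain P' Q' where 2: "polyfun P'" "polyfun Q'" "Q' a \<noteq> 0" "\<forall>b\<in>U. Q' b \<noteq> 0 \<longrightarrow> g b = P' b / Q' b"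
        by (rule reg_affineE[OF g a])
      show ?thesis
        by (rule exI[of _ "\<lambda>x. P x * Q' x"], rule exI[of _ "\<lambda>x. P' x * Q x"], rule exI[of _ "\<lambda>x. Q x * Q' x"])
           (use 1 2 in auto)
    qed
    note common = this
    show "(\<lambda>a. f a + g a) \<in> reg ?A U"
      unfolding reg_affine
    proof
      fix a assume "a \<in> U"
      from common[OF this] obtain P P' Q where "polyfun P" "polyfun P'" "polyfun Q" "Q a \<noteq> 0"
        "\<forall>b\<in>U. Q b \<noteq> 0 \<longrightarrow> f b = P b / Q b \<and> g b = P' b / Q b" by (elim exE conjE)
      then show "\<exists>P Q. polyfun P \<and> polyfun Q \<and> Q a \<noteq> 0 \<and> (\<forall>b\<in>U. Q b \<noteq> 0 \<longrightarrow> f b + g b = P b / Q b)"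
        by (intro exI[of _ "\<lambda>x. P x + P' x"] exI[of _ Q]) (auto simp: add_divide_distrib)
    qed
    show "(\<lambda>a. f a * g a) \<in> reg ?A U"
      unfolding reg_affine
    proof
      fix a assume "a \<in> U"
      from common[OF this] obtain P P' Q where "polyfun P" "polyfun P'" "polyfun Q" "Q a \<noteq> 0"
        "\<forall>b\<in>U. Q b \<noteq> 0 \<longrightarrow> f b = P b / Q b \<and> g b = P' b / Q b" by (elim exE conjE)
      then show "\<exists>P Q. polyfun P \<and> polyfun Q \<and> Q a \<noteq> 0 \<and> (\<forall>b\<in>U. Q b \<noteq> 0 \<longrightarrow> f b * g b = P b / Q b)"
        by (intro exI[of _ "\<lambda>x. P x * P' x"] exI[of _ "\<lambda>x. Q x * Q x"]) auto
    qed
  }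
  {
    fix f assume f: "f \<in> reg ?A U"
    show "openin (topo ?A) {a\<in>U. f a \<noteq> 0}"
      unfolding openin_affine
    proof (intro conjI ballI)
      fix a assume a: "a \<in> {a\<in>U. f a \<noteq> 0}"
      obtain P Q where 1: "polyfun P" "polyfun Q" "Q a \<noteq> 0" "\<forall>b\<in>U. Q b \<noteq> 0 \<longrightarrow> f b = P b / Q b"
        using f a unfolding reg_affine by blast
      obtain R where R: "polyfun R" "R a \<noteq> 0" "{x\<in>affine_points N. R x \<noteq> 0} \<subseteq> U"
        using U a unfolding openin_affine by blast
      have "P a \<noteq> 0" using a 1 by auto
      then show "\<exists>Q. polyfun Q \<and> Q a \<noteq> 0 \<and> {x\<in>affine_points N. Q x \<noteq> 0} \<subseteq> {a\<in>U. f a \<noteq> 0}"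
        by (intro exI[of _ "\<lambda>x. P x * Q x * R x"]) (use 1 R in auto)
    qed (use sub in auto)
    show "(\<lambda>a. inverse (f a)) \<in> reg ?A {a\<in>U. f a \<noteq> 0}"
      unfolding reg_affine
    proof
      fix a assume a: "a \<in> {a\<in>U. f a \<noteq> 0}"
      obtain P Q where 1: "polyfun P" "polyfun Q" "Q a \<noteq> 0" "\<forall>b\<in>U. Q b \<noteq> 0 \<longrightarrow> f b = P b / Q b"
        using f a unfolding reg_affine by blast
      have "P a \<noteq> 0" using a 1 by auto
      then show "\<exists>P Q. polyfun P \<and> polyfun Q \<and> Q a \<noteq> 0 \<and>
          (\<forall>b\<in>{a\<in>U. f a \<noteq> 0}. Q b \<noteq> 0 \<longrightarrow> inverse (f b) = P b / Q b)"
        by (intro exI[of _ "\<lambda>x. Q x * Q x"] exI[of _ "\<lambda>x. P x * Q x"]) (use 1 in \<open>auto simp: field_simps\<close>)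
    qed
    show "f \<in> reg ?A W" if "openin (topo ?A) W \<and> W \<subseteq> U" for W
      unfolding reg_affine
    proof
      fix a assume "a \<in> W"
      with that have "a \<in> U" by auto
      then obtain P Q where "polyfun P" "polyfun Q" "Q a \<noteq> 0" "\<forall>b\<in>U. Q b \<noteq> 0 \<longrightarrow> f b = P b / Q b"
        using f unfolding reg_affine by blast
      then show "\<exists>P Q. polyfun P \<and> polyfun Q \<and> Q a \<noteq> 0 \<and> (\<forall>b\<in>W. Q b \<noteq> 0 \<longrightarrow> f b = P b / Q b)"
        using that by (intro exI[of _ P] exI[of _ Q]) auto
    qed
  }
  fix f assume f: "\<forall>a\<in>U. \<exists>W. openin (topo ?A) W \<and> a \<in> W \<and> W \<subseteq> U \<and>
                (\<exists>g\<in>reg ?A W. \<forall>b\<in>W. f b = g b)"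
  show "f \<in> reg ?A U"
    unfolding reg_affine
  proof
    fix a assume a: "a \<in> U"
    then obtain W g where W: "openin (topo ?A) W" "a \<in> W" "g \<in> reg ?A W" "\<forall>b\<in>W. f b = g b"
      using f by blast
    obtain P Q where 1: "polyfun P" "polyfun Q" "Q a \<noteq> 0" "\<forall>b\<in>W. Q b \<noteq> 0 \<longrightarrow> g b = P b / Q b"
      by (rule reg_affineE[OF W(3,2)])
    obtain R where R: "polyfun R" "R a \<noteq> 0" "{x\<in>affine_points N. R x \<noteq> 0} \<subseteq> W"
      by (rule openin_affineE[OF W(1,2)])
    show "\<exists>P Q. polyfun P \<and> polyfun Q \<and> Q a \<noteq> 0 \<and> (\<forall>b\<in>U. Q b \<noteq> 0 \<longrightarrow> f b = P b / Q b)"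
      by (rule exI[of _ "\<lambda>x. P x * R x"], rule exI[of _ "\<lambda>x. Q x * R x"])
         (use 1 R W sub in \<open>auto simp: subset_iff\<close>)
  qed
qed

abbreviation zariski :: "nat \<Rightarrow> (nat \<Rightarrow> complex) set \<Rightarrow> (nat \<Rightarrow> complex) fspace" where
  "zariski N C \<equiv> subspace_fun (affine_space N) C"

lemma space_with_functions_zariski: "space_with_functions (zariski N C)"
  by (rule space_with_functions_subspace[OF space_with_functions_affine])

lemma pts_zariski: "C \<subseteq> affine_points N \<Longrightarrow> pts (zariski N C) = C"
  by auto

lemma openin_zariski:
  assumes "C \<subseteq> affine_points N"
  shows "openin (topo (zariski N C)) B \<longleftrightarrow> B \<subseteq> C \<and>
     (\<forall>a\<in>B. \<exists>Q. polyfun Q \<and> Q a \<noteq> 0 \<and> {x\<in>C. Q x \<noteq> 0} \<subseteq> B)" (is "?L \<longleftrightarrow> ?R")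
proof
  assume ?L
  then obtain W where W: "openin (topo (affine_space N)) W" "B = W \<inter> C" by (auto simp: openin_subtopology)
  show ?R
  proof (intro conjI ballI)
    fix a assume a: "a \<in> B"
    then have "a \<in> W" using W(2) by blast
    from openin_affineE[OF W(1) this] obtain Q
      where "polyfun Q" "Q a \<noteq> 0" "{x\<in>affine_points N. Q x \<noteq> 0} \<subseteq> W" .
    then show "\<exists>Q. polyfun Q \<and> Q a \<noteq> 0 \<and> {x\<in>C. Q x \<noteq> 0} \<subseteq> B"
      using W(2) assms by (intro exI[of _ Q]) auto
  qed (use W(2) in auto)
next
  assume R: ?R
  show ?L
  proof (subst openin_subopen, rule ballI)
    fix a assume a: "a \<in> B"
    then obtain Q where Q: "polyfun Q" "Q a \<noteq> 0" "{x\<in>C. Q x \<noteq> 0} \<subseteq> B" using R by blast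
    have "openin (topo (affine_space N)) {x\<in>affine_points N. Q x \<noteq> 0}"
      unfolding openin_affine using Q by blast
    then have "openin (topo (zariski N C)) (C \<inter> {x\<in>affine_points N. Q x \<noteq> 0})"
      by (simp add: openin_subtopology_Int2)
    moreover have "C \<inter> {x\<in>affine_points N. Q x \<noteq> 0} = {x\<in>C. Q x \<noteq> 0}" using assms by auto
    ultimately show "\<exists>T. openin (topo (zariski N C)) T \<and> a \<in> T \<and> T \<subseteq> B" using Q a R by auto
  qed
qed

text \<open>Multiplying numerator and denominator by equations of the neighbourhoods on which the fraction represents
  \<open>f\<close> gives an identity without denominators that holds on all of \<open>B\<close>.\<close>

lemma reg_zariskiD:
  assumes f: "f \<in> reg (zariski N C) B" and B: "B \<subseteq> affine_points N" and a: "a \<in> B"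
  obtains P Q where "polyfun P" "polyfun Q" "Q a \<noteq> 0" "\<And>x. x \<in> B \<Longrightarrow> f x * Q x = P x"
proof -
  obtain W g where W: "openin (topo (affine_space N)) W" "a \<in> W" "g \<in> reg (affine_space N) W"
    "\<forall>b\<in>W \<inter> B. f b = g b" using f a unfolding reg_subspace by blast
  obtain P Q where 1: "polyfun P" "polyfun Q" "Q a \<noteq> 0" "\<forall>b\<in>W. Q b \<noteq> 0 \<longrightarrow> g b = P b / Q b"
    by (rule reg_affineE[OF W(3,2)])
  obtain R where R: "polyfun R" "R a \<noteq> 0" "{x\<in>affine_points N. R x \<noteq> 0} \<subseteq> W"
    by (rule openin_affineE[OF W(1,2)])
  \<comment> \<open>The factor \<open>Q * R\<close> on both sides makes them vanish where the fraction need not represent \<open>f\<close>.\<close>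
  show ?thesis
  proof (rule that[of "\<lambda>x. (P x * R x) * (Q x * R x)" "\<lambda>x. (Q x * R x) * (Q x * R x)"])
    fix x assume x: "x \<in> B"
    show "f x * ((Q x * R x) * (Q x * R x)) = (P x * R x) * (Q x * R x)"
    proof (cases "Q x * R x = 0")
      case False
      then have "f x = P x / Q x" using x W(4) 1(4) R(3) B by auto
      then show ?thesis using False by (simp add: field_simps)
    next
      case True
      show ?thesis by (simp only: True mult_zero_left mult_zero_right)
    qed
  qed (use 1 R in auto)
qed

lemma reg_zariskiI:
  assumes B: "B \<subseteq> affine_points N"
    and f: "\<And>a. a \<in> B \<Longrightarrow> \<exists>P Q. polyfun P \<and> polyfun Q \<and> Q a \<noteq> 0 \<and> (\<forall>x\<in>B. f x * Q x = P x)"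
  shows "f \<in> reg (zariski N C) B"
  unfolding reg_subspace
proof
  fix a assume a: "a \<in> B"
  then obtain P Q where 1: "polyfun P" "polyfun Q" "Q a \<noteq> 0" "\<forall>x\<in>B. f x * Q x = P x" using f by blast
  let ?W = "{x\<in>affine_points N. Q x \<noteq> 0}"
  have "openin (topo (affine_space N)) ?W" unfolding openin_affine using 1 by blast
  moreover have "(\<lambda>x. P x / Q x) \<in> reg (affine_space N) ?W" unfolding reg_affine using 1 by auto
  moreover have "f x = P x / Q x" if "x \<in> ?W \<inter> B" for x
    using that 1(4) by (auto simp: nonzero_eq_divide_eq)
  ultimately show "\<exists>W g. openin (topo (affine_space N)) W \<and> a \<in> W \<and> g \<in> reg (affine_space N) W \<and>
      (\<forall>b\<in>W \<inter> B. f b = g b)"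
    using a 1 B by (intro exI[of _ ?W] exI[of _ "\<lambda>x. P x / Q x"]) auto
qed

lemma morphism_polynomial:
  assumes C: "C \<subseteq> affine_points N" and D: "D \<subseteq> affine_points M"
    and \<theta>: "\<And>x. x \<in> C \<Longrightarrow> \<theta> x \<in> D" "\<And>i. polyfun (\<lambda>x. \<theta> x i)"
  shows "morphism (zariski N C) (zariski M D) \<theta>"
proof (rule morphismI)
  show "\<theta> a \<in> pts (zariski M D)" if "a \<in> pts (zariski N C)" for a
    using that \<theta>(1)[of a] C D by auto
  fix U assume U: "openin (topo (zariski M D)) U"
  have eq: "{a\<in>pts (zariski N C). \<theta> a \<in> U} = {a\<in>C. \<theta> a \<in> U}" using C by auto
  show "openin (topo (zariski N C)) {a\<in>pts (zariski N C). \<theta> a \<in> U}"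
    unfolding eq openin_zariski[OF C]
  proof (intro conjI ballI)
    fix a assume "a \<in> {a\<in>C. \<theta> a \<in> U}"
    then obtain Q where "polyfun Q" "Q (\<theta> a) \<noteq> 0" "{x\<in>D. Q x \<noteq> 0} \<subseteq> U"
      using U unfolding openin_zariski[OF D] by blast
    then show "\<exists>Q. polyfun Q \<and> Q a \<noteq> 0 \<and> {x\<in>C. Q x \<noteq> 0} \<subseteq> {a\<in>C. \<theta> a \<in> U}"
      using \<theta> by (intro exI[of _ "\<lambda>x. Q (\<theta> x)"]) (auto intro: polyfun_compose)
  qed auto
  fix f assume f: "f \<in> reg (zariski M D) U"
  have UM: "U \<subseteq> affine_points M" using U D unfolding openin_zariski[OF D] by blast
  show "f \<circ> \<theta> \<in> reg (zariski N C) {a\<in>pts (zariski N C). \<theta> a \<in> U}"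
    unfolding eq
  proof (rule reg_zariskiI)
    fix a assume a: "a \<in> {a\<in>C. \<theta> a \<in> U}"
    then obtain P Q where PQ: "polyfun P" "polyfun Q" "Q (\<theta> a) \<noteq> 0" "\<And>x. x \<in> U \<Longrightarrow> f x * Q x = P x"
      using reg_zariskiD[OF f UM] by blast
    show "\<exists>P Q. polyfun P \<and> polyfun Q \<and> Q a \<noteq> 0 \<and> (\<forall>x\<in>{a\<in>C. \<theta> a \<in> U}. (f \<circ> \<theta>) x * Q x = P x)"
      by (intro exI[of _ "\<lambda>x. P (\<theta> x)"] exI[of _ "\<lambda>x. Q (\<theta> x)"])
         (use PQ \<theta>(2) in \<open>auto intro: polyfun_compose\<close>)
  qed (use C in auto)
qed

section \<open>Weighted projective spaces\<close>

lemma space_with_functions_orbit_space: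
  assumes S: "space_with_functions S"
  shows "space_with_functions (orbit_space S G act)"
  unfolding space_with_functions_def
proof (intro allI impI conjI ballI)
  let ?Q = "orbit_space S G act" and ?o = "orbit G act"
  have reg: "f \<in> reg ?Q U \<longleftrightarrow> f \<circ> ?o \<in> reg S {a\<in>pts S. ?o a \<in> U}" for f U
    by (simp add: orbit_space_def)
  fix U assume U: "openin (topo ?Q) U"
  then have sub: "U \<subseteq> ?o ` pts S" and o: "openin (topo S) {a\<in>pts S. ?o a \<in> U}"
    unfolding openin_orbit_space by auto
  show "(\<lambda>_. c) \<in> reg ?Q U" for c
    unfolding reg using swf_const[OF S o] by (simp add: o_def)
  show "(\<lambda>a. f a + g a) \<in> reg ?Q U" if "f \<in> reg ?Q U" "g \<in> reg ?Q U" for f g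
    using swf_add[OF S o] that unfolding reg by (force simp: o_def)
  show "(\<lambda>a. f a * g a) \<in> reg ?Q U" if "f \<in> reg ?Q U" "g \<in> reg ?Q U" for f g
    using swf_mult[OF S o] that unfolding reg by (force simp: o_def)
  have eq: "{a\<in>pts S. ?o a \<in> {A\<in>U. f A \<noteq> 0}} = {a\<in>{a\<in>pts S. ?o a \<in> U}. (f \<circ> ?o) a \<noteq> 0}"
    for f :: "'a set \<Rightarrow> complex" by auto
  show "openin (topo ?Q) {A\<in>U. f A \<noteq> 0}" if "f \<in> reg ?Q U" for f
    unfolding openin_orbit_space eq
    using swf_nonzero[OF S o that[unfolded reg]] sub by auto
  show "(\<lambda>A. inverse (f A)) \<in> reg ?Q {A\<in>U. f A \<noteq> 0}" if "f \<in> reg ?Q U" for f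
    unfolding reg eq using swf_inverse[OF S o] that unfolding reg by (force simp: o_def)
  show "f \<in> reg ?Q W" if "f \<in> reg ?Q U" "openin (topo ?Q) W \<and> W \<subseteq> U" for f W
    unfolding reg
    by (rule swf_restrict[OF S o]) (use that in \<open>auto simp: reg openin_orbit_space\<close>)
  fix f assume f: "\<forall>a\<in>U. \<exists>W. openin (topo ?Q) W \<and> a \<in> W \<and> W \<subseteq> U \<and>
                (\<exists>g\<in>reg ?Q W. \<forall>b\<in>W. f b = g b)"
  show "f \<in> reg ?Q U"
    unfolding reg
  proof (rule swf_glue[OF S o])
    fix a assume "a \<in> {a\<in>pts S. ?o a \<in> U}"
    then have a: "a \<in> pts S" "?o a \<in> U" by auto
    then obtain W g where W: "openin (topo ?Q) W" "?o a \<in> W" "W \<subseteq> U" "g \<in> reg ?Q W" "\<forall>b\<in>W. f b = g b"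
      using f by meson
    show "\<exists>W g. openin (topo S) W \<and> a \<in> W \<and> W \<subseteq> {a\<in>pts S. ?o a \<in> U} \<and> g \<in> reg S W \<and>
        (\<forall>b\<in>W. (f \<circ> ?o) b = g b)"
      by (rule exI[of _ "{a\<in>pts S. ?o a \<in> W}"], rule exI[of _ "g \<circ> ?o"])
         (use W a in \<open>auto simp: reg openin_orbit_space\<close>)
  qed
qed

lemma space_with_functions_weighted_proj: "space_with_functions (weighted_proj N w)"
  unfolding weighted_proj_def
  by (rule space_with_functions_orbit_space[OF space_with_functions_zariski])

lemma punctured_affine: "punctured N \<subseteq> affine_points N"
  by (auto simp: punctured_def)

lemma pts_weighted_proj: "pts (weighted_proj N w) = weighted_point w ` punctured N"
  unfolding weighted_proj_def pts_orbit_space pts_zariski[OF punctured_affine] ..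

lemma weighted_scale_punctured:
  "x \<in> punctured N \<Longrightarrow> t \<noteq> 0 \<Longrightarrow> weighted_scale w t x \<in> punctured N"
  by (auto simp: punctured_def affine_points_def weighted_scale_def fun_eq_iff)

lemma weighted_scale_scale: "weighted_scale w s (weighted_scale w t x) = weighted_scale w (s * t) x"
  by (simp add: weighted_scale_def power_mult_distrib mult_ac)

lemma weighted_scale_1 [simp]: "weighted_scale w 1 x = x"
  by (simp add: weighted_scale_def)

lemma weighted_point_scale [simp]:
  assumes "t \<noteq> 0" shows "weighted_point w (weighted_scale w t x) = weighted_point w x"
proof
  show "weighted_point w (weighted_scale w t x) \<subseteq> weighted_point w x"
    using assms by (auto simp: orbit_def weighted_scale_scale intro!: image_eqI)
  show "weighted_point w x \<subseteq> weighted_point w (weighted_scale w t x)"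
  proof
    fix y assume "y \<in> weighted_point w x"
    then obtain s where "s \<noteq> 0" "y = weighted_scale w s x" by (auto simp: orbit_def)
    then show "y \<in> weighted_point w (weighted_scale w t x)"
      using assms unfolding orbit_def
      by (intro image_eqI[of _ _ "s / t"]) (auto simp: weighted_scale_scale)
  qed
qed

lemma weighted_point_self: "x \<in> weighted_point w x"
  unfolding orbit_def by (rule image_eqI[of _ _ 1]) auto

lemma weighted_point_eq_iff:
  "weighted_point w x = weighted_point w y \<longleftrightarrow> (\<exists>t. t \<noteq> 0 \<and> y = weighted_scale w t x)"
proof
  assume "weighted_point w x = weighted_point w y"
  then have "y \<in> weighted_point w x" using weighted_point_self by simp
  then show "\<exists>t. t \<noteq> 0 \<and> y = weighted_scale w t x" by (auto simp: orbit_def)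
qed auto

text \<open>The factor \<open>t\<close> is allowed to be 0, which gives the values at the origin.\<close>

definition homogeneous_fun :: "(nat \<Rightarrow> nat) \<Rightarrow> nat \<Rightarrow> ((nat \<Rightarrow> complex) \<Rightarrow> complex) \<Rightarrow> bool" where
  "homogeneous_fun w d f \<longleftrightarrow> (\<forall>t x. f (weighted_scale w t x) = t ^ d * f x)"

lemma homogeneous_funD: "homogeneous_fun w d f \<Longrightarrow> f (weighted_scale w t x) = t ^ d * f x"
  by (simp add: homogeneous_fun_def)

lemma homogeneous_poly_eval:
  assumes "weighted_homogeneous w d P" shows "homogeneous_fun w d (poly_eval P)"
  unfolding homogeneous_fun_def
proof (intro allI)
  fix t x
  have "Poly_Mapping.lookup P m * (\<Prod>i\<in>Poly_Mapping.keys m. weighted_scale w t x i ^ Poly_Mapping.lookup m i)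
      = t ^ d * (Poly_Mapping.lookup P m * (\<Prod>i\<in>Poly_Mapping.keys m. x i ^ Poly_Mapping.lookup m i))"
    if "m \<in> Poly_Mapping.keys P" for m
  proof -
    have "(\<Prod>i\<in>Poly_Mapping.keys m. weighted_scale w t x i ^ Poly_Mapping.lookup m i) =
        (\<Prod>i\<in>Poly_Mapping.keys m. t ^ (w i * Poly_Mapping.lookup m i)) *
        (\<Prod>i\<in>Poly_Mapping.keys m. x i ^ Poly_Mapping.lookup m i)"
      by (simp add: weighted_scale_def power_mult_distrib power_mult prod.distrib)
    also have "(\<Prod>i\<in>Poly_Mapping.keys m. t ^ (w i * Poly_Mapping.lookup m i)) = t ^ d"
      using assms that by (simp add: weighted_homogeneous_def flip: power_sum)
    finally show ?thesis by simp
  qed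
  then show "poly_eval P (weighted_scale w t x) = t ^ d * poly_eval P x"
    unfolding poly_eval_def sum_distrib_left by (intro sum.cong) auto
qed

lemma homogeneous_prod:
  "homogeneous_fun w (\<Sum>k<r. w (j k) * e k) (\<lambda>x. \<Prod>k<r. x (j k) ^ e k)"
  unfolding homogeneous_fun_def
  by (simp add: weighted_scale_def power_mult_distrib prod.distrib power_sum power_mult)

text \<open>The value at a point is computed from any coordinate vector of it; for \<open>P\<close> and \<open>Q\<close> homogeneous of the same
  degree the choice is immaterial.\<close>

definition proj_frac :: "((nat \<Rightarrow> complex) \<Rightarrow> complex) \<Rightarrow> ((nat \<Rightarrow> complex) \<Rightarrow> complex) \<Rightarrow>
    (nat \<Rightarrow> complex) set \<Rightarrow> complex" where
  "proj_frac P Q A = P (SOME x. x \<in> A) / Q (SOME x. x \<in> A)"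

lemma proj_frac_point:
  assumes "homogeneous_fun w d P" "homogeneous_fun w d Q"
  shows "proj_frac P Q (weighted_point w x) = P x / Q x"
proof -
  have "(SOME y. y \<in> weighted_point w x) \<in> weighted_point w x"
    by (rule someI[of "\<lambda>y. y \<in> weighted_point w x", OF weighted_point_self])
  then obtain t where t: "t \<noteq> 0" "(SOME y. y \<in> weighted_point w x) = weighted_scale w t x"
    by (auto simp: orbit_def)
  show ?thesis
    unfolding proj_frac_def t(2) using t(1) by (simp add: homogeneous_funD[OF assms(1)] homogeneous_funD[OF assms(2)])
qed

lemma weighted_basic_mem:
  assumes "homogeneous_fun w d Q" "x \<in> punctured N"
  shows "weighted_point w x \<in> weighted_point w ` {x\<in>punctured N. Q x \<noteq> 0} \<longleftrightarrow> Q x \<noteq> 0"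
proof
  assume "weighted_point w x \<in> weighted_point w ` {x\<in>punctured N. Q x \<noteq> 0}"
  then obtain y where "Q y \<noteq> 0" "weighted_point w x = weighted_point w y" by auto
  then show "Q x \<noteq> 0" by (auto simp: weighted_point_eq_iff homogeneous_funD[OF assms(1)])
qed (use assms in auto)

lemma openin_weighted_basic:
  assumes "polyfun Q" "homogeneous_fun w d Q"
  shows "openin (topo (weighted_proj N w)) (weighted_point w ` {x\<in>punctured N. Q x \<noteq> 0})"
proof -
  have eq: "{x\<in>punctured N. weighted_point w x \<in> weighted_point w ` {x\<in>punctured N. Q x \<noteq> 0}} =
      {x\<in>punctured N. Q x \<noteq> 0}"
    using weighted_basic_mem[OF assms(2)] by auto
  show ?thesis
    unfolding weighted_proj_def openin_orbit_space pts_zariski[OF punctured_affine] eq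
      openin_zariski[OF punctured_affine]
    using assms(1) by auto
qed

lemma reg_weighted_proj:
  assumes "polyfun P" "homogeneous_fun w d P" "polyfun Q" "homogeneous_fun w d Q"
  shows "proj_frac P Q \<in> reg (weighted_proj N w) (weighted_point w ` {x\<in>punctured N. Q x \<noteq> 0})"
proof -
  have eq: "{x\<in>punctured N. weighted_point w x \<in> weighted_point w ` {x\<in>punctured N. Q x \<noteq> 0}} =
      {x\<in>punctured N. Q x \<noteq> 0}"
    using weighted_basic_mem[OF assms(4)] by auto
  have "proj_frac P Q \<circ> weighted_point w \<in> reg (zariski N (punctured N)) {x\<in>punctured N. Q x \<noteq> 0}"
  proof (rule reg_zariskiI)
    show "{x\<in>punctured N. Q x \<noteq> 0} \<subseteq> affine_points N" using punctured_affine by auto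
    show "\<exists>P' Q'. polyfun P' \<and> polyfun Q' \<and> Q' a \<noteq> 0 \<and>
        (\<forall>x\<in>{x\<in>punctured N. Q x \<noteq> 0}. (proj_frac P Q \<circ> weighted_point w) x * Q' x = P' x)"
      if "a \<in> {x\<in>punctured N. Q x \<noteq> 0}" for a
      by (intro exI[of _ P] exI[of _ Q]) (use assms that in \<open>auto simp: proj_frac_point[OF assms(2,4)]\<close>)
  qed
  then show ?thesis
    by (simp add: weighted_proj_def orbit_space_def pts_zariski[OF punctured_affine] eq
        del: topo_subspace)
qed

lemma morphism_weighted_point:
  assumes "C \<subseteq> punctured N"
  shows "morphism (zariski N C) (subspace_fun (weighted_proj N w) (weighted_point w ` C)) (weighted_point w)"
proof (rule morphism_subspace_cod[OF space_with_functions_zariski])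
  have CA: "C \<subseteq> affine_points N" using assms punctured_affine by blast
  have 1: "morphism (zariski N C) (zariski N (punctured N)) (\<lambda>x. x)"
    by (rule morphism_polynomial[OF CA punctured_affine]) (use assms in auto)
  show "morphism (zariski N C) (weighted_proj N w) (weighted_point w)"
    using morphism_compose[OF 1 morphism_orbit] by (simp add: weighted_proj_def o_def)
  show "weighted_point w a \<in> weighted_point w ` C" if "a \<in> pts (zariski N C)" for a
    using that by (simp add: pts_zariski[OF CA])
qed

section \<open>Polynomials, roots and tensors\<close>

lemma poly_eval_cong:
  assumes "\<And>i. i \<in> poly_vars P \<Longrightarrow> x i = y i"
  shows "poly_eval P x = poly_eval P y"
  unfolding poly_eval_def
proof (intro sum.cong refl arg_cong2[where f="(*)"] prod.cong)
  fix m i assume "m \<in> Poly_Mapping.keys P" "i \<in> Poly_Mapping.keys m"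
  then have "i \<in> poly_vars P" by (auto simp: poly_vars_def)
  then show "x i ^ Poly_Mapping.lookup m i = y i ^ Poly_Mapping.lookup m i" using assms by simp
qed

text \<open>If \<open>P\<close> vanished on the whole coordinate space, then so would its partial derivatives there, and any nonzero
  point would be a singular zero.\<close>

lemma quasi_smooth_nonzero:
  assumes "quasi_smooth I P" "I \<noteq> {}"
  shows "\<exists>d. (\<forall>i. i \<notin> I \<longrightarrow> d i = 0) \<and> poly_eval P d \<noteq> 0"
proof (rule ccontr)
  assume "\<not> ?thesis"
  then have zero: "poly_eval P d = 0" if "\<And>i. i \<notin> I \<Longrightarrow> d i = 0" for d using that by blast
  obtain i0 where i0: "i0 \<in> I" using assms(2) by blast
  let ?x = "\<lambda>i. if i = i0 then 1 else (0::complex)"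
  have sup: "\<forall>i. i \<notin> I \<longrightarrow> ?x i = 0" using i0 by auto
  have ne: "?x \<noteq> (\<lambda>_. 0)"
  proof
    assume "?x = (\<lambda>_. 0)"
    from fun_cong[OF this, of i0] show False by simp
  qed
  have "poly_eval P ?x = 0" using sup by (intro zero) auto
  then obtain i where i: "i \<in> I" "partial_deriv i P ?x \<noteq> 0"
    using assms(1)[unfolded quasi_smooth_def, THEN spec, of ?x] sup ne by auto
  have "(\<lambda>t. poly_eval P (?x(i := t))) = (\<lambda>_. 0)"
    using i(1) i0 by (auto intro!: zero)
  then have "partial_deriv i P ?x = 0" by (simp add: partial_deriv_def)
  with i show False by simp
qed

lemma complex_nth_root_exists:
  assumes "k > 0" "a \<noteq> 0" obtains t :: complex where "t ^ k = a" "t \<noteq> 0"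
proof (rule that[of "exp (Ln a / of_nat k)"])
  show "exp (Ln a / of_nat k) ^ k = a"
    using assms by (simp flip: exp_of_nat_mult)
qed simp

lemma primitive_root_exists:
  assumes "k > 0" obtains z :: complex where "z ^ k = 1" "\<And>d. z ^ d = 1 \<Longrightarrow> k dvd d"
proof (rule that[of "exp (2 * of_real pi * \<i> / of_nat k)"])
  have pow: "exp (2 * of_real pi * \<i> / of_nat k) ^ d = exp (2 * of_real pi * \<i> * of_nat d / of_nat k)" for d
    by (simp add: mult_ac flip: exp_of_nat_mult)
  show "exp (2 * of_real pi * \<i> / of_nat k) ^ k = 1"
    unfolding pow using complex_root_unity_eq_1[of k k] assms by simp
  show "k dvd d" if "exp (2 * of_real pi * \<i> / of_nat k) ^ d = 1" for d
    using that unfolding pow using complex_root_unity_eq_1[of k d] assms by simp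
qed

text \<open>The image under \<open>H\<close> of a neighbourhood of 0 is a neighbourhood of 0 by the open mapping theorem, so it
  contains \<open>poly G s\<close> for all small \<open>s\<close>, and \<open>G\<close> has only finitely many zeros.\<close>

lemma common_nonzero_value:
  fixes G H :: "complex poly"
  assumes G: "G \<noteq> 0" "poly G 0 = 0" and H: "H \<noteq> 0" "poly H 0 = 0"
    and E: "open E" "(0, 0) \<in> E"
  obtains s t where "(s, t) \<in> E" "poly G s = poly H t" "poly G s \<noteq> 0"
proof -
  from open_prod_elim[OF E] obtain A B where AB': "open A" "open B" "(0, 0) \<in> A \<times> B" "A \<times> B \<subseteq> E" .
  then have AB: "open A" "open B" "0 \<in> A" "0 \<in> B" "A \<times> B \<subseteq> E" by auto
  have nc: "\<not> poly H constant_on UNIV"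
  proof
    assume "poly H constant_on UNIV"
    then have "poly H x = 0" for x using H(2) unfolding constant_on_def by (metis UNIV_I)
    then show False using H(1) poly_all_0_iff_0 by blast
  qed
  have hol: "poly H holomorphic_on UNIV"
    by (intro holomorphic_intros | simp)+
  have oB: "open (poly H ` B)"
    by (rule open_mapping_thm[OF hol _ _ AB(2) _ nc]) auto
  have "open (poly G -` (poly H ` B))"
    by (rule open_vimage[OF oB]) (intro continuous_intros)
  then have oT: "open (A \<inter> poly G -` (poly H ` B))" using AB(1) by blast
  have T0: "0 \<in> A \<inter> poly G -` (poly H ` B)" using AB G(2) H(2) by (auto intro: image_eqI[of _ _ 0])
  have "infinite (A \<inter> poly G -` (poly H ` B))"
    using finite_imp_not_open[OF _ oT] T0 by blast
  then have "\<not> A \<inter> poly G -` (poly H ` B) \<subseteq> {s. poly G s = 0}"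
    using poly_roots_finite[OF G(1)] finite_subset by blast
  then obtain s where s: "s \<in> A" "poly G s \<in> poly H ` B" "poly G s \<noteq> 0" by auto
  then obtain t where "t \<in> B" "poly G s = poly H t" by auto
  with s AB that show ?thesis by blast
qed

lemma morphism_const:
  assumes T: "space_with_functions T" and b: "b \<in> pts S" shows "morphism T S (\<lambda>_. b)"
proof (rule morphismI)
  fix U assume U: "openin (topo S) U"
  show o: "openin (topo T) {a\<in>pts T. b \<in> U}" by (cases "b \<in> U") auto
  show "k \<circ> (\<lambda>_. b) \<in> reg T {a\<in>pts T. b \<in> U}" for k
    using swf_const[OF T o] by (simp add: o_def)
qed (use b in auto)

lemma tensor_regI:
  assumes "finite K" "\<And>e. e \<in> K \<Longrightarrow> f e \<in> reg S U" "\<And>e. e \<in> K \<Longrightarrow> g e \<in> reg T W"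
  shows "(\<lambda>(a, b). \<Sum>e\<in>K. f e a * g e b) \<in> tensor_reg S T U W"
proof -
  obtain \<phi> where \<phi>: "bij_betw \<phi> {0..<card K} K" using ex_bij_betw_nat_finite[OF assms(1)] by blast
  then have bij: "bij_betw \<phi> {..<card K} K" by (simp add: lessThan_atLeast0)
  have mem: "\<phi> i \<in> K" if "i < card K" for i using bij that by (auto simp: bij_betw_def)
  have "(\<lambda>(a, b). \<Sum>e\<in>K. f e a * g e b) = (\<lambda>(a, b). \<Sum>i<card K. f (\<phi> i) a * g (\<phi> i) b)"
    by (simp add: sum.reindex_bij_betw[OF bij, of "\<lambda>e. f e _ * g e _"] fun_eq_iff)
  then show ?thesis unfolding tensor_reg_def
    using assms(2,3)[OF mem]
    by (intro CollectI exI[of _ "card K"] exI[of _ "\<lambda>i. f (\<phi> i)"] exI[of _ "\<lambda>i. g (\<phi> i)"]) auto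
qed

lemma prod_lessThan_add: "(\<Prod>k<n + (m::nat). f k) = (\<Prod>k<n. f k) * (\<Prod>j<m. f (n + j) :: 'a::comm_monoid_mult)"
  by (induction m) (auto simp: mult_ac)

section \<open>Cones over cyclic hypersurfaces\<close>

definition cyclic_cone :: "nat \<Rightarrow> nat \<Rightarrow> cpoly \<Rightarrow> (nat \<Rightarrow> complex) set" where
  "cyclic_cone n l p = {x \<in> punctured (n + 1). x 0 ^ l + poly_eval p x = 0}"

lemma cyclic_hypersurface_eq:
  "cyclic_hypersurface n w l p = subspace_fun (weighted_proj (n + 1) w) (weighted_point w ` cyclic_cone n l p)"
  by (simp add: cyclic_hypersurface_def cyclic_cone_def)

lemma cyclic_cone_punctured: "cyclic_cone n l p \<subseteq> punctured (n + 1)"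
  by (auto simp: cyclic_cone_def)

lemma cyclic_cone_affine: "cyclic_cone n l p \<subseteq> affine_points (n + 1)"
  using cyclic_cone_punctured punctured_affine by blast

lemma space_with_functions_cyclic: "space_with_functions (cyclic_hypersurface n w l p)"
  unfolding cyclic_hypersurface_eq
  by (intro space_with_functions_subspace space_with_functions_weighted_proj)

lemma pts_cyclic: "pts (cyclic_hypersurface n w l p) = weighted_point w ` cyclic_cone n l p"
  unfolding cyclic_hypersurface_eq by (auto simp: pts_weighted_proj cyclic_cone_def)

lemma cyclic_cone_scale:
  assumes p: "weighted_homogeneous w (l * w 0) p" and x: "x \<in> cyclic_cone n l p" and t: "t \<noteq> 0"
  shows "weighted_scale w t x \<in> cyclic_cone n l p"
proof -
  have "weighted_scale w t x 0 ^ l + poly_eval p (weighted_scale w t x) = t ^ (l * w 0) * (x 0 ^ l + poly_eval p x)"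
    unfolding homogeneous_funD[OF homogeneous_poly_eval[OF p]]
    by (simp add: weighted_scale_def power_mult_distrib distrib_left mult.commute flip: power_mult)
  then show ?thesis
    using x weighted_scale_punctured[OF _ t, of x "n + 1" w] by (simp add: cyclic_cone_def)
qed

text \<open>A \<open>w 0\<close>-th root of the inverse of \<open>x 0\<close> rescales this coordinate to 1.\<close>

lemma cyclic_cone_normalize:
  assumes p: "weighted_homogeneous w (l * w 0) p" and w0: "0 < w 0"
    and x: "x \<in> cyclic_cone n l p" "x 0 \<noteq> 0"
  obtains x' where "x' \<in> cyclic_cone n l p" "x' 0 = 1" "weighted_point w x = weighted_point w x'"
proof -
  obtain t where t: "t ^ w 0 = 1 / x 0" "t \<noteq> 0"
    using complex_nth_root_exists[OF w0, of "1 / x 0"] x(2) by auto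
  show ?thesis
  proof (rule that[of "weighted_scale w t x"])
    show "weighted_scale w t x \<in> cyclic_cone n l p" by (rule cyclic_cone_scale[OF p x(1) t(2)])
    show "weighted_scale w t x 0 = 1" using t(1) x(2) by (simp add: weighted_scale_def)
  qed (use t(2) in simp)
qed

section \<open>The slice\<close>

text \<open>The diagonal matrix that scales the first \<open>n\<close> coordinates with weights $w_1, \ldots, w_n$ and the factor \<open>s\<close>, and
  the others with weights $v_1, \ldots, v_m$ and the factor \<open>t\<close>.\<close>

definition two_scale :: "nat \<Rightarrow> (nat \<Rightarrow> nat) \<Rightarrow> (nat \<Rightarrow> nat) \<Rightarrow> complex \<Rightarrow> complex \<Rightarrow> nat \<Rightarrow> complex" where
  "two_scale n w v s t = (\<lambda>k. if k < n then s ^ w (k + 1) else t ^ v (k - n + 1))"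

lemma two_scale_mult:
  "diag_scale (two_scale n w v s t) (two_scale n w v s' t') = two_scale n w v (s * s') (t * t')"
  by (auto simp: two_scale_def power_mult_distrib fun_eq_iff)

lemma two_scale_nonzero: "s \<noteq> 0 \<Longrightarrow> t \<noteq> 0 \<Longrightarrow> two_scale n w v s t k \<noteq> 0"
  by (simp add: two_scale_def)

lemma diagonal_group_two_scale:
  assumes "finite J" "(1, 1) \<in> J" "\<And>s t. (s, t) \<in> J \<Longrightarrow> s \<noteq> 0 \<and> t \<noteq> 0"
    and "\<And>s t s' t'. (s, t) \<in> J \<Longrightarrow> (s', t') \<in> J \<Longrightarrow> (s * s', t * t') \<in> J"
  shows "diagonal_group ((\<lambda>(s, t). two_scale n w v s t) ` J)"
  unfolding diagonal_group_def
proof (intro conjI ballI)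
  show "(\<lambda>_. 1) \<in> (\<lambda>(s, t). two_scale n w v s t) ` J"
    by (rule image_eqI[OF _ assms(2)]) (simp add: two_scale_def fun_eq_iff)
  show "\<forall>i. g i \<noteq> 0" if "g \<in> (\<lambda>(s, t). two_scale n w v s t) ` J" for g
    using that assms(3) two_scale_nonzero by auto
  show "diag_scale g h \<in> (\<lambda>(s, t). two_scale n w v s t) ` J"
    if g: "g \<in> (\<lambda>(s, t). two_scale n w v s t) ` J" and h: "h \<in> (\<lambda>(s, t). two_scale n w v s t) ` J" for g h
  proof -
    obtain s t s' t' where "(s, t) \<in> J" "g = two_scale n w v s t" "(s', t') \<in> J" "h = two_scale n w v s' t'"
      using g h by auto
    then show ?thesis
      by (intro image_eqI[of _ _ "(s * s', t * t')"]) (auto simp: two_scale_mult assms(4))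
  qed
qed (use assms(1) in auto)

locale twist_data =
  fixes n m l :: nat and w v :: "nat \<Rightarrow> nat" and p q :: cpoly
  assumes n_pos: "1 \<le> n" and m_pos: "1 \<le> m" and l_pos: "1 \<le> l"
    and w_pos: "\<And>i. i \<le> n \<Longrightarrow> 0 < w i" and v_pos: "\<And>j. j \<le> m \<Longrightarrow> 0 < v j"
    and p_vars: "poly_vars p \<subseteq> {1..n}" and p_hom: "weighted_homogeneous w (l * w 0) p"
    and p_smooth: "quasi_smooth {1..n} p"
    and q_vars: "poly_vars q \<subseteq> {1..m}" and q_hom: "weighted_homogeneous v (l * v 0) q"
    and q_smooth: "quasi_smooth {1..m} q"
begin

text \<open>The equations \<open>p\<close> and \<open>q\<close> in the coordinates of the target space, which are numbered from 0, first the \<open>n\<close>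
  arguments of \<open>p\<close> and then those of \<open>q\<close>.\<close>

definition p1 :: "(nat \<Rightarrow> complex) \<Rightarrow> complex" where "p1 c = poly_eval p (\<lambda>i. c (i - 1))"
definition q1 :: "(nat \<Rightarrow> complex) \<Rightarrow> complex" where "q1 c = poly_eval q (\<lambda>j. c (n + j - 1))"

abbreviation tw :: "nat \<Rightarrow> nat" where "tw \<equiv> twist_weights n w v"

abbreviation V1 where "V1 \<equiv> cyclic_hypersurface n w l p"
abbreviation V2 where "V2 \<equiv> cyclic_hypersurface m v l q"
abbreviation V where "V \<equiv> prod_fspace V1 V2"
abbreviation X where "X \<equiv> twist_hypersurface n m w v p q"

definition slice :: "(nat \<Rightarrow> complex) set" where
  "slice = {c \<in> affine_points (n + m). p1 c = -1 \<and> q1 c = -1}"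

definition xlift :: "(nat \<Rightarrow> complex) \<Rightarrow> nat \<Rightarrow> complex" where
  "xlift c = (\<lambda>i. if i = 0 then 1 else if i \<le> n then c (i - 1) else 0)"
definition ylift :: "(nat \<Rightarrow> complex) \<Rightarrow> nat \<Rightarrow> complex" where
  "ylift c = (\<lambda>j. if j = 0 then 1 else if j \<le> m then c (n + j - 1) else 0)"

definition to_V :: "(nat \<Rightarrow> complex) \<Rightarrow> (nat \<Rightarrow> complex) set \<times> (nat \<Rightarrow> complex) set" where
  "to_V c = (weighted_point w (xlift c), weighted_point v (ylift c))"
definition to_X :: "(nat \<Rightarrow> complex) \<Rightarrow> (nat \<Rightarrow> complex) set" where
  "to_X c = weighted_point tw c"

abbreviation scl :: "complex \<Rightarrow> complex \<Rightarrow> (nat \<Rightarrow> complex) \<Rightarrow> nat \<Rightarrow> complex" where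
  "scl s t c \<equiv> diag_scale (two_scale n w v s t) c"

lemma polyfun_p1: "polyfun p1"
  unfolding p1_def by (rule polyfun_compose) auto

lemma polyfun_q1: "polyfun q1"
  unfolding q1_def by (rule polyfun_compose) auto

lemma p1_scl: "p1 (scl s t c) = s ^ (l * w 0) * p1 c"
proof -
  have "p1 (scl s t c) = poly_eval p (weighted_scale w s (\<lambda>i. c (i - 1)))"
    unfolding p1_def by (rule poly_eval_cong) (use p_vars in \<open>force simp: two_scale_def weighted_scale_def\<close>)
  then show ?thesis by (simp add: p1_def homogeneous_funD[OF homogeneous_poly_eval[OF p_hom]])
qed

lemma q1_scl: "q1 (scl s t c) = t ^ (l * v 0) * q1 c"
proof -
  have "q1 (scl s t c) = poly_eval q (weighted_scale v t (\<lambda>j. c (n + j - 1)))"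
    unfolding q1_def by (rule poly_eval_cong) (use q_vars in \<open>force simp: two_scale_def weighted_scale_def\<close>)
  then show ?thesis by (simp add: q1_def homogeneous_funD[OF homogeneous_poly_eval[OF q_hom]])
qed

lemma weighted_scale_tw: "weighted_scale tw t c = scl (t ^ v 0) (t ^ w 0) c"
  by (auto simp: weighted_scale_def twist_weights_def two_scale_def fun_eq_iff simp flip: power_mult)

text \<open>The degree of \<open>X\<close>.\<close>

abbreviation M :: nat where "M \<equiv> l * w 0 * v 0"

lemma p1_tw: "p1 (weighted_scale tw t c) = t ^ M * p1 c"
  unfolding weighted_scale_tw p1_scl by (simp add: mult_ac flip: power_mult)

lemma q1_tw: "q1 (weighted_scale tw t c) = t ^ M * q1 c"
  unfolding weighted_scale_tw q1_scl by (simp add: mult_ac flip: power_mult)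

lemma pos: "0 < l" "0 < w 0" "0 < v 0" "0 < M"
  using l_pos w_pos[of 0] v_pos[of 0] by auto

lemma poly_eval_zero: "poly_eval p (\<lambda>_. 0) = 0" "poly_eval q (\<lambda>_. 0) = 0"
  using homogeneous_funD[OF homogeneous_poly_eval[OF p_hom], of 0 "\<lambda>_. 0"]
    homogeneous_funD[OF homogeneous_poly_eval[OF q_hom], of 0 "\<lambda>_. 0"] pos
  by (auto simp: weighted_scale_def power_0_left)

lemma p1_zero: "p1 (\<lambda>_. 0) = 0"
  by (simp add: p1_def poly_eval_zero)

lemma slice_affine: "slice \<subseteq> affine_points (n + m)"
  by (auto simp: slice_def)

lemma slice_punctured: "slice \<subseteq> punctured (n + m)"
  using p1_zero by (auto simp: slice_def punctured_def)

lemma scl_affine: "c \<in> affine_points N \<Longrightarrow> scl s t c \<in> affine_points N"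
  by (auto simp: affine_points_def)

lemma scl_slice:
  assumes "c \<in> slice" "s ^ (l * w 0) = 1" "t ^ (l * v 0) = 1" shows "scl s t c \<in> slice"
  using assms scl_affine by (auto simp: slice_def p1_scl q1_scl)

abbreviation C1 where "C1 \<equiv> cyclic_cone n l p"
abbreviation C2 where "C2 \<equiv> cyclic_cone m l q"
definition CX where "CX = {c \<in> punctured (n + m). p1 c - q1 c = 0}"

lemma X_eq: "X = subspace_fun (weighted_proj (n + m) tw) (weighted_point tw ` CX)"
  by (simp add: twist_hypersurface_def CX_def p1_def q1_def)

lemma poly_eval_xlift: "poly_eval p (xlift c) = p1 c"
  unfolding p1_def by (rule poly_eval_cong) (use p_vars in \<open>auto simp: xlift_def\<close>)

lemma poly_eval_ylift: "poly_eval q (ylift c) = q1 c"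
  unfolding q1_def by (rule poly_eval_cong) (use q_vars in \<open>auto simp: ylift_def\<close>)

lemma xlift_punctured: "xlift c \<in> punctured (n + 1)"
  by (auto simp: punctured_def affine_points_def xlift_def fun_eq_iff)
lemma ylift_punctured: "ylift c \<in> punctured (m + 1)"
  by (auto simp: punctured_def affine_points_def ylift_def fun_eq_iff)

lemma xlift_C1: "c \<in> slice \<Longrightarrow> xlift c \<in> C1"
  using xlift_punctured by (auto simp: cyclic_cone_def slice_def poly_eval_xlift) (simp add: xlift_def)
lemma ylift_C2: "c \<in> slice \<Longrightarrow> ylift c \<in> C2"
  using ylift_punctured by (auto simp: cyclic_cone_def slice_def poly_eval_ylift) (simp add: ylift_def)

abbreviation R where "R \<equiv> zariski (n + m) slice"

lemma swf_R: "space_with_functions R" by (rule space_with_functions_zariski)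

lemma pts_R: "pts R = slice" by (rule pts_zariski[OF slice_affine])

lemma CX_sub: "CX \<subseteq> punctured (n + m)"
  by (auto simp: CX_def)

lemma morphism_to_V: "morphism R V to_V"
proof -
  have 1: "morphism R (zariski (n + 1) C1) xlift"
  proof (rule morphism_polynomial[OF slice_affine])
    show "polyfun (\<lambda>x. xlift x i)" for i by (cases "i = 0"; cases "i \<le> n") (simp_all add: xlift_def)
  qed (use cyclic_cone_affine xlift_C1 in blast)+
  have 2: "morphism R (zariski (m + 1) C2) ylift"
  proof (rule morphism_polynomial[OF slice_affine])
    show "polyfun (\<lambda>x. ylift x i)" for i by (cases "i = 0"; cases "i \<le> m") (simp_all add: ylift_def)
  qed (use cyclic_cone_affine ylift_C2 in blast)+
  have "morphism R V (\<lambda>c. (weighted_point w (xlift c), weighted_point v (ylift c)))"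
    by (rule morphism_pair[OF swf_R space_with_functions_cyclic space_with_functions_cyclic])
       (use morphism_compose[OF 1 morphism_weighted_point[OF cyclic_cone_punctured, where w = w]]
          morphism_compose[OF 2 morphism_weighted_point[OF cyclic_cone_punctured, where w = v]]
        in \<open>simp_all only: cyclic_hypersurface_eq o_def\<close>)
  then show ?thesis by (simp add: to_V_def[abs_def])
qed

lemma morphism_to_X: "morphism R X to_X"
proof -
  have 1: "morphism R (zariski (n + m) CX) (\<lambda>c. c)"
  proof (rule morphism_polynomial[OF slice_affine])
    show "CX \<subseteq> affine_points (n + m)" using CX_sub punctured_affine by blast
    show "x \<in> CX" if "x \<in> slice" for x using that slice_punctured by (auto simp: CX_def slice_def)
  qed auto
  show ?thesis
    using morphism_compose[OF 1 morphism_weighted_point[OF CX_sub, where w = tw]]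
    by (simp add: X_eq to_X_def[abs_def] o_def)
qed

lemma to_V_scl:
  assumes "s ^ w 0 = 1" "t ^ v 0 = 1" shows "to_V (scl s t c) = to_V c"
proof -
  have 1: "xlift (scl s t c) = weighted_scale w s (xlift c)"
    using assms by (auto simp: xlift_def weighted_scale_def two_scale_def fun_eq_iff)
  have 2: "ylift (scl s t c) = weighted_scale v t (ylift c)"
    using assms by (auto simp: ylift_def weighted_scale_def two_scale_def fun_eq_iff)
  have "s \<noteq> 0" "t \<noteq> 0" using assms pos by (auto simp: power_0_left)
  then show ?thesis by (simp add: to_V_def 1 2)
qed

lemma to_X_eq_iff:
  assumes "c \<in> slice" "c' \<in> slice"
  shows "to_X c = to_X c' \<longleftrightarrow> (\<exists>t. t ^ M = 1 \<and> c' = weighted_scale tw t c)"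
proof
  assume "to_X c = to_X c'"
  then obtain t where t: "t \<noteq> 0" "c' = weighted_scale tw t c" by (auto simp: to_X_def weighted_point_eq_iff)
  have "t ^ M = 1" using p1_tw[of t c] assms t(2) by (simp add: slice_def)
  with t show "\<exists>t. t ^ M = 1 \<and> c' = weighted_scale tw t c" by blast
next
  assume "\<exists>t. t ^ M = 1 \<and> c' = weighted_scale tw t c"
  then obtain t where t: "t ^ M = 1" "c' = weighted_scale tw t c" by blast
  then have "t \<noteq> 0" using pos(4) by (auto simp: power_0_left)
  with t show "to_X c = to_X c'" by (auto simp: to_X_def)
qed

lemma to_V_surj:
  assumes x: "x \<in> C1" "x 0 \<noteq> 0" and y: "y \<in> C2" "y 0 \<noteq> 0"
  shows "\<exists>c\<in>slice. to_V c = (weighted_point w x, weighted_point v y)"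
proof -
  obtain x' where x': "x' \<in> C1" "x' 0 = 1" "weighted_point w x = weighted_point w x'" by (rule cyclic_cone_normalize[OF p_hom pos(2) x])
  obtain y' where y': "y' \<in> C2" "y' 0 = 1" "weighted_point v y = weighted_point v y'" by (rule cyclic_cone_normalize[OF q_hom pos(3) y])
  define c where "c k = (if k < n then x' (k + 1) else if k < n + m then y' (k - n + 1) else 0)" for k
  have xl: "xlift c = x'"
    using x' by (auto simp: xlift_def c_def fun_eq_iff cyclic_cone_def punctured_def affine_points_def)
  have yl: "ylift c = y'"
    using y' by (auto simp: ylift_def c_def fun_eq_iff cyclic_cone_def punctured_def affine_points_def)
  have "c \<in> affine_points (n + m)" by (simp add: c_def affine_points_def)
  moreover have "p1 c = -1" using x' unfolding poly_eval_xlift[symmetric] xl cyclic_cone_def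
    by (auto simp: add_eq_0_iff)
  moreover have "q1 c = -1" using y' unfolding poly_eval_ylift[symmetric] yl cyclic_cone_def
    by (auto simp: add_eq_0_iff)
  ultimately have "c \<in> slice" by (simp add: slice_def)
  then show ?thesis by (intro bexI[of _ c]) (simp_all add: to_V_def xl yl x' y')
qed

text \<open>A root of order \<open>M\<close> of \<open>- 1 / p1 c\<close> makes the common value of \<open>p1\<close> and \<open>q1\<close> equal to -1.\<close>

lemma to_X_surj:
  assumes c: "c \<in> CX" "p1 c \<noteq> 0"
  shows "\<exists>z\<in>slice. \<exists>t. t \<noteq> 0 \<and> z = weighted_scale tw t c"
proof -
  obtain t where t: "t ^ M = - 1 / p1 c" "t \<noteq> 0"
    using complex_nth_root_exists[of M "- 1 / p1 c"] pos c by auto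
  have "weighted_scale tw t c \<in> affine_points (n + m)"
    using c CX_sub weighted_scale_punctured[OF _ t(2), of c "n + m" tw] by (auto simp: punctured_def)
  then have "weighted_scale tw t c \<in> slice"
    using c t by (simp add: slice_def p1_tw q1_tw CX_def)
  with t show ?thesis by blast
qed

section \<open>The slice as a chart of the target hypersurface\<close>

text \<open>Under the group of \<open>M\<close>-th roots of unity the invariant monomials are those whose weighted degree is a
  multiple of \<open>M\<close>. As \<open>- p1\<close> has degree \<open>M\<close> and is 1 on the slice, its powers bring all monomials to one
  common degree without changing their values on the slice.\<close>

lemma invariant_fraction_X:
  assumes B: "B \<subseteq> slice"
    and inv: "\<And>t c. t ^ M = 1 \<Longrightarrow> c \<in> B \<Longrightarrow> weighted_scale tw t c \<in> B \<and> f (weighted_scale tw t c) = f c"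
    and PQ: "polyfun P" "polyfun Q" "\<And>c. c \<in> B \<Longrightarrow> f c * Q c = P c" and c: "c \<in> B" "Q c \<noteq> 0"
  obtains d P' Q' where "polyfun P'" "homogeneous_fun tw d P'" "polyfun Q'" "homogeneous_fun tw d Q'"
    "Q' c \<noteq> 0" "\<And>z. z \<in> B \<Longrightarrow> f z * Q' z = P' z"
proof -
  define J where "J = (\<lambda>t. (t ^ v 0, t ^ w 0)) ` {t :: complex. t ^ M = 1}"
  define G where "G = (\<lambda>(s, t). two_scale n w v s t) ` J"
  have G: "diagonal_group G"
    unfolding G_def
  proof (rule diagonal_group_two_scale)
    show "finite J" unfolding J_def
      by (rule finite_imageI[OF finite_roots_unity]) (use Suc_leI[OF pos(4)] in simp)
    show "(1, 1) \<in> J" unfolding J_def by (rule image_eqI[of _ _ 1]) auto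
    show "s \<noteq> 0 \<and> t \<noteq> 0" if "(s, t) \<in> J" for s t
      using that pos by (auto simp: J_def power_0_left)
    show "(s * s', t * t') \<in> J" if st: "(s, t) \<in> J" "(s', t') \<in> J" for s t s' t'
    proof -
      obtain a where "a ^ M = 1" "s = a ^ v 0" "t = a ^ w 0" using st(1) unfolding J_def by blast
      moreover obtain b where "b ^ M = 1" "s' = b ^ v 0" "t' = b ^ w 0" using st(2) unfolding J_def by blast
      ultimately show ?thesis unfolding J_def
        by (intro image_eqI[of _ _ "a * b"]) (auto simp: power_mult_distrib)
    qed
  qed
  have invG: "diag_scale g x \<in> B \<and> f (diag_scale g x) = f x" if g: "g \<in> G" and "x \<in> B" for g x
    using that inv unfolding G_def J_def by (auto simp flip: weighted_scale_tw)
  obtain K a b P0 Q0 where fin: "finite K"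
    and triv: "\<And>e g. e \<in> K \<Longrightarrow> g \<in> G \<Longrightarrow> monomial_at (n + m) e g = 1"
    and P0: "\<And>x. x \<in> B \<Longrightarrow> P0 x = (\<Sum>e\<in>K. a e * monomial_at (n + m) e x)"
    and Q0: "\<And>x. x \<in> B \<Longrightarrow> Q0 x = (\<Sum>e\<in>K. b e * monomial_at (n + m) e x)"
    and eq: "\<And>x. x \<in> B \<Longrightarrow> f x * Q0 x = P0 x" and Q0c: "Q0 c \<noteq> (0::complex)"
    by (rule invariant_fraction[OF G order_trans[OF B slice_affine] invG PQ c];
        (assumption | (rule that; assumption)))
  define deg where "deg e = (\<Sum>k<n + m. tw k * Poly_Mapping.lookup e k)" for e :: "nat \<Rightarrow>\<^sub>0 nat"
  have dvd: "M dvd deg e" if "e \<in> K" for e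
  proof -
    obtain \<zeta> :: complex where z: "\<zeta> ^ M = 1" "\<And>d. \<zeta> ^ d = 1 \<Longrightarrow> M dvd d"
      using primitive_root_exists[of M] pos by blast
    have "two_scale n w v (\<zeta> ^ v 0) (\<zeta> ^ w 0) \<in> G" unfolding G_def J_def using z(1) by auto
    moreover have "two_scale n w v (\<zeta> ^ v 0) (\<zeta> ^ w 0) k = \<zeta> ^ tw k" for k
      by (simp add: two_scale_def twist_weights_def flip: power_mult)
    ultimately have "(\<Prod>k<n + m. (\<zeta> ^ tw k) ^ Poly_Mapping.lookup e k) = 1"
      using triv[OF that, of "two_scale n w v (\<zeta> ^ v 0) (\<zeta> ^ w 0)"] by simp
    then have "\<zeta> ^ deg e = 1" by (simp add: deg_def power_sum power_mult)
    then show ?thesis by (rule z(2))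
  qed
  \<comment> \<open>The exponent \<open>E\<close> only has to be at least \<open>deg e div M\<close> for all monomials \<open>e\<close>.\<close>
  define E where "E = (\<Sum>e\<in>K. deg e div M)"
  define H where "H a x = (\<Sum>e\<in>K. a e * (monomial_at (n + m) e x * (- p1 x) ^ (E - deg e div M)))"
    for a :: "(nat \<Rightarrow>\<^sub>0 nat) \<Rightarrow> complex" and x
  have polyH: "polyfun (H a)" for a unfolding H_def
    by (intro polyfun_sum polyfun_mult polyfun_const polyfun_prod polyfun_power polyfun_uminus polyfun_p1 polyfun_coord)
  have homH: "homogeneous_fun tw (M * E) (H a)" for a
    unfolding homogeneous_fun_def
  proof (intro allI)
    fix t x
    have "monomial_at (n + m) e (weighted_scale tw t x) * (- p1 (weighted_scale tw t x)) ^ (E - deg e div M)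
      = t ^ (M * E) * (monomial_at (n + m) e x * (- p1 x) ^ (E - deg e div M))"
      if e: "e \<in> K" for e
    proof -
      have le: "deg e div M \<le> E" unfolding E_def by (rule member_le_sum[OF e _ fin]) simp
      have 1: "monomial_at (n + m) e (weighted_scale tw t x) =
          t ^ deg e * monomial_at (n + m) e x" (is "_ = _ * ?A")
        using homogeneous_prod[of tw "\<lambda>k. k" "Poly_Mapping.lookup e" "n + m"]
        by (simp add: homogeneous_fun_def deg_def)
      have 2: "(- p1 (weighted_scale tw t x)) ^ (E - deg e div M) =
          t ^ (M * (E - deg e div M)) * (- p1 x) ^ (E - deg e div M)" (is "_ = _ * ?B")
        unfolding p1_tw mult_minus_right[symmetric] power_mult_distrib power_mult ..
      have "deg e + M * (E - deg e div M) = M * E"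
        using dvd[OF e] le by (metis add_diff_inverse_nat dvd_mult_div_cancel distrib_left not_less)
      then have 3: "t ^ deg e * t ^ (M * (E - deg e div M)) = t ^ (M * E)"
        by (simp flip: power_add)
      have "(t ^ deg e * ?A) * (t ^ (M * (E - deg e div M)) * ?B) =
          (t ^ deg e * t ^ (M * (E - deg e div M))) * (?A * ?B)"
        by (simp only: mult_ac)
      then show ?thesis unfolding 1 2 3 .
    qed
    then show "H a (weighted_scale tw t x) = t ^ (M * E) * H a x"
      unfolding H_def sum_distrib_left by (intro sum.cong) (auto simp: mult.left_commute)
  qed
  have Hslice: "H a x = (\<Sum>e\<in>K. a e * monomial_at (n + m) e x)" if "x \<in> slice" for a x
    using that by (simp add: H_def slice_def)
  show ?thesis
  proof (rule that[OF polyH homH polyH homH, of b a])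
    show "H b c \<noteq> 0" using Q0c Q0[OF c(1)] Hslice[of c b] B c by auto
    show "f z * H b z = H a z" if "z \<in> B" for z
      using eq[OF that] Q0[OF that] P0[OF that] Hslice[of z] B that by auto
  qed
qed

text \<open>For openness, the homogeneous equation supplied by \<open>invariant_fraction_X\<close> for the indicator function is
  multiplied by \<open>p1\<close>: the points of \<open>X\<close> where the product is nonzero come from the slice, and lie in \<open>A\<close>.\<close>

lemma open_quotient_X: "open_quotient R X to_X"
  unfolding open_quotient_def
proof (intro conjI allI impI)
  show "morphism R X to_X" by (rule morphism_to_X)
  fix A assume "A \<subseteq> to_X ` pts R \<and> openin (topo R) {z\<in>pts R. to_X z \<in> A}"
  then have A: "A \<subseteq> to_X ` slice" and o: "openin (topo R) {z\<in>slice. to_X z \<in> A}" unfolding pts_R by blast+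
  have inv: "weighted_scale tw t c \<in> slice \<and> to_X (weighted_scale tw t c) = to_X c"
    if "t ^ M = 1" "c \<in> slice" for t c
  proof -
    have "weighted_scale tw t c \<in> slice"
      unfolding weighted_scale_tw
      by (rule scl_slice[OF that(2)]) (use that(1) in \<open>simp_all add: mult_ac flip: power_mult\<close>)
    then show ?thesis using to_X_eq_iff[OF that(2)] that(1) by metis
  qed
  show "openin (topo X) A"
  proof (subst openin_subopen, rule ballI)
    fix e assume "e \<in> A"
    then obtain c where c: "c \<in> slice" "to_X c \<in> A" "e = to_X c" using A by auto
    then obtain Q where Q: "polyfun Q" "Q c \<noteq> 0" "{x\<in>slice. Q x \<noteq> 0} \<subseteq> {z\<in>slice. to_X z \<in> A}"
      using o unfolding openin_zariski[OF slice_affine] by blast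
    let ?f = "\<lambda>z. if to_X z \<in> A then 1 else (0::complex)"
    obtain d P' Q' where *: "polyfun P'" "homogeneous_fun tw d P'" "Q' c \<noteq> 0" "\<And>z. z \<in> slice \<Longrightarrow> ?f z * Q' z = P' z"
      by (rule invariant_fraction_X[of slice ?f Q Q c]) (use inv Q c in \<open>auto simp: subset_iff\<close>)
    have P'c: "P' c \<noteq> 0" using *(3) *(4)[OF c(1)] c(2) by auto
    let ?D = "weighted_point tw ` {x\<in>punctured (n + m). P' x * p1 x \<noteq> 0}"
    have hom: "homogeneous_fun tw (d + M) (\<lambda>x. P' x * p1 x)"
      unfolding homogeneous_fun_def p1_tw homogeneous_funD[OF *(2)] by (simp add: power_add mult_ac)
    have "openin (topo (weighted_proj (n + m) tw)) ?D"
      by (rule openin_weighted_basic[OF _ hom]) (use * polyfun_p1 in auto)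
    then have oD: "openin (topo X) (weighted_point tw ` CX \<inter> ?D)"
      unfolding X_eq by (simp add: openin_subtopology_Int2)
    have cP: "c \<in> punctured (n + m)" "c \<in> CX" "p1 c \<noteq> 0"
      using c(1) slice_punctured by (auto simp: CX_def slice_def)
    then have "e \<in> weighted_point tw ` CX \<inter> ?D" using P'c c(3) by (auto simp: to_X_def)
    moreover have "weighted_point tw ` CX \<inter> ?D \<subseteq> A"
    proof
      fix e' assume e': "e' \<in> weighted_point tw ` CX \<inter> ?D"
      then obtain x where x: "x \<in> CX" "e' = weighted_point tw x" by auto
      then have ne: "P' x * p1 x \<noteq> 0"
        using e' weighted_basic_mem[OF hom, of x "n + m"] CX_sub by blast
      then obtain z t where z: "z \<in> slice" "t \<noteq> 0" "z = weighted_scale tw t x"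
        using to_X_surj[OF x(1)] by auto
      then have "P' z \<noteq> 0" using ne by (simp add: homogeneous_funD[OF *(2)])
      then have "to_X z \<in> A" using *(4)[OF z(1)] by (auto split: if_splits)
      then show "e' \<in> A" using z x by (simp add: to_X_def)
    qed
    ultimately show "\<exists>T. openin (topo X) T \<and> e \<in> T \<and> T \<subseteq> A" using oD by blast
  qed
  fix f assume "f \<circ> to_X \<in> reg R {z\<in>pts R. to_X z \<in> A}"
  then have f: "f \<circ> to_X \<in> reg R {z\<in>slice. to_X z \<in> A}" by (simp only: pts_R)
  show "f \<in> reg X A"
    unfolding X_eq reg_subspace
  proof
    fix e assume "e \<in> A"
    then obtain c where c: "c \<in> slice" "to_X c \<in> A" "e = to_X c" using A by auto
    let ?B = "{z\<in>slice. to_X z \<in> A}"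
    have BA: "?B \<subseteq> affine_points (n + m)" using slice_affine by auto
    have cB: "c \<in> ?B" using c by simp
    obtain P Q where PQ: "polyfun P" "polyfun Q" "Q c \<noteq> 0" "\<And>x. x \<in> ?B \<Longrightarrow> (f \<circ> to_X) x * Q x = P x"
      by (rule reg_zariskiD[OF f BA cB]) (rule that; assumption)
    obtain d P' Q' where *: "polyfun P'" "homogeneous_fun tw d P'" "polyfun Q'" "homogeneous_fun tw d Q'"
      "Q' c \<noteq> 0" "\<And>z. z \<in> ?B \<Longrightarrow> (f \<circ> to_X) z * Q' z = P' z"
      by (rule invariant_fraction_X[of ?B "f \<circ> to_X" P Q c]) (use inv PQ c in \<open>auto\<close>)
    let ?D = "weighted_point tw ` {x\<in>punctured (n + m). Q' x \<noteq> 0}"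
    have eD: "e \<in> ?D" using * c slice_punctured by (auto simp: to_X_def)
    have "f e' = proj_frac P' Q' e'" if e': "e' \<in> ?D \<inter> A" for e'
    proof -
      obtain z where z: "z \<in> slice" "e' = to_X z" "to_X z \<in> A" using e' A by auto
      then have "Q' z \<noteq> 0" using e' weighted_basic_mem[OF *(4), of z "n + m"] slice_punctured
        unfolding to_X_def by blast
      then show ?thesis using *(6)[of z] z by (simp add: to_X_def proj_frac_point[OF *(2,4)] field_simps)
    qed
    then show "\<exists>W g. openin (topo (weighted_proj (n + m) tw)) W \<and> e \<in> W \<and> g \<in> reg (weighted_proj (n + m) tw) W \<and>
        (\<forall>b\<in>W \<inter> A. f b = g b)"
      using openin_weighted_basic[OF *(3,4)] reg_weighted_proj[OF *(1,2,3,4)] eD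
      by (intro exI[of _ ?D] exI[of _ "proj_frac P' Q'"]) auto
  qed
qed

end

section \<open>Affine charts of cyclic hypersurfaces\<close>

definition cyclic_chart :: "nat \<Rightarrow> (nat \<Rightarrow> nat) \<Rightarrow> nat \<Rightarrow> cpoly \<Rightarrow> (nat \<Rightarrow> complex) set set" where
  "cyclic_chart n w l p =
     weighted_point w ` cyclic_cone n l p \<inter> weighted_point w ` {x\<in>punctured (n + 1). x 0 \<noteq> 0}"

lemma homogeneous_coord_power: "homogeneous_fun w (w i * k) (\<lambda>x. x i ^ k)"
  by (simp add: homogeneous_fun_def weighted_scale_def power_mult_distrib power_mult)

lemma homogeneous_coord: "homogeneous_fun w (w i) (\<lambda>x. x i)"
  using homogeneous_coord_power[of w i 1] by simp

lemma openin_cyclic_chart: "openin (topo (cyclic_hypersurface n w l p)) (cyclic_chart n w l p)"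
  unfolding cyclic_hypersurface_eq cyclic_chart_def
  using openin_weighted_basic[OF polyfun_coord homogeneous_coord[of w 0], where N = "n + 1"]
  by (simp add: openin_subtopology_Int2)

lemma cyclic_chart_memD:
  assumes "A \<in> cyclic_chart n w l p" obtains x where "x \<in> cyclic_cone n l p" "x 0 \<noteq> 0" "A = weighted_point w x"
proof -
  obtain x where x: "x \<in> cyclic_cone n l p" "A = weighted_point w x"
    "A \<in> weighted_point w ` {x\<in>punctured (n + 1). x 0 \<noteq> 0}"
    using assms unfolding cyclic_chart_def by auto
  then have "x 0 \<noteq> 0"
    using weighted_basic_mem[OF homogeneous_coord[of w 0], of x "n + 1"] cyclic_cone_punctured by blast
  with x that show ?thesis by blast
qed

lemma cyclic_chart_memI:
  "x \<in> cyclic_cone n l p \<Longrightarrow> x 0 \<noteq> 0 \<Longrightarrow> weighted_point w x \<in> cyclic_chart n w l p"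
  unfolding cyclic_chart_def using cyclic_cone_punctured by blast

lemma homogeneous_cmult: "homogeneous_fun w d f \<Longrightarrow> homogeneous_fun w d (\<lambda>x. a * f x)"
  by (simp add: homogeneous_fun_def)

text \<open>A monomial in the coordinates other than $x_0$ whose degree is divisible by \<open>w 0\<close> becomes a function on the
  chart when it is divided by the power of $x_0$ of the same degree.\<close>

lemma cyclic_monomial:
  fixes e :: "nat \<Rightarrow> nat"
  assumes dvd: "w 0 dvd (\<Sum>k<r. w (k + 1) * e k)"
  obtains F where "F \<in> reg (cyclic_hypersurface n w l p) (cyclic_chart n w l p)"
    "\<And>x. x 0 = 1 \<Longrightarrow> F (weighted_point w x) = a * (\<Prod>k<r. x (k + 1) ^ e k)"
proof -
  obtain d where d: "(\<Sum>k<r. w (k + 1) * e k) = w 0 * d" using dvd by (rule dvdE)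
  define P where "P x = a * (\<Prod>k<r. x (k + 1) ^ e k)" for x :: "nat \<Rightarrow> complex"
  define Q where "Q x = x 0 ^ d" for x :: "nat \<Rightarrow> complex"
  have "homogeneous_fun w (w 0 * d) (\<lambda>x. \<Prod>k<r. x (k + 1) ^ e k)"
    using homogeneous_prod[of w "\<lambda>k. k + 1" e r] unfolding d .
  from homogeneous_cmult[OF this, of a] have P: "polyfun P" "homogeneous_fun w (w 0 * d) P"
    unfolding P_def by (auto intro!: polyfun_mult polyfun_prod polyfun_power)
  have Q: "polyfun Q" "homogeneous_fun w (w 0 * d) Q"
    unfolding Q_def using homogeneous_coord_power by auto
  let ?W = "\<lambda>Q. weighted_point w ` {x\<in>punctured (n + 1). Q x \<noteq> (0::complex)}"
  have "proj_frac P Q \<in> reg (weighted_proj (n + 1) w) (?W Q)"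
    by (rule reg_weighted_proj[OF P Q])
  then have r: "proj_frac P Q \<in> reg (weighted_proj (n + 1) w) (?W (\<lambda>x. x 0))"
    by (rule swf_restrict[OF space_with_functions_weighted_proj openin_weighted_basic[OF Q]])
       (use openin_weighted_basic[OF polyfun_coord homogeneous_coord[of w 0], where N = "n + 1"] in \<open>auto simp: Q_def\<close>)
  have "proj_frac P Q \<in> reg (cyclic_hypersurface n w l p) (cyclic_chart n w l p)"
    unfolding cyclic_hypersurface_eq
    by (rule reg_subspaceI[OF r openin_weighted_basic[OF polyfun_coord homogeneous_coord]])
       (simp add: cyclic_chart_def)
  then show ?thesis
    by (rule that) (simp add: proj_frac_point[OF P(2) Q(2)] P_def Q_def)
qed

text \<open>Restricting to a line gives a polynomial in one variable to which \<open>common_nonzero_value\<close> applies.\<close>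

lemma polyfun_line_vanishing:
  assumes "polyfun f" "f a = 0" "f b \<noteq> 0"
  obtains G where "G \<noteq> 0" "poly G 0 = 0" "\<And>t. f (\<lambda>i. a i + t * (b i - a i)) = poly G t"
proof -
  obtain G where G: "\<And>t. f (\<lambda>i. a i + t * (b i - a i)) = poly G t"
    using polyfun_on_line[OF assms(1), of a "\<lambda>i. b i - a i"] by blast
  show ?thesis
  proof (rule that[OF _ _ G])
    show "G \<noteq> 0" using G[of 1] assms(3) by auto
    show "poly G 0 = 0" using G[of 0] assms(2) by simp
  qed
qed

text \<open>At a point with $x_0 = 0$ we have \<open>p = 0\<close>. Moving the other coordinates along a line towards a point where
  \<open>p\<close> is nonzero, and solving $x_0^\ell = - p$ for a small $x_0$, one stays on the cone and, by continuity,
  in the given open set.\<close>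

lemma cyclic_chart_dense:
  assumes l: "1 \<le> l" and n: "1 \<le> n" and vars: "poly_vars p \<subseteq> {1..n}" and qs: "quasi_smooth {1..n} p"
    and A: "openin (topo (cyclic_hypersurface n w l p)) A" "a \<in> A"
  obtains b where "b \<in> A" "b \<in> cyclic_chart n w l p"
proof -
  let ?C = "cyclic_cone n l p"
  have "a \<in> weighted_point w ` ?C" using openin_subset[OF A(1)] A(2) pts_cyclic by blast
  then obtain x where x: "x \<in> ?C" "weighted_point w x \<in> A" using A(2) by auto
  show ?thesis
  proof (cases "x 0 = 0")
    case False
    then show ?thesis using x that cyclic_chart_memI by blast
  next
    case True
    then have px: "poly_eval p x = 0" using x(1) l by (simp add: cyclic_cone_def power_0_left)
    have "openin (topo (zariski (n + 1) ?C)) {x\<in>pts (zariski (n + 1) ?C). weighted_point w x \<in> A}"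
      by (rule morphismD(3)[OF morphism_weighted_point[OF cyclic_cone_punctured]])
         (use A(1) in \<open>simp add: cyclic_hypersurface_eq\<close>)
    then have "openin (topo (zariski (n + 1) ?C)) {x\<in>?C. weighted_point w x \<in> A}"
      unfolding pts_zariski[OF cyclic_cone_affine] .
    moreover have "x \<in> {x\<in>?C. weighted_point w x \<in> A}" using x by simp
    ultimately obtain Q where Q: "polyfun Q" "Q x \<noteq> 0" "{x\<in>?C. Q x \<noteq> 0} \<subseteq> {x\<in>?C. weighted_point w x \<in> A}"
      unfolding openin_zariski[OF cyclic_cone_affine] by meson
    obtain Q' where Q': "Q = poly_eval Q'" using Q(1) by (auto simp: polyfun_def)
    \<comment> \<open>The first variable below is the parameter on the line from \<open>x\<close> to \<open>d\<close>, the second is the coordinate 0.\<close>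
    obtain d where d: "\<forall>i. i \<notin> {1..n} \<longrightarrow> d i = 0" "poly_eval p d \<noteq> 0"
      using quasi_smooth_nonzero[OF qs] n by auto
    obtain G where G: "G \<noteq> 0" "poly G 0 = 0" "\<And>t. poly_eval p (\<lambda>i. x i + t * (d i - x i)) = poly G t"
      using polyfun_line_vanishing[OF polyfun_poly_eval px d(2)] by blast
    define \<theta> where "\<theta> u i = (if i = 0 then snd u else x i + fst u * (d i - x i))" for u :: "complex \<times> complex" and i
    have "continuous_on UNIV (\<lambda>u. \<theta> u i)" for i
      by (cases "i = 0") (auto simp: \<theta>_def intro!: continuous_intros)
    then have cont: "continuous_on UNIV (\<lambda>u. Q (\<theta> u))" unfolding Q' by (rule continuous_on_poly_eval)
    have oE: "open ((\<lambda>u. Q (\<theta> u)) -` (- {0}))"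
      by (rule open_vimage[OF open_Compl[OF closed_singleton] cont])
    have "\<theta> (0, 0) = x" using True by (auto simp: \<theta>_def fun_eq_iff)
    then have E0: "(0, 0) \<in> (\<lambda>u. Q (\<theta> u)) -` (- {0})" using Q(2) by simp
    have H: "- monom 1 l \<noteq> (0 :: complex poly)" "poly (- monom 1 l) (0::complex) = 0"
      using l by (simp_all add: poly_monom power_0_left)
    obtain t s where ts: "(t, s) \<in> (\<lambda>u. Q (\<theta> u)) -` (- {0})" "poly G t = poly (- monom 1 l) s" "poly G t \<noteq> 0"
      by (rule common_nonzero_value[OF G(1,2) H oE E0])
    have p\<theta>: "poly_eval p (\<theta> (t, s)) = poly G t"
      unfolding G(3)[symmetric] by (rule poly_eval_cong) (use vars in \<open>auto simp: \<theta>_def\<close>)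
    have s: "poly G t = - (s ^ l)" using ts(2) by (simp add: poly_monom)
    then have s0: "s \<noteq> 0" using ts(3) l by (auto simp: power_0_left)
    have "\<theta> (t, s) \<in> affine_points (n + 1)"
      using cyclic_cone_affine[of n l p] x(1) d(1) by (auto simp: affine_points_def \<theta>_def)
    moreover have "\<theta> (t, s) \<noteq> (\<lambda>_. 0)" using s0 by (auto simp: \<theta>_def fun_eq_iff)
    moreover have th0: "\<theta> (t, s) 0 = s" by (simp add: \<theta>_def)
    ultimately have \<theta>C: "\<theta> (t, s) \<in> ?C" using p\<theta> s by (simp add: cyclic_cone_def punctured_def)
    show ?thesis
    proof (rule that)
      show "weighted_point w (\<theta> (t, s)) \<in> A" using ts(1) \<theta>C Q(3) by auto
      show "weighted_point w (\<theta> (t, s)) \<in> cyclic_chart n w l p"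
        by (rule cyclic_chart_memI[OF \<theta>C]) (simp add: th0 s0)
    qed
  qed
qed

section \<open>The slice as a chart of the product\<close>

context twist_data begin

abbreviation V1_chart where "V1_chart \<equiv> cyclic_chart n w l p"
abbreviation V2_chart where "V2_chart \<equiv> cyclic_chart m v l q"

abbreviation chart_tensors where "chart_tensors \<equiv> tensor_reg V1 V2 V1_chart V2_chart"

lemma to_V_chart: "c \<in> slice \<Longrightarrow> to_V c \<in> V1_chart \<times> V2_chart"
  unfolding to_V_def
  by (intro SigmaI cyclic_chart_memI xlift_C1 ylift_C2) (simp_all add: xlift_def ylift_def)

lemma chart_to_V: "e \<in> V1_chart \<times> V2_chart \<Longrightarrow> \<exists>c\<in>slice. to_V c = e"
  by (auto elim!: cyclic_chart_memD intro: to_V_surj)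

text \<open>The group is the product of the groups of \<open>w 0\<close>-th and \<open>v 0\<close>-th roots of unity, acting on the two blocks of
  coordinates. An invariant monomial is a product of two monomials whose degrees are divisible by \<open>w 0\<close> and
  \<open>v 0\<close>; these are functions on the two charts by \<open>cyclic_monomial\<close>, so that invariant polynomials become
  tensors.\<close>

lemma invariant_fraction_V:
  assumes B: "B \<subseteq> slice"
    and inv: "\<And>s t c. s ^ w 0 = 1 \<Longrightarrow> t ^ v 0 = 1 \<Longrightarrow> c \<in> B \<Longrightarrow> scl s t c \<in> B \<and> f (scl s t c) = f c"
    and PQ: "polyfun P" "polyfun Q" "\<And>c. c \<in> B \<Longrightarrow> f c * Q c = P c" and c: "c \<in> B" "Q c \<noteq> 0"
  obtains h k where "h \<in> chart_tensors" "k \<in> chart_tensors"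
    "k (to_V c) \<noteq> 0" "\<And>z. z \<in> B \<Longrightarrow> f z * k (to_V z) = h (to_V z)"
proof -
  define J where "J = {s :: complex. s ^ w 0 = 1} \<times> {t :: complex. t ^ v 0 = 1}"
  define G where "G = (\<lambda>(s, t). two_scale n w v s t) ` J"
  have G: "diagonal_group G"
    unfolding G_def
  proof (rule diagonal_group_two_scale)
    show "finite J" unfolding J_def
      by (intro finite_cartesian_product finite_roots_unity) (use pos in auto)
    show "s \<noteq> 0 \<and> t \<noteq> 0" if "(s, t) \<in> J" for s t
      using that pos by (auto simp: J_def power_0_left)
  qed (auto simp: J_def power_mult_distrib)
  have invG: "diag_scale g x \<in> B \<and> f (diag_scale g x) = f x" if g: "g \<in> G" and "x \<in> B" for g x
    using that inv unfolding G_def J_def by auto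
  obtain K a b P0 Q0 where fin: "finite K"
    and triv: "\<And>e g. e \<in> K \<Longrightarrow> g \<in> G \<Longrightarrow> monomial_at (n + m) e g = 1"
    and P0: "\<And>x. x \<in> B \<Longrightarrow> P0 x = (\<Sum>e\<in>K. a e * monomial_at (n + m) e x)"
    and Q0: "\<And>x. x \<in> B \<Longrightarrow> Q0 x = (\<Sum>e\<in>K. b e * monomial_at (n + m) e x)"
    and eq: "\<And>x. x \<in> B \<Longrightarrow> f x * Q0 x = P0 x" and Q0c: "Q0 c \<noteq> (0::complex)"
    by (rule invariant_fraction[OF G order_trans[OF B slice_affine] invG PQ c];
        (assumption | (rule that; assumption)))
  have triv': "(\<Prod>k<n. (s ^ w (k + 1)) ^ Poly_Mapping.lookup e k) *
      (\<Prod>j<m. (t ^ v (j + 1)) ^ Poly_Mapping.lookup e (n + j)) = 1"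
    if "e \<in> K" "s ^ w 0 = 1" "t ^ v 0 = 1" for e and s t :: complex
  proof -
    have "two_scale n w v s t \<in> G" unfolding G_def J_def using that by auto
    from triv[OF that(1) this] show ?thesis
      unfolding prod_lessThan_add by (simp add: two_scale_def)
  qed
  have dvd1: "w 0 dvd (\<Sum>k<n. w (k + 1) * Poly_Mapping.lookup e k)" if e: "e \<in> K" for e
  proof -
    obtain \<zeta> :: complex where z: "\<zeta> ^ w 0 = 1" "\<And>d. \<zeta> ^ d = 1 \<Longrightarrow> w 0 dvd d"
      using primitive_root_exists[of "w 0"] pos by blast
    show ?thesis
      by (rule z(2)) (use triv'[OF e z(1), of 1] in \<open>simp add: power_sum power_mult\<close>)
  qed
  have dvd2: "v 0 dvd (\<Sum>j<m. v (j + 1) * Poly_Mapping.lookup e (n + j))" if e: "e \<in> K" for e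
  proof -
    obtain \<zeta> :: complex where z: "\<zeta> ^ v 0 = 1" "\<And>d. \<zeta> ^ d = 1 \<Longrightarrow> v 0 dvd d"
      using primitive_root_exists[of "v 0"] pos by blast
    show ?thesis
      by (rule z(2)) (use triv'[OF e _ z(1), of 1] in \<open>simp add: power_sum power_mult\<close>)
  qed
  have tensor: "\<exists>h\<in>chart_tensors.
      \<forall>z. h (to_V z) = (\<Sum>e\<in>K. a e * monomial_at (n + m) e z)"
    for a :: "(nat \<Rightarrow>\<^sub>0 nat) \<Rightarrow> complex"
  proof -
    have "\<forall>e\<in>K. \<exists>F. F \<in> reg V1 V1_chart \<and> (\<forall>x. x 0 = 1 \<longrightarrow>
        F (weighted_point w x) = a e * (\<Prod>k<n. x (k + 1) ^ Poly_Mapping.lookup e k))"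
    proof
      fix e assume e: "e \<in> K"
      obtain F where "F \<in> reg V1 V1_chart" "\<And>x. x 0 = 1 \<Longrightarrow>
          F (weighted_point w x) = a e * (\<Prod>k<n. x (k + 1) ^ Poly_Mapping.lookup e k)"
        by (rule cyclic_monomial[OF dvd1[OF e], where a = "a e"]) (rule that; assumption)
      then show "\<exists>F. F \<in> reg V1 V1_chart \<and> (\<forall>x. x 0 = 1 \<longrightarrow>
          F (weighted_point w x) = a e * (\<Prod>k<n. x (k + 1) ^ Poly_Mapping.lookup e k))"
        by (intro exI[of _ F]) simp
    qed
    from bchoice[OF this] obtain F where F: "\<forall>e\<in>K. F e \<in> reg V1 V1_chart \<and> (\<forall>x. x 0 = 1 \<longrightarrow>
        F e (weighted_point w x) = a e * (\<Prod>k<n. x (k + 1) ^ Poly_Mapping.lookup e k))" ..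
    have "\<forall>e\<in>K. \<exists>F. F \<in> reg V2 V2_chart \<and> (\<forall>x. x 0 = 1 \<longrightarrow>
        F (weighted_point v x) = (\<Prod>k<m. x (k + 1) ^ Poly_Mapping.lookup e (n + k)))"
    proof
      fix e assume e: "e \<in> K"
      obtain F where "F \<in> reg V2 V2_chart" "\<And>x. x 0 = 1 \<Longrightarrow>
          F (weighted_point v x) = 1 * (\<Prod>k<m. x (k + 1) ^ Poly_Mapping.lookup e (n + k))"
        by (rule cyclic_monomial[OF dvd2[OF e], where a = 1]) (rule that; assumption)
      then show "\<exists>F. F \<in> reg V2 V2_chart \<and> (\<forall>x. x 0 = 1 \<longrightarrow>
          F (weighted_point v x) = (\<Prod>k<m. x (k + 1) ^ Poly_Mapping.lookup e (n + k)))"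
        by (intro exI[of _ F]) simp
    qed
    from bchoice[OF this] obtain F' where F': "\<forall>e\<in>K. F' e \<in> reg V2 V2_chart \<and> (\<forall>x. x 0 = 1 \<longrightarrow>
        F' e (weighted_point v x) = (\<Prod>k<m. x (k + 1) ^ Poly_Mapping.lookup e (n + k)))" ..
    show ?thesis
    proof (rule bexI[OF _ tensor_regI[OF fin]], intro allI)
      show "F e \<in> reg V1 V1_chart" "F' e \<in> reg V2 V2_chart" if "e \<in> K" for e using F F' that by auto
      fix z
      have "xlift z 0 = 1" "ylift z 0 = 1" by (simp_all add: xlift_def ylift_def)
      then have "F e (weighted_point w (xlift z)) * F' e (weighted_point v (ylift z)) =
          a e * monomial_at (n + m) e z" if "e \<in> K" for e
        using that by (simp add: F F' prod_lessThan_add xlift_def ylift_def)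
      then show "(case to_V z of (a, b) \<Rightarrow> \<Sum>e\<in>K. F e a * F' e b) =
          (\<Sum>e\<in>K. a e * monomial_at (n + m) e z)"
        unfolding to_V_def prod.case by (intro sum.cong) auto
    qed
  qed
  obtain h where h: "h \<in> chart_tensors"
    "\<forall>z. h (to_V z) = (\<Sum>e\<in>K. a e * monomial_at (n + m) e z)"
    using tensor[of a] by blast
  obtain k where k: "k \<in> chart_tensors"
    "\<forall>z. k (to_V z) = (\<Sum>e\<in>K. b e * monomial_at (n + m) e z)"
    using tensor[of b] by blast
  show ?thesis
    by (rule that[OF h(1) k(1)]) (use h k eq P0 Q0 Q0c c in auto)
qed

text \<open>The tensors of \<open>invariant_fraction_V\<close> define basic open sets, and the fractions of such tensors regular
  functions, of the product; each point of the product of the two charts comes from the slice.\<close>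

lemma open_quotient_V: "open_quotient R V to_V"
  unfolding open_quotient_def
proof (intro conjI allI impI)
  show "morphism R V to_V" by (rule morphism_to_V)
  fix A assume "A \<subseteq> to_V ` pts R \<and> openin (topo R) {z\<in>pts R. to_V z \<in> A}"
  then have A: "A \<subseteq> to_V ` slice" and o: "openin (topo R) {z\<in>slice. to_V z \<in> A}" unfolding pts_R by blast+
  have inv: "scl s t c \<in> slice \<and> to_V (scl s t c) = to_V c"
    if "s ^ w 0 = 1" "t ^ v 0 = 1" "c \<in> slice" for s t c
    using scl_slice[OF that(3), of s t] to_V_scl[OF that(1,2)] that
    by (simp add: mult.commute[of l] power_mult)
  show "openin (topo V) A"
  proof (subst openin_subopen, rule ballI)
    fix e assume "e \<in> A"
    then obtain c where c: "c \<in> slice" "to_V c \<in> A" "e = to_V c" using A by auto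
    then have "c \<in> {z\<in>slice. to_V z \<in> A}" by simp
    then obtain Q where Q: "polyfun Q" "Q c \<noteq> 0" "{x\<in>slice. Q x \<noteq> 0} \<subseteq> {z\<in>slice. to_V z \<in> A}"
      using o unfolding openin_zariski[OF slice_affine] by meson
    let ?f = "\<lambda>z. if to_V z \<in> A then 1 else (0::complex)"
    obtain h k where *: "h \<in> chart_tensors" "k (to_V c) \<noteq> 0"
      "\<And>z. z \<in> slice \<Longrightarrow> ?f z * k (to_V z) = h (to_V z)"
      by (rule invariant_fraction_V[of slice ?f Q Q c]) (use inv Q c in \<open>auto simp: subset_iff\<close>)
    let ?D = "{e \<in> V1_chart \<times> V2_chart. h e \<noteq> 0}"
    have "openin (topo V) ?D"
      unfolding prod_fspace_def fspace.simps
      by (rule topology_generated_by_Basis) (use openin_cyclic_chart *(1) in blast)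
    moreover have "e \<in> ?D" using *(2) *(3)[OF c(1)] c to_V_chart[OF c(1)] by auto
    moreover have "?D \<subseteq> A"
    proof
      fix e' assume e': "e' \<in> ?D"
      then obtain z where z: "z \<in> slice" "to_V z = e'" using chart_to_V by blast
      then show "e' \<in> A" using *(3)[OF z(1)] e' by (auto split: if_splits)
    qed
    ultimately show "\<exists>T. openin (topo V) T \<and> e \<in> T \<and> T \<subseteq> A" by blast
  qed
  fix f assume "f \<circ> to_V \<in> reg R {z\<in>pts R. to_V z \<in> A}"
  then have f: "f \<circ> to_V \<in> reg R {z\<in>slice. to_V z \<in> A}" by (simp only: pts_R)
  have "\<exists>h k. h \<in> chart_tensors \<and> k \<in> chart_tensors \<and>
     e \<in> V1_chart \<times> V2_chart \<and> k e \<noteq> 0 \<and> (\<forall>e'\<in>A \<inter> V1_chart \<times> V2_chart. k e' \<noteq> 0 \<longrightarrow> f e' = h e' / k e')"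
    if "e \<in> A" for e
  proof -
    obtain c where c: "c \<in> slice" "to_V c \<in> A" "e = to_V c" using A \<open>e \<in> A\<close> by auto
    let ?B = "{z\<in>slice. to_V z \<in> A}"
    have BA: "?B \<subseteq> affine_points (n + m)" using slice_affine by auto
    have cB: "c \<in> ?B" using c by simp
    obtain P Q where PQ: "polyfun P" "polyfun Q" "Q c \<noteq> 0" "\<And>x. x \<in> ?B \<Longrightarrow> (f \<circ> to_V) x * Q x = P x"
      by (rule reg_zariskiD[OF f BA cB]) (rule that; assumption)
    obtain h k where *: "h \<in> chart_tensors" "k \<in> chart_tensors"
      "k (to_V c) \<noteq> 0" "\<And>z. z \<in> ?B \<Longrightarrow> (f \<circ> to_V) z * k (to_V z) = h (to_V z)"
      by (rule invariant_fraction_V[of ?B "f \<circ> to_V" P Q c]) (use inv PQ c in \<open>auto\<close>)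
    have val: "f e' = h e' / k e'" if "e' \<in> A" "k e' \<noteq> 0" for e'
      using *(4) that A by (auto simp: field_simps)
    show ?thesis
      by (rule exI[of _ h], rule exI[of _ k]) (use * c to_V_chart[OF c(1)] val in simp)
  qed
  note loc = this
  show "f \<in> reg V A"
    unfolding prod_fspace_def fspace.simps
  proof (intro CollectI ballI)
    fix e assume "e \<in> A"
    from loc[OF this] obtain h k where "h \<in> chart_tensors"
      "k \<in> chart_tensors" "e \<in> V1_chart \<times> V2_chart" "k e \<noteq> 0"
      "\<forall>e'\<in>A \<inter> V1_chart \<times> V2_chart. k e' \<noteq> 0 \<longrightarrow> f e' = h e' / k e'"
      by (elim exE conjE)
    then show "\<exists>U W h k. openin (topo V1) U \<and> openin (topo V2) W \<and> e \<in> U \<times> W \<and>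
        h \<in> tensor_reg V1 V2 U W \<and> k \<in> tensor_reg V1 V2 U W \<and> k e \<noteq> 0 \<and>
        (\<forall>e'\<in>A \<inter> U \<times> W. k e' \<noteq> 0 \<longrightarrow> f e' = h e' / k e')"
      by - (rule exI[of _ V1_chart], rule exI[of _ V2_chart], rule exI[of _ h], rule exI[of _ k],
          simp add: openin_cyclic_chart)
  qed
qed

text \<open>The two factors can be treated in turn, because \<open>b \<mapsto> (b, a2)\<close> and \<open>b \<mapsto> (b1, b)\<close> are morphisms into the product.\<close>

lemma to_V_dense:
  assumes A: "openin (topo V) A" "a \<in> A"
  obtains c where "c \<in> slice" "to_V c \<in> A"
proof -
  note swf = space_with_functions_cyclic
  obtain a1 a2 where a: "a = (a1, a2)" by force
  have a12: "a1 \<in> pts V1" "a2 \<in> pts V2"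
    using openin_subset[OF A(1)] A(2) unfolding pts_prod[OF swf swf] a by auto
  have "morphism V1 V (\<lambda>b. (b, a2))"
    by (rule morphism_pair[OF swf swf swf morphism_id[OF swf] morphism_const[OF swf a12(2)]])
  from morphismD(3)[OF this A(1)] have o1: "openin (topo V1) {b\<in>pts V1. (b, a2) \<in> A}" .
  obtain b1 where b1: "b1 \<in> {b\<in>pts V1. (b, a2) \<in> A}" "b1 \<in> V1_chart"
    by (rule cyclic_chart_dense[OF l_pos n_pos p_vars p_smooth o1, of a1]) (use a a12 A(2) in auto)
  have "morphism V2 V (\<lambda>b. (b1, b))"
    by (rule morphism_pair[OF swf swf swf morphism_const[OF swf] morphism_id[OF swf]]) (use b1 in auto)
  from morphismD(3)[OF this A(1)] have o2: "openin (topo V2) {b\<in>pts V2. (b1, b) \<in> A}" .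
  obtain b2 where b2: "b2 \<in> {b\<in>pts V2. (b1, b) \<in> A}" "b2 \<in> V2_chart"
    by (rule cyclic_chart_dense[OF l_pos m_pos q_vars q_smooth o2, of a2]) (use b1 a12 in auto)
  obtain c where "c \<in> slice" "to_V c = (b1, b2)" using chart_to_V[of "(b1, b2)"] b1 b2 by auto
  with b2 that show ?thesis by auto
qed

text \<open>At a point with \<open>p = q = 0\<close>, the arguments of \<open>p\<close> and of \<open>q\<close> are moved along two separate lines, with
  parameters chosen such that \<open>p\<close> and \<open>q\<close> keep a common value, now nonzero.\<close>

lemma to_X_dense:
  assumes A: "openin (topo X) A" "a \<in> A"
  obtains c where "c \<in> slice" "to_X c \<in> A"
proof -
  have CXA: "CX \<subseteq> affine_points (n + m)" using CX_sub punctured_affine by blast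
  have "a \<in> weighted_point tw ` CX"
    using openin_subset[OF A(1)] A(2) by (auto simp: X_eq)
  then obtain x where x: "x \<in> CX" "weighted_point tw x \<in> A" using A(2) by auto
  have "\<exists>y\<in>CX. p1 y \<noteq> 0 \<and> weighted_point tw y \<in> A"
  proof (cases "p1 x = 0")
    case False
    with x show ?thesis by blast
  next
    case True
    then have px: "p1 x = 0" and qx: "q1 x = 0" using x(1) by (auto simp: CX_def)
    have "openin (topo (zariski (n + m) CX)) {x\<in>pts (zariski (n + m) CX). weighted_point tw x \<in> A}"
      by (rule morphismD(3)[OF morphism_weighted_point[OF CX_sub]])
         (use A(1) in \<open>simp add: X_eq\<close>)
    then have "openin (topo (zariski (n + m) CX)) {x\<in>CX. weighted_point tw x \<in> A}"
      unfolding pts_zariski[OF CXA] .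
    moreover have "x \<in> {x\<in>CX. weighted_point tw x \<in> A}" using x by simp
    ultimately obtain Q where Q: "polyfun Q" "Q x \<noteq> 0" "{x\<in>CX. Q x \<noteq> 0} \<subseteq> {x\<in>CX. weighted_point tw x \<in> A}"
      unfolding openin_zariski[OF CXA] by meson
    obtain Q' where Q': "Q = poly_eval Q'" using Q(1) by (auto simp: polyfun_def)
    obtain d where d: "\<forall>i. i \<notin> {1..n} \<longrightarrow> d i = 0" "poly_eval p d \<noteq> 0"
      using quasi_smooth_nonzero[OF p_smooth] n_pos by auto
    obtain e where e: "\<forall>i. i \<notin> {1..m} \<longrightarrow> e i = 0" "poly_eval q e \<noteq> 0"
      using quasi_smooth_nonzero[OF q_smooth] m_pos by auto
    have "p1 (\<lambda>k. d (k + 1)) \<noteq> 0"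
      using d(2) poly_eval_cong[of p d "\<lambda>i. d (i - 1 + 1)"] p_vars by (force simp: p1_def)
    then obtain G where G: "G \<noteq> 0" "poly G 0 = 0" "\<And>t. p1 (\<lambda>k. x k + t * (d (k + 1) - x k)) = poly G t"
      using polyfun_line_vanishing[OF polyfun_p1 px, of "\<lambda>k. d (k + 1)"] by blast
    have "q1 (\<lambda>k. e (k + 1 - n)) \<noteq> 0"
      using e(2) poly_eval_cong[of q e "\<lambda>j. e (n + j - 1 + 1 - n)"] q_vars by (force simp: q1_def)
    then obtain H where H: "H \<noteq> 0" "poly H 0 = 0" "\<And>s. q1 (\<lambda>k. x k + s * (e (k + 1 - n) - x k)) = poly H s"
      using polyfun_line_vanishing[OF polyfun_q1 qx, of "\<lambda>k. e (k + 1 - n)"] by blast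
    define \<theta> where "\<theta> u k = (if k < n then x k + fst u * (d (k + 1) - x k)
        else x k + snd u * (e (k + 1 - n) - x k))" for u :: "complex \<times> complex" and k
    have "continuous_on UNIV (\<lambda>u. \<theta> u i)" for i
      by (cases "i < n") (auto simp: \<theta>_def intro!: continuous_intros)
    then have cont: "continuous_on UNIV (\<lambda>u. Q (\<theta> u))" unfolding Q' by (rule continuous_on_poly_eval)
    have oE: "open ((\<lambda>u. Q (\<theta> u)) -` (- {0}))"
      by (rule open_vimage[OF open_Compl[OF closed_singleton] cont])
    have "\<theta> (0, 0) = x" by (auto simp: \<theta>_def fun_eq_iff)
    then have E0: "(0, 0) \<in> (\<lambda>u. Q (\<theta> u)) -` (- {0})" using Q(2) by simp
    obtain t s where ts: "(t, s) \<in> (\<lambda>u. Q (\<theta> u)) -` (- {0})" "poly G t = poly H s" "poly G t \<noteq> 0"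
      by (rule common_nonzero_value[OF G(1,2) H(1,2) oE E0])
    have p\<theta>: "p1 (\<theta> (t, s)) = poly G t"
      unfolding G(3)[symmetric] p1_def by (rule poly_eval_cong) (use p_vars in \<open>force simp: \<theta>_def\<close>)
    have q\<theta>: "q1 (\<theta> (t, s)) = poly H s"
      unfolding H(3)[symmetric] q1_def by (rule poly_eval_cong) (use q_vars in \<open>force simp: \<theta>_def\<close>)
    have "\<theta> (t, s) \<in> affine_points (n + m)"
      unfolding affine_points_def
    proof (intro CollectI allI impI)
      fix i assume i: "n + m \<le> i"
      then have "e (i + 1 - n) = 0" by (intro e(1)[rule_format]) auto
      moreover have "x i = 0" using i CXA x(1) by (auto intro: affine_pointsD)
      ultimately show "\<theta> (t, s) i = 0" using i by (simp add: \<theta>_def)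
    qed
    moreover have "\<theta> (t, s) \<noteq> (\<lambda>_. 0)" using p\<theta> ts(3) p1_zero by auto
    ultimately have "\<theta> (t, s) \<in> CX" using p\<theta> q\<theta> ts(2) by (simp add: CX_def punctured_def)
    then show ?thesis using ts Q(3) p\<theta> by (intro bexI[of _ "\<theta> (t, s)"]) auto
  qed
  then obtain y where y: "y \<in> CX" "p1 y \<noteq> 0" "weighted_point tw y \<in> A" by blast
  obtain z t where "z \<in> slice" "t \<noteq> 0" "z = weighted_scale tw t y" using to_X_surj[OF y(1,2)] by blast
  with y that show ?thesis by (simp add: to_X_def)
qed

end

section \<open>Groups acting on the slice\<close>

lemma twist_action_point:
  "twist_action \<gamma> (weighted_point w x, weighted_point v y) =
     (weighted_point w (x(0 := \<gamma> * x 0)), weighted_point v (y(0 := \<gamma> * y 0)))"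
proof -
  have "(weighted_scale w t x)(0 := \<gamma> * weighted_scale w t x 0) = weighted_scale w t (x(0 := \<gamma> * x 0))"
    for w t and x :: "nat \<Rightarrow> complex"
    by (auto simp: weighted_scale_def fun_eq_iff)
  then have "(\<lambda>x. x(0 := \<gamma> * x 0)) ` weighted_point w x = weighted_point w (x(0 := \<gamma> * x 0))"
    for w and x :: "nat \<Rightarrow> complex"
    by (simp add: orbit_def image_image)
  then show ?thesis by (simp add: twist_action_def)
qed

lemma twist_action_1: "twist_action 1 c = c"
  by (cases c) (simp add: twist_action_def)

lemma twist_action_mult: "twist_action (\<gamma> * \<delta>) c = twist_action \<gamma> (twist_action \<delta> c)"
  by (cases c) (simp add: twist_action_def image_image mult.assoc)

lemma orbit_roots_of_unity_eq_iff:
  assumes one: "act 1 a = a" "act 1 b = b" and l: "0 < l"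
    and mult: "\<And>\<gamma> \<delta>. \<gamma> \<in> roots_of_unity l \<Longrightarrow> \<delta> \<in> roots_of_unity l \<Longrightarrow> act (\<gamma> * \<delta>) a = act \<gamma> (act \<delta> a)"
  shows "orbit (roots_of_unity l) act a = orbit (roots_of_unity l) act b \<longleftrightarrow>
    (\<exists>\<gamma>\<in>roots_of_unity l. b = act \<gamma> a)"
proof
  assume eq: "orbit (roots_of_unity l) act a = orbit (roots_of_unity l) act b"
  have "b \<in> orbit (roots_of_unity l) act b"
    unfolding orbit_def by (rule image_eqI[of _ _ 1]) (simp_all add: one roots_of_unity_def)
  with eq have "b \<in> orbit (roots_of_unity l) act a" by simp
  then show "\<exists>\<gamma>\<in>roots_of_unity l. b = act \<gamma> a" by (auto simp: orbit_def)
next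
  assume "\<exists>\<gamma>\<in>roots_of_unity l. b = act \<gamma> a"
  then obtain \<gamma> where \<gamma>: "\<gamma> \<in> roots_of_unity l" "b = act \<gamma> a" by blast
  have nz: "\<gamma> \<noteq> 0" using \<gamma>(1) l by (auto simp: roots_of_unity_def power_0_left)
  show "orbit (roots_of_unity l) act a = orbit (roots_of_unity l) act b"
  proof
    show "orbit (roots_of_unity l) act b \<subseteq> orbit (roots_of_unity l) act a"
    proof
      fix c assume "c \<in> orbit (roots_of_unity l) act b"
      then obtain \<delta> where "\<delta> \<in> roots_of_unity l" "c = act \<delta> b" by (auto simp: orbit_def)
      then show "c \<in> orbit (roots_of_unity l) act a"
        using \<gamma> mult unfolding orbit_def
        by (intro image_eqI[of _ _ "\<delta> * \<gamma>"]) (auto simp: roots_of_unity_def power_mult_distrib)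
    qed
    show "orbit (roots_of_unity l) act a \<subseteq> orbit (roots_of_unity l) act b"
    proof
      fix c assume "c \<in> orbit (roots_of_unity l) act a"
      then obtain \<delta> where \<delta>: "\<delta> \<in> roots_of_unity l" "c = act \<delta> a" by (auto simp: orbit_def)
      have r: "\<delta> / \<gamma> \<in> roots_of_unity l" using \<delta>(1) \<gamma>(1) by (simp add: roots_of_unity_def power_divide)
      have "c = act (\<delta> / \<gamma>) b" using mult[OF r \<gamma>(1)] \<delta>(2) \<gamma>(2) nz by simp
      with r show "c \<in> orbit (roots_of_unity l) act b" unfolding orbit_def by blast
    qed
  qed
qed

context twist_data begin

text \<open>Multiplying the coordinates 0 by \<open>\<gamma>\<close> amounts to rescaling the others, once the coordinates 0 are normalized
  to 1 again.\<close>

lemma act_to_V: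
  assumes "s ^ w 0 * \<gamma> = 1" "t ^ v 0 * \<gamma> = 1"
  shows "twist_action \<gamma> (to_V c) = to_V (scl s t c)"
proof -
  have 1: "xlift (scl s t c) = weighted_scale w s ((xlift c)(0 := \<gamma> * xlift c 0))"
    using assms by (auto simp: xlift_def weighted_scale_def two_scale_def fun_eq_iff)
  have 2: "ylift (scl s t c) = weighted_scale v t ((ylift c)(0 := \<gamma> * ylift c 0))"
    using assms by (auto simp: ylift_def weighted_scale_def two_scale_def fun_eq_iff)
  have "s \<noteq> 0" "t \<noteq> 0" using assms pos by (auto simp: power_0_left)
  then show ?thesis unfolding to_V_def twist_action_point 1 2 by simp
qed

lemma to_V_eqD:
  assumes "to_V c = to_V c'" "c \<in> affine_points (n + m)" "c' \<in> affine_points (n + m)"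
  obtains s t where "s ^ w 0 = 1" "t ^ v 0 = 1" "c' = scl s t c"
proof -
  obtain s t where s: "xlift c' = weighted_scale w s (xlift c)" and t: "ylift c' = weighted_scale v t (ylift c)"
    using assms(1) by (auto simp: to_V_def weighted_point_eq_iff)
  show ?thesis
  proof (rule that)
    show "s ^ w 0 = 1" using fun_cong[OF s, of 0] by (simp add: xlift_def weighted_scale_def)
    show "t ^ v 0 = 1" using fun_cong[OF t, of 0] by (simp add: ylift_def weighted_scale_def)
    show "c' = scl s t c"
    proof
      fix k
      consider "k < n" | "n \<le> k" "k < n + m" | "n + m \<le> k" by linarith
      then show "c' k = scl s t c k"
      proof cases
        case 1
        then show ?thesis using fun_cong[OF s, of "k + 1"]
          by (simp add: xlift_def weighted_scale_def two_scale_def)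
      next
        case 2
        then have "n + Suc (k - n) - 1 = k" "Suc (k - n) \<le> m" by auto
        with 2 show ?thesis using fun_cong[OF t, of "k - n + 1"]
          by (simp add: ylift_def weighted_scale_def two_scale_def)
      next
        case 3
        then show ?thesis using assms(2,3) by (simp add: affine_pointsD)
      qed
    qed
  qed
qed

text \<open>These scalings preserve the slice. Among them are the groups whose orbits are the fibres of \<open>to_V\<close> and of
  \<open>to_X\<close>, and scalings that induce the action of $\mu_\ell$.\<close>

definition scalars :: "(complex \<times> complex) set" where
  "scalars = {s. s ^ (l * w 0) = 1} \<times> {t. t ^ (l * v 0) = 1}"

lemma finite_scalars: "finite scalars"
  unfolding scalars_def
  by (intro finite_cartesian_product finite_roots_unity) (use pos in \<open>auto simp: Suc_le_eq\<close>)

lemma scalars_one: "(1, 1) \<in> scalars"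
  by (simp add: scalars_def)

lemma scalars_mult: "(s, t) \<in> scalars \<Longrightarrow> (s', t') \<in> scalars \<Longrightarrow> (s * s', t * t') \<in> scalars"
  by (simp add: scalars_def power_mult_distrib)

lemma scalars_inverse: "(s, t) \<in> scalars \<Longrightarrow> (1 / s, 1 / t) \<in> scalars"
  by (simp add: scalars_def power_divide)

lemma scalars_nonzero: "(s, t) \<in> scalars \<Longrightarrow> s \<noteq> 0 \<and> t \<noteq> 0"
  using pos by (auto simp: scalars_def power_0_left)

lemma scl_scl: "scl s t (scl s' t' c) = scl (s * s') (t * t') c"
  using two_scale_mult[of n w v s t s' t'] by (simp add: fun_eq_iff mult.assoc[symmetric])

lemma scl_1: "scl 1 1 c = c"
  by (simp add: two_scale_def fun_eq_iff)

lemma scalars_slice: "(s, t) \<in> scalars \<Longrightarrow> c \<in> slice \<Longrightarrow> scl s t c \<in> slice"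
  by (rule scl_slice) (simp_all add: scalars_def)

lemma openin_scl_preimage:
  assumes "(s, t) \<in> scalars" "openin (topo R) B" shows "openin (topo R) {z\<in>slice. scl s t z \<in> B}"
proof -
  have "morphism R R (scl s t)"
    by (rule morphism_polynomial[OF slice_affine slice_affine]) (use assms scalars_slice in auto)
  from morphismD(3)[OF this assms(2)] show ?thesis unfolding pts_R .
qed

lemma openin_scl_saturation:
  assumes "J \<subseteq> scalars" "openin (topo R) B"
  shows "openin (topo R) {z\<in>slice. \<exists>(s, t)\<in>J. scl s t z \<in> B}"
proof -
  have "openin (topo R) (\<Union>j\<in>J. {z\<in>slice. scl (fst j) (snd j) z \<in> B})"
  proof (rule openin_Union, elim imageE, hypsubst)
    fix j assume "j \<in> J"
    then have "(fst j, snd j) \<in> scalars" using assms(1) by auto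
    then show "openin (topo R) {z\<in>slice. scl (fst j) (snd j) z \<in> B}"
      by (rule openin_scl_preimage[OF _ assms(2)])
  qed
  moreover have "(\<Union>j\<in>J. {z\<in>slice. scl (fst j) (snd j) z \<in> B}) = {z\<in>slice. \<exists>(s, t)\<in>J. scl s t z \<in> B}"
    by (auto simp: case_prod_beta)
  ultimately show ?thesis by simp
qed

lemma root_in_scalars: "s ^ w 0 = 1 \<Longrightarrow> t ^ v 0 = 1 \<Longrightarrow> (s, t) \<in> scalars"
  by (simp add: scalars_def mult.commute[of l] power_mult)

lemma tw_in_scalars: "t ^ M = 1 \<Longrightarrow> (t ^ v 0, t ^ w 0) \<in> scalars"
  by (simp add: scalars_def mult_ac flip: power_mult)

text \<open>The fibres are orbits of a group of homeomorphisms, so the saturation of an open set is a union of open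
  translates.\<close>

lemma to_V_open_map:
  assumes B: "openin (topo R) B" shows "openin (topo V) (to_V ` B)"
proof (rule open_quotientD(2)[OF open_quotient_V])
  have Bs: "B \<subseteq> slice" using openin_subset[OF B] pts_R by simp
  then show "to_V ` B \<subseteq> to_V ` pts R" unfolding pts_R by auto
  let ?J = "{s. s ^ w 0 = 1} \<times> {t. t ^ v 0 = 1} :: (complex \<times> complex) set"
  have eq: "{z\<in>slice. to_V z \<in> to_V ` B} = {z\<in>slice. \<exists>(s, t)\<in>?J. scl s t z \<in> B}"
  proof (intro Collect_cong conj_cong refl iffI)
    fix z assume z: "z \<in> slice"
    {
      assume "to_V z \<in> to_V ` B"
      then obtain z' where z': "z' \<in> B" "to_V z = to_V z'" by auto
      have "z \<in> affine_points (n + m)" "z' \<in> affine_points (n + m)" using z z'(1) Bs slice_affine by auto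
      from to_V_eqD[OF z'(2) this] obtain s t where "s ^ w 0 = 1" "t ^ v 0 = 1" "z' = scl s t z" .
      then show "\<exists>(s, t)\<in>?J. scl s t z \<in> B"
        using z'(1) by (intro bexI[of _ "(s, t)"]) simp_all
    }
    assume "\<exists>(s, t)\<in>?J. scl s t z \<in> B"
    then obtain s t where "s ^ w 0 = 1" "t ^ v 0 = 1" "scl s t z \<in> B" by auto
    then show "to_V z \<in> to_V ` B" by (intro image_eqI[of _ _ "scl s t z"]) (simp_all only: to_V_scl)
  qed
  have "?J \<subseteq> scalars" using root_in_scalars by auto
  from openin_scl_saturation[OF this B] show "openin (topo R) {z\<in>pts R. to_V z \<in> to_V ` B}"
    unfolding pts_R eq .
qed

lemma to_X_open_map:
  assumes B: "openin (topo R) B" shows "openin (topo X) (to_X ` B)"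
proof (rule open_quotientD(2)[OF open_quotient_X])
  have Bs: "B \<subseteq> slice" using openin_subset[OF B] pts_R by simp
  then show "to_X ` B \<subseteq> to_X ` pts R" unfolding pts_R by auto
  let ?J = "(\<lambda>t. (t ^ v 0, t ^ w 0)) ` {t :: complex. t ^ M = 1}"
  have eq: "{z\<in>slice. to_X z \<in> to_X ` B} = {z\<in>slice. \<exists>(s, t)\<in>?J. scl s t z \<in> B}"
  proof (intro Collect_cong conj_cong refl iffI)
    fix z assume z: "z \<in> slice"
    {
      assume "to_X z \<in> to_X ` B"
      then obtain z' where z': "z' \<in> B" "to_X z = to_X z'" by auto
      then obtain t where "t ^ M = 1" "z' = weighted_scale tw t z"
        using to_X_eq_iff[OF z, of z'] Bs by auto
      then show "\<exists>(s, t)\<in>?J. scl s t z \<in> B"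
        using z'(1) unfolding weighted_scale_tw by (intro bexI[of _ "(t ^ v 0, t ^ w 0)"]) auto
    }
    assume "\<exists>(s, t)\<in>?J. scl s t z \<in> B"
    then obtain t where t: "t ^ M = 1" "weighted_scale tw t z \<in> B" unfolding weighted_scale_tw by auto
    then have "to_X z = to_X (weighted_scale tw t z)"
      using to_X_eq_iff[OF z, of "weighted_scale tw t z"] Bs by blast
    then show "to_X z \<in> to_X ` B" using t(2) by auto
  qed
  have "?J \<subseteq> scalars" using tw_in_scalars by auto
  from openin_scl_saturation[OF this B] show "openin (topo R) {z\<in>pts R. to_X z \<in> to_X ` B}"
    unfolding pts_R eq .
qed

text \<open>The intersection of the translates of \<open>B\<close>, which is invariant under \<open>J\<close> if \<open>J\<close> is a group.\<close>

definition core :: "(nat \<Rightarrow> complex) set \<Rightarrow> (complex \<times> complex) set \<Rightarrow> (nat \<Rightarrow> complex) set" where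
  "core B J = {z\<in>slice. \<forall>(s, t)\<in>J. scl s t z \<in> B}"

lemma core_dense_open:
  assumes B: "dense_open R B" and J: "J \<subseteq> scalars" shows "dense_open R (core B J)"
proof -
  have "finite J" using finite_subset[OF J finite_scalars] .
  then show ?thesis using J
  proof (induction J rule: finite_induct)
    case empty
    have "core B {} = pts R" unfolding core_def pts_R by simp
    moreover have "dense_open R (pts R)"
      by (rule dense_openI[OF openin_topspace]) (use openin_subset in blast)
    ultimately show ?case by simp
  next
    case (insert j J)
    obtain s t where j: "j = (s, t)" by force
    have sc: "(s, t) \<in> scalars" using insert j by simp
    have IH: "dense_open R (core B J)" using insert by simp
    have eq: "core B (insert j J) = core B J \<inter> {z\<in>slice. scl s t z \<in> B}" by (auto simp: core_def j)
    show ?case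
    proof (rule dense_openI)
      show "openin (topo R) (core B (insert j J))"
        unfolding eq by (intro openin_Int dense_openD(1)[OF IH] openin_scl_preimage[OF sc dense_openD(1)[OF B]])
      fix A a assume A: "openin (topo R) A" "a \<in> A"
      then obtain b where b: "b \<in> A" "b \<in> core B J" using dense_openD(2)[OF IH] by blast
      have bs: "b \<in> slice" using b by (simp add: core_def)
      have o: "openin (topo R) {z\<in>slice. scl (1 / s) (1 / t) z \<in> A \<inter> core B J}"
        by (rule openin_scl_preimage[OF scalars_inverse[OF sc] openin_Int[OF A(1) dense_openD(1)[OF IH]]])
      have "scl s t b \<in> {z\<in>slice. scl (1 / s) (1 / t) z \<in> A \<inter> core B J}"
        using scalars_slice[OF sc bs] scalars_nonzero[OF sc] b by (simp add: scl_scl scl_1 del: mult.assoc)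
      then obtain z where z: "z \<in> slice" "scl (1 / s) (1 / t) z \<in> A \<inter> core B J" "z \<in> B"
        using dense_openD(2)[OF B o] by blast
      have "scl s t (scl (1 / s) (1 / t) z) = z" using scalars_nonzero[OF sc] by (simp only: scl_scl) (simp add: scl_1)
      then have "scl (1 / s) (1 / t) z \<in> core B (insert j J)"
        unfolding eq using z scalars_slice[OF scalars_inverse[OF sc] z(1)] by simp
      then show "\<exists>b. b \<in> A \<and> b \<in> core B (insert j J)" using z(2) by blast
    qed
  qed
qed

text \<open>On the representatives with coordinates 0 equal to 1, both roots in the twist map can be taken to be 1.\<close>

lemma to_V_graph:
  assumes "c \<in> slice" shows "(to_V c, to_X c) \<in> twist_graph n m w v"
proof -
  have c: "c \<in> affine_points (n + m)" "c \<noteq> (\<lambda>_. 0)" using assms slice_punctured slice_affine by (auto simp: punctured_def)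
  have tc: "twist_coords n m w v 1 1 (xlift c) (ylift c) = c"
    using affine_pointsD[OF c(1)] by (auto simp: twist_coords_def xlift_def ylift_def fun_eq_iff)
  have xy0: "xlift c 0 = 1" "ylift c 0 = 1" by (simp_all add: xlift_def ylift_def)
  show ?thesis
    unfolding twist_graph_def mem_Collect_eq
    by (rule exI[of _ "xlift c"], rule exI[of _ "ylift c"], rule exI[of _ 1], rule exI[of _ 1])
       (use c(2) xlift_punctured ylift_punctured xy0 in \<open>simp add: tc to_V_def to_X_def\<close>)
qed

end

section \<open>The resolutions and the two quotients\<close>

locale twist_resolution = twist_data n m l w v p q +
    rV: birational_morphism Vt "prod_fspace (cyclic_hypersurface n w l p) (cyclic_hypersurface m v l q)" \<pi>V UV WV gV +
    rX: birational_morphism Xt "twist_hypersurface n m w v p q" \<pi>X UX WX gX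
  for n m l w v p q and Vt :: "'a fspace" and Xt :: "'b fspace" and \<pi>V \<pi>X UV WV gV UX WX gX +
  fixes \<sigma> and U and \<Phi>t
  assumes complete_Xt: "complete_variety Xt" and smooth_Xt: "smooth Xt"
    and act: "lifted_action l Vt \<sigma> \<pi>V twist_action"
    and U: "dense_open Vt U" and \<Phi>t: "morphism (subspace_fun Vt U) Xt \<Phi>t"
    and lifts: "lifts_twist n m w v U \<Phi>t \<pi>V \<pi>X"
begin

lemma swf_Vt: "space_with_functions Vt"
  using rV.var by (simp add: variety_def)

lemma open_U: "openin (topo Vt) U" by (rule dense_openD(1)[OF U])

text \<open>The points of the slice whose image in \<open>V\<close> has a unique preimage in \<open>Vt\<close>, at which the lifted twist map is
  defined.\<close>

definition liftable :: "(nat \<Rightarrow> complex) set" where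
  "liftable = {z\<in>slice. to_V z \<in> {b\<in>WV. gV b \<in> U}}"

lemma liftable_dense_open: "dense_open R liftable"
proof (rule dense_openI)
  show "openin (topo R) liftable"
    unfolding liftable_def using morphismD(3)[OF morphism_to_V rV.openin_inv[OF open_U]] unfolding pts_R .
  fix A a assume A: "openin (topo R) A" "a \<in> A"
  obtain b where b: "b \<in> to_V ` A" "b \<in> WV"
    using dense_openD(2)[OF rV.W to_V_open_map[OF A(1)], of "to_V a"] A(2) by blast
  have "openin (topo Vt) (UV \<inter> {a\<in>pts Vt. \<pi>V a \<in> to_V ` A})"
    using rV.open_U morphismD(3)[OF rV.mor to_V_open_map[OF A(1)]] by blast
  moreover have "gV b \<in> UV \<inter> {a\<in>pts Vt. \<pi>V a \<in> to_V ` A}"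
    using b rV.inv_U[OF b(2)] rV.inv_right[OF b(2)] rV.U_pts by auto
  ultimately obtain c where c: "c \<in> UV" "\<pi>V c \<in> to_V ` A" "c \<in> U"
    using dense_openD(2)[OF U] by blast
  then obtain z where z: "z \<in> A" "\<pi>V c = to_V z" by auto
  have "to_V z \<in> WV" using rV.to_W[OF c(1)] z(2) by simp
  then have "z \<in> liftable"
    using z c rV.inv_left[OF c(1)] openin_subset[OF A(1)] by (auto simp: liftable_def)
  with z show "\<exists>b. b \<in> A \<and> b \<in> liftable" by blast
qed

definition Z where "Z = core liftable scalars"

lemma Z_dense_open: "dense_open R Z"
  unfolding Z_def by (rule core_dense_open[OF liftable_dense_open]) simp

lemma Z_open: "openin (topo R) Z" by (rule dense_openD(1)[OF Z_dense_open])

lemma Z_slice: "z \<in> Z \<Longrightarrow> z \<in> slice" by (simp add: Z_def core_def)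

lemma Z_liftable: assumes "z \<in> Z" shows "to_V z \<in> WV" "gV (to_V z) \<in> U"
proof -
  have "scl 1 1 z \<in> liftable" using assms scalars_one unfolding Z_def core_def by blast
  then show "to_V z \<in> WV" "gV (to_V z) \<in> U" by (simp_all only: scl_1) (simp_all add: liftable_def)
qed

lemma Z_scl: assumes "z \<in> Z" "(s, t) \<in> scalars" shows "scl s t z \<in> Z"
proof -
  have "scl s' t' (scl s t z) \<in> liftable" if "(s', t') \<in> scalars" for s' t'
    unfolding scl_scl using assms(1) scalars_mult[OF that assms(2)] unfolding Z_def core_def by blast
  then show ?thesis using scalars_slice[OF assms(2) Z_slice[OF assms(1)]] unfolding Z_def core_def by blast
qed

abbreviation R0 where "R0 \<equiv> subspace_fun R Z"

lemma pts_R0: "pts R0 = Z" using openin_subset[OF Z_open] by auto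

lemma swf_R0: "space_with_functions R0" by (rule space_with_functions_subspace[OF swf_R])

lemma openin_R0: "openin (topo R0) B \<longleftrightarrow> openin (topo R) B \<and> B \<subseteq> Z"
  unfolding topo_subspace[of R Z] by (rule openin_open_subtopology[OF Z_open])

lemma quotient_V: "open_quotient R0 V to_V"
proof (rule open_quotient_restrict[OF swf_R open_quotient_V Z_open])
  fix z z' assume z: "z \<in> pts R" "z' \<in> Z" "to_V z = to_V z'"
  obtain s t where "s ^ w 0 = 1" "t ^ v 0 = 1" "z = scl s t z'"
    using to_V_eqD[OF z(3)[symmetric]] z(1,2) Z_slice slice_affine unfolding pts_R by blast
  then show "z \<in> Z" using Z_scl[OF z(2) root_in_scalars] by simp
qed

lemma quotient_X: "open_quotient R0 X to_X"
proof (rule open_quotient_restrict[OF swf_R open_quotient_X Z_open])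
  fix z z' assume z: "z \<in> pts R" "z' \<in> Z" "to_X z = to_X z'"
  obtain t where "t ^ M = 1" "z = weighted_scale tw t z'"
    using to_X_eq_iff[of z' z] z Z_slice unfolding pts_R by auto
  then show "z \<in> Z" using Z_scl[OF z(2) tw_in_scalars] by (simp add: weighted_scale_tw)
qed

text \<open>The chart of \<open>Vt\<close>.\<close>

definition slice_lift where "slice_lift z = gV (to_V z)"

lemma slice_lift: assumes "z \<in> Z" shows "slice_lift z \<in> UV" "slice_lift z \<in> U" "\<pi>V (slice_lift z) = to_V z" "slice_lift z \<in> pts Vt"
proof -
  show "slice_lift z \<in> UV" "slice_lift z \<in> U" "\<pi>V (slice_lift z) = to_V z"
    using rV.inv_U[OF Z_liftable(1)[OF assms]] Z_liftable(2)[OF assms] rV.inv_right[OF Z_liftable(1)[OF assms]]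
    by (simp_all add: slice_lift_def)
  then show "slice_lift z \<in> pts Vt" by (simp add: rV.U_pts)
qed

lemma quotient_Vt: "open_quotient R0 Vt slice_lift"
  by (rule open_quotient_transport[OF swf_R0 swf_Vt quotient_V rV.open_U rV.open_W rV.iso])
     (unfold pts_R0, use slice_lift Z_liftable in auto)

text \<open>The commutative diagram, evaluated at the point of the graph given by \<open>to_V_graph\<close>.\<close>

lemma twist_slice_lift: assumes "z \<in> Z" shows "\<pi>X (\<Phi>t (slice_lift z)) = to_X z"
  using lifts to_V_graph[OF Z_slice[OF assms]] slice_lift[OF assms] unfolding lifts_twist_def by metis

lemma \<Phi>t_pts: "z \<in> Z \<Longrightarrow> \<Phi>t (slice_lift z) \<in> pts Xt"
  by (rule morphismD(2)[OF \<Phi>t]) (simp add: slice_lift)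

lemma dense_V: assumes "openin (topo V) A" "a \<in> A" obtains z where "z \<in> Z" "to_V z \<in> A"
proof -
  obtain c where c: "c \<in> slice" "to_V c \<in> A" by (rule to_V_dense[OF assms])
  have "openin (topo R) {z\<in>pts R. to_V z \<in> A}" by (rule morphismD(3)[OF morphism_to_V assms(1)])
  then obtain z where "z \<in> {z\<in>pts R. to_V z \<in> A}" "z \<in> Z"
    using dense_openD(2)[OF Z_dense_open, of _ c] c unfolding pts_R by blast
  with that show ?thesis by blast
qed

lemma dense_X: assumes "openin (topo X) A" "a \<in> A" obtains z where "z \<in> Z" "to_X z \<in> A"
proof -
  obtain c where c: "c \<in> slice" "to_X c \<in> A" by (rule to_X_dense[OF assms])
  have "openin (topo R) {z\<in>pts R. to_X z \<in> A}" by (rule morphismD(3)[OF morphism_to_X assms(1)])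
  then obtain z where "z \<in> {z\<in>pts R. to_X z \<in> A}" "z \<in> Z"
    using dense_openD(2)[OF Z_dense_open, of _ c] c unfolding pts_R by blast
  with that show ?thesis by blast
qed

lemma dense_Vt: assumes "openin (topo Vt) A" "a \<in> A" obtains z where "z \<in> Z" "slice_lift z \<in> A"
proof -
  obtain b where b: "b \<in> A" "b \<in> UV" using dense_openD(2)[OF rV.U assms] by blast
  then have "\<pi>V b \<in> {b\<in>WV. gV b \<in> A}" using rV.to_W rV.inv_left by simp
  then obtain z where "z \<in> Z" "to_V z \<in> {b\<in>WV. gV b \<in> A}" by (rule dense_V[OF rV.openin_inv[OF assms(1)]])
  then show ?thesis by (intro that[of z]) (auto simp: slice_lift_def)
qed

lemma meets_WX:
  assumes B: "openin (topo R0) B" "z0 \<in> B" obtains z where "z \<in> B" "z \<in> Z" "to_X z \<in> WX"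
proof -
  have "openin (topo X) (to_X ` B)" by (rule to_X_open_map) (use B(1) openin_R0 in blast)
  then obtain z where "z \<in> B" "to_X z \<in> WX" using dense_openD(2)[OF rX.W, of "to_X ` B" "to_X z0"] B(2) by blast
  moreover have "B \<subseteq> Z" using B by (simp only: openin_R0)
  ultimately show ?thesis using that by blast
qed

text \<open>The action of \<open>\<gamma>\<close> on \<open>V\<close> is a scaling of the slice, by roots of the inverse of \<open>\<gamma>\<close>.\<close>

lemma act_Z:
  assumes "\<gamma> \<in> roots_of_unity l" "z \<in> Z"
  obtains s t where "s ^ w 0 * \<gamma> = 1" "t ^ v 0 * \<gamma> = 1" "scl s t z \<in> Z"
    "twist_action \<gamma> (to_V z) = to_V (scl s t z)"
proof -
  have \<gamma>: "\<gamma> ^ l = 1" "\<gamma> \<noteq> 0" using assms(1) pos by (auto simp: roots_of_unity_def power_0_left)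
  obtain s where s: "s ^ w 0 = 1 / \<gamma>" using complex_nth_root_exists[of "w 0" "1 / \<gamma>"] pos \<gamma> by auto
  obtain t where t: "t ^ v 0 = 1 / \<gamma>" using complex_nth_root_exists[of "v 0" "1 / \<gamma>"] pos \<gamma> by auto
  have st: "s ^ w 0 * \<gamma> = 1" "t ^ v 0 * \<gamma> = 1" using s t \<gamma> by auto
  have "(s, t) \<in> scalars"
    using \<gamma>(1) s t by (simp add: scalars_def mult.commute[of l] power_mult power_divide)
  then show ?thesis using that[OF st Z_scl[OF assms(2)] act_to_V[OF st]] by blast
qed

text \<open>The twist map is single-valued: both sides are determined by the common point \<open>slice_lift z = slice_lift z'\<close>.\<close>

lemma to_X_cong: assumes "z \<in> Z" "z' \<in> Z" "to_V z = to_V z'" shows "to_X z = to_X z'"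
  using twist_slice_lift[OF assms(1)] twist_slice_lift[OF assms(2)] assms(3) by (simp add: slice_lift_def)

text \<open>In the first direction \<open>z'\<close> and \<open>scl s t z\<close> have the same image in \<open>V\<close>, for some \<open>s\<close> and \<open>t\<close> with
  \<open>s ^ w 0 = t ^ v 0\<close>. The scaling of the target space by a \<open>v 0\<close>-th root of \<open>s\<close> removes \<open>s\<close> and changes
  \<open>t\<close> to a \<open>v 0\<close>-th root of unity \<open>\<tau>\<close>; then \<open>scl 1 \<tau> z\<close> and \<open>z\<close> have the same image in \<open>V\<close>, and
  \<open>to_X_cong\<close> applies.\<close>

lemma fibre:
  assumes z: "z \<in> Z" "z' \<in> Z"
  shows "(\<exists>\<gamma>\<in>roots_of_unity l. to_V z' = twist_action \<gamma> (to_V z)) \<longleftrightarrow> to_X z = to_X z'"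
proof
  assume "\<exists>\<gamma>\<in>roots_of_unity l. to_V z' = twist_action \<gamma> (to_V z)"
  then obtain \<gamma> where \<gamma>: "\<gamma> \<in> roots_of_unity l" "to_V z' = twist_action \<gamma> (to_V z)" by blast
  obtain s t where st: "s ^ w 0 * \<gamma> = 1" "t ^ v 0 * \<gamma> = 1" "scl s t z \<in> Z"
    "twist_action \<gamma> (to_V z) = to_V (scl s t z)" by (rule act_Z[OF \<gamma>(1) z(1)])
  have nz: "s \<noteq> 0" "\<gamma> \<noteq> 0" using st(1) pos by (auto simp: power_0_left)
  obtain u where u: "u ^ v 0 = s" "u \<noteq> 0" using complex_nth_root_exists[OF pos(3) nz(1)] by blast
  define \<tau> where "\<tau> = t / u ^ w 0"
  have "s ^ w 0 = t ^ v 0" using st(1,2) nz(2) by (metis mult_right_cancel)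
  moreover have "(u ^ w 0) ^ v 0 = s ^ w 0" using u(1) by (metis power_mult mult.commute)
  moreover have "t \<noteq> 0" using st(2) pos by (auto simp: power_0_left)
  ultimately have \<tau>: "\<tau> ^ v 0 = 1" by (simp add: \<tau>_def power_divide)
  have "scl s t z = weighted_scale tw u (scl 1 \<tau> z)"
    unfolding weighted_scale_tw scl_scl using u by (simp add: \<tau>_def)
  then have 1: "to_X (scl s t z) = to_X (scl 1 \<tau> z)" using u(2) by (simp add: to_X_def)
  have "scl 1 \<tau> z \<in> Z" by (rule Z_scl[OF z(1) root_in_scalars]) (simp_all add: \<tau>)
  then have 2: "to_X (scl 1 \<tau> z) = to_X z" by (rule to_X_cong[OF _ z(1) to_V_scl]) (simp_all add: \<tau>)
  have "to_X z' = to_X (scl s t z)" by (rule to_X_cong[OF z(2) st(3)]) (simp add: \<gamma>(2) st(4))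
  with 1 2 show "to_X z = to_X z'" by simp
next
  assume "to_X z = to_X z'"
  then obtain u where u: "u ^ M = 1" "z' = weighted_scale tw u z"
    using to_X_eq_iff[OF Z_slice[OF z(1)] Z_slice[OF z(2)]] by blast
  have "u \<noteq> 0" using u(1) pos(4) by (auto simp: power_0_left)
  define \<gamma> where "\<gamma> = 1 / u ^ (v 0 * w 0)"
  have "\<gamma> ^ l = 1" using u(1) by (simp add: \<gamma>_def power_divide mult_ac flip: power_mult)
  moreover have "twist_action \<gamma> (to_V z) = to_V (scl (u ^ v 0) (u ^ w 0) z)"
    by (rule act_to_V) (use \<open>u \<noteq> 0\<close> in \<open>simp_all add: \<gamma>_def mult.commute flip: power_mult\<close>)
  ultimately show "\<exists>\<gamma>\<in>roots_of_unity l. to_V z' = twist_action \<gamma> (to_V z)"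
    unfolding u(2) weighted_scale_tw roots_of_unity_def by auto
qed

text \<open>The common part of both assertions: \<open>Q\<close> is any space of which \<open>Z\<close> is an open quotient chart with dense
  image and with the same fibres as \<open>to_X\<close>. The birational map is \<open>\<pi>X\<close> followed by the isomorphism \<open>\<Psi>\<close> of the
  two images of \<open>Z\<close>, and \<open>\<kappa>\<close> agrees with its composition with \<open>\<Phi>t\<close> at the points over \<open>Z\<close>.\<close>

lemma resolves_quotient:
  assumes Q: "open_quotient R0 Q \<rho>"
    and fib: "\<And>z z'. z \<in> Z \<Longrightarrow> z' \<in> Z \<Longrightarrow> \<rho> z = \<rho> z' \<longleftrightarrow> to_X z = to_X z'"
    and dense: "\<And>A a. openin (topo Q) A \<Longrightarrow> a \<in> A \<Longrightarrow> \<exists>z\<in>Z. \<rho> z \<in> A"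
    and \<kappa>: "\<And>z. z \<in> Z \<Longrightarrow> \<kappa> (slice_lift z) = \<rho> z"
  shows "resolves_via Vt U \<Phi>t Xt Q \<kappa>"
proof -
  obtain \<Psi> where \<Psi>: "\<And>z. z \<in> Z \<Longrightarrow> \<Psi> (to_X z) = \<rho> z"
    and iso: "isomorphism (subspace_fun X (to_X ` Z)) (subspace_fun Q (\<rho> ` Z)) \<Psi>"
    by (rule open_quotient_isomorphism[OF swf_R0 quotient_X Q]) (use fib in \<open>unfold pts_R0, auto\<close>)
  have oX: "openin (topo X) (to_X ` Z)" using open_quotient_image[OF quotient_X] unfolding pts_R0 .
  have oQ: "openin (topo Q) (\<rho> ` Z)" using open_quotient_image[OF Q] unfolding pts_R0 .
  \<comment> \<open>\<open>\<pi>X\<close> is invertible over \<open>WX\<close> only, so both images are restricted accordingly.\<close>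
  define XW where "XW = WX \<inter> to_X ` Z"
  define QW where "QW = \<rho> ` {z\<in>Z. to_X z \<in> WX}"
  define D where "D = {b\<in>UX. \<pi>X b \<in> XW}"
  have oXW: "openin (topo X) XW" unfolding XW_def using rX.open_W oX by blast
  have \<rho>QW: "\<rho> z \<in> QW \<longleftrightarrow> to_X z \<in> WX" if "z \<in> Z" for z
    using that fib unfolding QW_def by (auto simp: image_iff)
  have oQW: "openin (topo Q) QW"
  proof (rule open_quotientD(2)[OF Q])
    show "QW \<subseteq> \<rho> ` pts R0" unfolding pts_R0 QW_def by auto
    have "{z\<in>pts R0. \<rho> z \<in> QW} = {z\<in>pts R0. to_X z \<in> WX}" unfolding pts_R0 using \<rho>QW by auto
    then show "openin (topo R0) {z\<in>pts R0. \<rho> z \<in> QW}"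
      using morphismD(3)[OF open_quotientD(1)[OF quotient_X] rX.open_W] by simp
  qed
  have "{a\<in>to_X ` Z. \<Psi> a \<in> QW} = XW" unfolding XW_def using \<rho>QW \<Psi> by auto
  then have iso2: "isomorphism (subspace_fun X XW) (subspace_fun Q QW) \<Psi>"
    using isomorphism_restrict[OF iso oX oQ oQW] by (auto simp: QW_def)
  have iso1: "isomorphism (subspace_fun Xt D) (subspace_fun X XW) \<pi>X"
    unfolding D_def by (rule isomorphism_restrict[OF rX.iso rX.open_U rX.open_W oXW]) (simp add: XW_def)
  have oD: "openin (topo Xt) D"
  proof -
    have "D = UX \<inter> {b\<in>pts Xt. \<pi>X b \<in> XW}" unfolding D_def using rX.U_pts by auto
    then show ?thesis using rX.open_U morphismD(3)[OF rX.mor oXW] by auto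
  qed
  have dD: "dense_open Xt D"
  proof (rule dense_openI[OF oD])
    fix A a assume A: "openin (topo Xt) A" "a \<in> A"
    obtain b where b: "b \<in> A" "b \<in> UX" using dense_openD(2)[OF rX.U A] by blast
    then have "\<pi>X b \<in> {b\<in>WX. gX b \<in> A}" using rX.to_W rX.inv_left by simp
    then obtain z where z: "z \<in> Z" "to_X z \<in> {b\<in>WX. gX b \<in> A}" by (rule dense_X[OF rX.openin_inv[OF A(1)]])
    then have "gX (to_X z) \<in> D" using rX.inv_U rX.inv_right by (auto simp: D_def XW_def)
    with z show "\<exists>b. b \<in> A \<and> b \<in> D" by blast
  qed
  have dQW: "dense_open Q QW"
  proof (rule dense_openI[OF oQW])
    fix A a assume A: "openin (topo Q) A" "a \<in> A"
    then obtain z0 where z0: "z0 \<in> Z" "\<rho> z0 \<in> A" using dense by blast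
    have "openin (topo R0) {z\<in>pts R0. \<rho> z \<in> A}" by (rule morphismD(3)[OF open_quotientD(1)[OF Q] A(1)])
    then have "openin (topo R0) {z\<in>Z. \<rho> z \<in> A}" unfolding pts_R0 .
    then obtain z where "z \<in> {z\<in>Z. \<rho> z \<in> A}" "to_X z \<in> WX" by (rule meets_WX) (use z0 in auto)
    then show "\<exists>b. b \<in> A \<and> b \<in> QW" by (auto simp: QW_def)
  qed
  have "birational_resolution Xt Q D (\<Psi> \<circ> \<pi>X)"
    unfolding birational_resolution_def birational_map_def
    using complete_Xt smooth_Xt dD dQW isomorphism_compose[OF iso1 iso2] by blast
  moreover have "dense_open Vt {a\<in>slice_lift ` Z. \<Phi>t a \<in> D}"
  proof (rule dense_openI)
    have oV: "openin (topo Vt) (slice_lift ` Z)" using open_quotient_image[OF quotient_Vt] unfolding pts_R0 .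
    have "openin (topo Vt) {a\<in>pts (subspace_fun Vt U). \<Phi>t a \<in> D}"
      using morphismD(3)[OF \<Phi>t oD] by (simp add: openin_open_subtopology[OF open_U])
    moreover have "{a\<in>slice_lift ` Z. \<Phi>t a \<in> D} = slice_lift ` Z \<inter> {a\<in>pts (subspace_fun Vt U). \<Phi>t a \<in> D}"
      using slice_lift by auto
    ultimately show "openin (topo Vt) {a\<in>slice_lift ` Z. \<Phi>t a \<in> D}" using oV by auto
    fix A a assume A: "openin (topo Vt) A" "a \<in> A"
    obtain z0 where z0: "z0 \<in> Z" "slice_lift z0 \<in> A" by (rule dense_Vt[OF A])
    have "openin (topo R0) {z\<in>pts R0. slice_lift z \<in> A}"
      by (rule morphismD(3)[OF open_quotientD(1)[OF quotient_Vt] A(1)])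
    then have "openin (topo R0) {z\<in>Z. slice_lift z \<in> A}" unfolding pts_R0 .
    then obtain z where z: "z \<in> Z" "slice_lift z \<in> A" "to_X z \<in> WX" by (rule meets_WX) (use z0 in auto)
    \<comment> \<open>The image under \<open>\<Phi>t\<close> lies over \<open>WX\<close>, hence in \<open>UX\<close> by separatedness.\<close>
    have "\<Phi>t (slice_lift z) \<in> UX" by (rule rX.mem_U[OF \<Phi>t_pts[OF z(1)]]) (simp add: twist_slice_lift z)
    then have "\<Phi>t (slice_lift z) \<in> D" using z by (simp add: D_def XW_def twist_slice_lift)
    with z show "\<exists>b. b \<in> A \<and> b \<in> {a\<in>slice_lift ` Z. \<Phi>t a \<in> D}" by blast
  qed
  moreover have "{a\<in>slice_lift ` Z. \<Phi>t a \<in> D} \<subseteq> U" using slice_lift by auto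
  moreover have "(\<Psi> \<circ> \<pi>X) (\<Phi>t a) = \<kappa> a" if "a \<in> slice_lift ` Z" for a
    using that by (auto simp: twist_slice_lift \<Psi> \<kappa>)
  ultimately show ?thesis unfolding resolves_via_def
    by (intro exI[of _ D] exI[of _ "\<Psi> \<circ> \<pi>X"] exI[of _ "{a\<in>slice_lift ` Z. \<Phi>t a \<in> D}"]) auto
qed

abbreviation G where "G \<equiv> roots_of_unity l"

lemma one_G: "1 \<in> G" by (simp add: roots_of_unity_def)

lemma resolves_V_quotient:
  "resolves_via Vt U \<Phi>t Xt (orbit_space V G twist_action) (\<lambda>a. orbit G twist_action (\<pi>V a))"
proof (rule resolves_quotient)
  have self: "a \<in> orbit G twist_action a" for a
    unfolding orbit_def by (rule image_eqI[of _ _ 1]) (simp_all add: twist_action_1 one_G)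
  show "open_quotient R0 (orbit_space V G twist_action) (\<lambda>z. orbit G twist_action (to_V z))"
  proof (rule open_quotient_orbit_space[OF quotient_V self])
    fix \<gamma> z assume \<gamma>: "\<gamma> \<in> G" and "z \<in> pts R0"
    then have z: "z \<in> Z" by (simp only: pts_R0)
    obtain s t where "s ^ w 0 * \<gamma> = 1" "t ^ v 0 * \<gamma> = 1" "scl s t z \<in> Z"
      "twist_action \<gamma> (to_V z) = to_V (scl s t z)" by (rule act_Z[OF \<gamma> z])
    then show "twist_action \<gamma> (to_V z) \<in> to_V ` pts R0" unfolding pts_R0 by simp
  qed
  show "orbit G twist_action (to_V z) = orbit G twist_action (to_V z') \<longleftrightarrow> to_X z = to_X z'"
    if "z \<in> Z" "z' \<in> Z" for z z'
    using orbit_roots_of_unity_eq_iff[of twist_action "to_V z" "to_V z'" l] fibre[OF that] pos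
    by (simp add: twist_action_1 twist_action_mult)
  show "\<exists>z\<in>Z. orbit G twist_action (to_V z) \<in> A"
    if A: "openin (topo (orbit_space V G twist_action)) A" "a \<in> A" for A a
  proof -
    have o: "openin (topo V) {b\<in>pts V. orbit G twist_action b \<in> A}"
      using A(1) unfolding openin_orbit_space by blast
    obtain b where "b \<in> {b\<in>pts V. orbit G twist_action b \<in> A}"
      using A unfolding openin_orbit_space by auto
    then obtain z where "z \<in> Z" "to_V z \<in> {b\<in>pts V. orbit G twist_action b \<in> A}"
      by (rule dense_V[OF o])
    then show ?thesis by blast
  qed
qed (simp add: slice_lift)

text \<open>The chart of \<open>Vt\<close> is equivariant: \<open>\<sigma> \<gamma>\<close> of a point over \<open>Z\<close> lies over a point of \<open>Z\<close>
  again, and is the only point of \<open>Vt\<close> with that image in \<open>V\<close>.\<close>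

lemma resolves_Vt_quotient:
  "resolves_via Vt U \<Phi>t Xt (orbit_space Vt G \<sigma>) (orbit G \<sigma>)"
proof (rule resolves_quotient)
  have \<sigma>: "\<sigma> 1 a = a" "\<And>\<gamma>. \<gamma> \<in> G \<Longrightarrow> \<pi>V (\<sigma> \<gamma> a) = twist_action \<gamma> (\<pi>V a)"
    "\<And>\<gamma>. \<gamma> \<in> G \<Longrightarrow> \<sigma> \<gamma> a \<in> pts Vt"
    "\<And>\<gamma> \<delta>. \<gamma> \<in> G \<Longrightarrow> \<delta> \<in> G \<Longrightarrow> \<sigma> (\<gamma> * \<delta>) a = \<sigma> \<gamma> (\<sigma> \<delta> a)" if "a \<in> pts Vt" for a
  proof -
    note * = act[unfolded lifted_action_def, THEN conjunct2, rule_format, OF that]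
    show "\<sigma> 1 a = a" using * by blast
    show "\<pi>V (\<sigma> \<gamma> a) = twist_action \<gamma> (\<pi>V a)" if "\<gamma> \<in> G" for \<gamma> using * that by blast
    show "\<sigma> (\<gamma> * \<delta>) a = \<sigma> \<gamma> (\<sigma> \<delta> a)" if "\<gamma> \<in> G" "\<delta> \<in> G" for \<gamma> \<delta> using * that by blast
    show "\<sigma> \<gamma> a \<in> pts Vt" if "\<gamma> \<in> G" for \<gamma>
      using act[unfolded lifted_action_def, THEN conjunct1, rule_format, OF that] \<open>a \<in> pts Vt\<close>
      by (rule morphismD(2))
  qed
  have \<sigma>_slice_lift: "\<sigma> \<gamma> (slice_lift z) = slice_lift z' \<longleftrightarrow> twist_action \<gamma> (to_V z) = to_V z'"
    if "\<gamma> \<in> G" "z \<in> Z" "z' \<in> Z" for \<gamma> z z'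
  proof
    have a: "slice_lift z \<in> pts Vt" "\<pi>V (slice_lift z) = to_V z" "\<pi>V (slice_lift z') = to_V z'" using slice_lift that by auto
    show "twist_action \<gamma> (to_V z) = to_V z'" if "\<sigma> \<gamma> (slice_lift z) = slice_lift z'"
      using \<sigma>(2)[OF a(1) \<open>\<gamma> \<in> G\<close>] a that by simp
    assume eq: "twist_action \<gamma> (to_V z) = to_V z'"
    have p: "\<pi>V (\<sigma> \<gamma> (slice_lift z)) = to_V z'" using \<sigma>(2)[OF a(1) \<open>\<gamma> \<in> G\<close>] a eq by simp
    then have "\<sigma> \<gamma> (slice_lift z) \<in> UV"
      using rV.mem_U[OF \<sigma>(3)[OF a(1) \<open>\<gamma> \<in> G\<close>]] Z_liftable(1)[OF \<open>z' \<in> Z\<close>] by simp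
    from rV.inv_left[OF this] show "\<sigma> \<gamma> (slice_lift z) = slice_lift z'" unfolding p by (simp add: slice_lift_def[of z'])
  qed
  show "open_quotient R0 (orbit_space Vt G \<sigma>) (\<lambda>z. orbit G \<sigma> (slice_lift z))"
  proof (rule open_quotient_orbit_space[OF quotient_Vt])
    show "a \<in> orbit G \<sigma> a" if "a \<in> pts Vt" for a
      unfolding orbit_def by (rule image_eqI[of _ _ 1]) (simp_all add: \<sigma>(1)[OF that] one_G)
    fix \<gamma> z assume \<gamma>: "\<gamma> \<in> G" and "z \<in> pts R0"
    then have z: "z \<in> Z" by (simp only: pts_R0)
    obtain s t where st: "s ^ w 0 * \<gamma> = 1" "t ^ v 0 * \<gamma> = 1" "scl s t z \<in> Z"
      "twist_action \<gamma> (to_V z) = to_V (scl s t z)" by (rule act_Z[OF \<gamma> z])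
    then have "\<sigma> \<gamma> (slice_lift z) = slice_lift (scl s t z)" using \<sigma>_slice_lift[OF \<gamma> z st(3)] by simp
    then show "\<sigma> \<gamma> (slice_lift z) \<in> slice_lift ` pts R0" using st(3) unfolding pts_R0 by simp
  qed
  show "orbit G \<sigma> (slice_lift z) = orbit G \<sigma> (slice_lift z') \<longleftrightarrow> to_X z = to_X z'"
    if z: "z \<in> Z" "z' \<in> Z" for z z'
  proof -
    have "orbit G \<sigma> (slice_lift z) = orbit G \<sigma> (slice_lift z') \<longleftrightarrow> (\<exists>\<gamma>\<in>G. slice_lift z' = \<sigma> \<gamma> (slice_lift z))"
      by (rule orbit_roots_of_unity_eq_iff) (use \<sigma> slice_lift(4) z pos in auto)
    also have "\<dots> \<longleftrightarrow> (\<exists>\<gamma>\<in>G. to_V z' = twist_action \<gamma> (to_V z))"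
      using \<sigma>_slice_lift[OF _ z] by (auto simp: eq_commute)
    finally show ?thesis using fibre[OF z] by simp
  qed
  show "\<exists>z\<in>Z. orbit G \<sigma> (slice_lift z) \<in> A"
    if A: "openin (topo (orbit_space Vt G \<sigma>)) A" "a \<in> A" for A a
  proof -
    have o: "openin (topo Vt) {b\<in>pts Vt. orbit G \<sigma> b \<in> A}"
      using A(1) unfolding openin_orbit_space by blast
    obtain b where "b \<in> {b\<in>pts Vt. orbit G \<sigma> b \<in> A}"
      using A unfolding openin_orbit_space by auto
    then obtain z where "z \<in> Z" "slice_lift z \<in> {b\<in>pts Vt. orbit G \<sigma> b \<in> A}"
      by (rule dense_Vt[OF o])
    then show ?thesis by blast
  qed
qed simp

end

lemma normalized_weights_pos: "normalized_weights n w \<Longrightarrow> 1 \<le> n"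
  by (cases n) (auto simp: normalized_weights_def)

theorem corollary3p3:
  fixes n m l :: nat
    and w v :: "nat \<Rightarrow> nat"
    and p q :: cpoly
    and V :: "((nat \<Rightarrow> complex) set \<times> (nat \<Rightarrow> complex) set) fspace"
    and X :: "(nat \<Rightarrow> complex) set fspace"
    and Vt :: "'a fspace"
    and Xt :: "'b fspace"
    and \<pi>V :: "'a \<Rightarrow> (nat \<Rightarrow> complex) set \<times> (nat \<Rightarrow> complex) set"
    and \<pi>X :: "'b \<Rightarrow> (nat \<Rightarrow> complex) set"
    and \<sigma> :: "complex \<Rightarrow> 'a \<Rightarrow> 'a"
    and U :: "'a set"
    and \<Phi>t :: "'a \<Rightarrow> 'b"
  assumes "\<forall>i\<le>n. 0 < w i" and "\<forall>j\<le>m. 0 < v j"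
    and "normalized_weights n w" and "normalized_weights m v"
    and "1 \<le> l"
    and "poly_vars p \<subseteq> {1..n}" and "weighted_homogeneous w (l * w 0) p" and "quasi_smooth {1..n} p"
    and "poly_vars q \<subseteq> {1..m}" and "weighted_homogeneous v (l * v 0) q" and "quasi_smooth {1..m} q"
    and "V = prod_fspace (cyclic_hypersurface n w l p) (cyclic_hypersurface m v l q)"
    and "X = twist_hypersurface n m w v p q"
    and "resolution Vt V \<pi>V" and "lifted_action l Vt \<sigma> \<pi>V twist_action"
    and "resolution Xt X \<pi>X"
    and "rational_map Vt U Xt \<Phi>t" and "lifts_twist n m w v U \<Phi>t \<pi>V \<pi>X"
  shows "resolves_via Vt U \<Phi>t Xt
           (orbit_space V (roots_of_unity l) twist_action)
           (\<lambda>a. orbit (roots_of_unity l) twist_action (\<pi>V a))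
       \<and> resolves_via Vt U \<Phi>t Xt
           (orbit_space Vt (roots_of_unity l) \<sigma>)
           (orbit (roots_of_unity l) \<sigma>)"
proof -
  note V = assms(12) and X = assms(13)
  interpret twist_data n m l w v p q
    by unfold_locales (use assms normalized_weights_pos in auto)
  obtain UV WV gV where "birational_morphism Vt V \<pi>V UV WV gV"
    by (rule resolution_birational_morphism[OF assms(14)])
  moreover obtain UX WX gX where "birational_morphism Xt X \<pi>X UX WX gX"
    by (rule resolution_birational_morphism[OF assms(16)])
  moreover have "complete_variety Xt" "smooth Xt"
    using assms(16) by (auto simp: resolution_def birational_resolution_def)
  moreover have "dense_open Vt U" "morphism (subspace_fun Vt U) Xt \<Phi>t"
    using assms(17) by (auto simp: rational_map_def)
  ultimately interpret twist_resolution n m l w v p q Vt Xt \<pi>V \<pi>X UV WV gV UX WX gX \<sigma> U \<Phi>t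
    using assms(15,18) unfolding V X
    by (intro twist_resolution.intro twist_resolution_axioms.intro twist_data_axioms)
  show ?thesis unfolding V using resolves_V_quotient resolves_Vt_quotient by blast
qed

end
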